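(* Let $\Omega\subseteq\mathbb{H}^n$ be a domain and let $u\in PSH(\Omega)$, $u\not\equiv-\infty$. Then $\triangle u$ is a closed positive $2$-current on $\Omega$.
   Context: Points of $\mathbb{H}^n\cong\mathbb{R}^{4n}$ are $q=(q_0,\dots,q_{n-1})$, $q_l=x_{4l}+\mathbf{i}x_{4l+1}+\mathbf{j}x_{4l+2}+\mathbf{k}x_{4l+3}$. Define (here $\mathbf{i}$ is the imaginary unit of $\mathbb{C}$), for $l=0,\dots,n-1$: $\nabla_{(2l)0}=\partial_{x_{4l}}+\mathbf{i}\partial_{x_{4l+1}}$, $\nabla_{(2l)1}=-\partial_{x_{4l+2}}-\mathbf{i}\partial_{x_{4l+3}}$, $\nabla_{(2l+1)0}=\partial_{x_{4l+2}}-\mathbf{i}\partial_{x_{4l+3}}$, $\nabla_{(2l+1)1}=\partial_{x_{4l}}-\mathbf{i}\partial_{x_{4l+1}}$. Let $\{\omega^0,\dots,\omega^{2n-1}\}$ be a fixed basis of $\mathbb{C}^{2n}$, $\omega^I=\omega^{i_1}\wedge\dots\wedge\omega^{i_p}$, $\Omega_{2n}=\omega^0\wedge\omega^1\wedge\dots\wedge\omega^{2n-1}$. For smooth $F=\sum_I f_I\omega^I$ put $d_\alpha F=\sum_{k,I}\nabla_{k\alpha}f_I\,\omega^k\wedge\omega^I$ ($\alpha=0,1$) and $\triangle F=d_0d_1F$. If $F=f\,\Omega_{2n}$ with $f\in L^1(\Omega)$, $\int_\Omega F:=\int_\Omega f\,dV$ ($dV$ Lebesgue measure). An upper semicontinuous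 function $u:\Omega\to[-\infty,\infty)$ is plurisubharmonic ($u\in PSH(\Omega)$) if its restriction to each right quaternionic line $\{a+b\lambda:\lambda\in\mathbb{H}\}$ (intersected with $\Omega$) is subharmonic. Strong positivity: for $a=a^0+\mathbf{i}a^1+\mathbf{j}a^2+\mathbf{k}a^3\in\mathbb{H}$ put $\tau(a)=\begin{pmatrix}a^0-\mathbf{i}a^1&-a^2+\mathbf{i}a^3\\ a^2+\mathbf{i}a^3&a^0+\mathbf{i}a^1\end{pmatrix}$, extended entrywise (blockwise) to quaternionic matrices. For a right $\mathbb{H}$-linear $\eta:\mathbb{H}^n\to\mathbb{H}$ (a $1\times n$ quaternionic matrix) put $\eta^*\widetilde\omega^p=\sum_{j=0}^{2n-1}\tau(\eta)_{pj}\omega^j$, $p=0,1$. Elementary strongly positive elements of $\wedge^{2k}\mathbb{C}^{2n}$ are those of the form $\eta_1^*\widetilde\omega^0\wedge\eta_1^*\widetilde\omega^1\wedge\dots\wedge\eta_k^*\widetilde\omega^0\wedge\eta_k^*\widetilde\omega^1$ with $\eta_1,\dots,\eta_k$ linearly independent right $\mathbb{H}$-linear maps; $SP^{2k}\mathbb{C}^{2n}$ (strongly positive elements) is the convex cone they generate (for $k=0$: $[0,\infty)$). Currents: a $p$-current on $\Omega$ is an element of the dual of the space $\mathcal{D}^{2n-p}(\Omega)=C_0^\infty(\Omega,\wedge^{2n-p}\mathbb{C}^{2n})$ of test $(2n-p)$-forms. A locally integrable $p$-form $\psi$ is identified with the current $\varphi\mapsto\int_\Omega\psi\wedge\varphi$.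 For a current $F$, $(d_\alpha F)(\eta):=-F(d_\alpha\eta)$ and $(\triangle F)(\eta):=F(\triangle\eta)$ for test forms $\eta$. $F$ is closed if $d_0F=d_1F=0$. A $2k$-current $T$ is positive if $T(\eta)\ge0$ for every $\eta\in C_0^\infty(\Omega,SP^{2n-2k}\mathbb{C}^{2n})$. *)

theory Defs
  imports "HOL-Analysis.Analysis"
begin

section \<open>Quaternions and the space of quaternionic vectors\<close>

text \<open>The quaternion \<open>a\<^sup>0 + i a\<^sup>1 + j a\<^sup>2 + k a\<^sup>3\<close> is the vector with components
  \<open>a $ 1 = a\<^sup>0\<close>, \<open>a $ 2 = a\<^sup>1\<close>, \<open>a $ 3 = a\<^sup>2\<close>, \<open>a $ 4 = a\<^sup>3\<close>.\<close>

type_synonym quat = "real^4"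

definition qmult :: "quat \<Rightarrow> quat \<Rightarrow> quat" where
  "qmult a b = vector
     [a $ 1 * b $ 1 - a $ 2 * b $ 2 - a $ 3 * b $ 3 - a $ 4 * b $ 4,
      a $ 1 * b $ 2 + a $ 2 * b $ 1 + a $ 3 * b $ 4 - a $ 4 * b $ 3,
      a $ 1 * b $ 3 - a $ 2 * b $ 4 + a $ 3 * b $ 1 + a $ 4 * b $ 2,
      a $ 1 * b $ 4 + a $ 2 * b $ 3 - a $ 3 * b $ 2 + a $ 4 * b $ 1]"

text \<open>The linear order of the index type only serves to number the quaternionic coordinates
  \<open>q\<^sub>0, \<dots>, q\<^bsub>n-1\<^esub>\<close>, where \<open>n = CARD('n)\<close>: \<open>coord l\<close> is the index of \<open>q\<^sub>l\<close>.\<close>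

type_synonym 'n qspace = "(real^4)^'n"

definition coord :: "nat \<Rightarrow> 'n::{finite,linorder}" where
  "coord l = sorted_list_of_set (UNIV :: 'n set) ! l"

definition qline :: "'n qspace \<Rightarrow> 'n qspace \<Rightarrow> quat \<Rightarrow> 'n::finite qspace" where
  "qline a b lam = a + (\<chi> l. qmult (b $ l) lam)"


section \<open>Plurisubharmonic functions\<close>

definition usc_on :: "'a::topological_space set \<Rightarrow> ('a \<Rightarrow> ereal) \<Rightarrow> bool" where
  "usc_on S f \<longleftrightarrow>
     (\<forall>x\<in>S. f x < \<infinity>) \<and> (\<forall>c. openin (top_of_set S) {x \<in> S. f x < c})"

text \<open>Integral of a function with values in \<open>[-\<infinity>,\<infinity>]\<close>, as the difference of the integrals of the
  positive and the negative part (\<open>e2ennreal\<close> maps negative numbers to 0). For an upper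
  semicontinuous function \<open>< \<infinity>\<close> on a compact set the integral of the positive part is finite.\<close>

definition ereal_integral_on :: "'a::euclidean_space set \<Rightarrow> ('a \<Rightarrow> ereal) \<Rightarrow> ereal" where
  "ereal_integral_on S f =
     enn2ereal (\<integral>\<^sup>+x\<in>S. e2ennreal (f x) \<partial>lborel) - enn2ereal (\<integral>\<^sup>+x\<in>S. e2ennreal (- f x) \<partial>lborel)"

text \<open>The function that is constantly \<open>-\<infinity>\<close> counts as subharmonic.\<close>

definition subharmonic_on :: "'a::euclidean_space set \<Rightarrow> ('a \<Rightarrow> ereal) \<Rightarrow> bool" where
  "subharmonic_on U v \<longleftrightarrow> usc_on U v \<and>
     (\<forall>a r. 0 < r \<longrightarrow> cball a r \<subseteq> U \<longrightarrow>
        v a \<le> ereal_integral_on (cball a r) v / ereal (measure lborel (cball a r)))"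

definition PSH :: "'n::finite qspace set \<Rightarrow> ('n qspace \<Rightarrow> ereal) set" where
  "PSH \<Omega> = {u. usc_on \<Omega> u \<and>
     (\<forall>a b. b \<noteq> 0 \<longrightarrow> subharmonic_on {lam. qline a b lam \<in> \<Omega>} (\<lambda>lam. u (qline a b lam)))}"

definition loc_integrable_on :: "'a::euclidean_space set \<Rightarrow> ('a \<Rightarrow> ereal) \<Rightarrow> bool" where
  "loc_integrable_on \<Omega> u \<longleftrightarrow>
     (AE x in lborel. x \<in> \<Omega> \<longrightarrow> \<bar>u x\<bar> \<noteq> \<infinity>) \<and>
     (\<forall>K. compact K \<longrightarrow> K \<subseteq> \<Omega> \<longrightarrow> set_integrable lborel K (\<lambda>x. real_of_ereal (u x)))"


section \<open>The exterior algebra\<close>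

text \<open>An element \<open>\<Sum>\<^sub>I a\<^sub>I \<omega>\<^sup>I\<close> of the exterior algebra is its family of coefficients, indexed by
  finite sets \<open>I = {i\<^sub>1 < \<dots> < i\<^sub>p}\<close> with \<open>\<omega>\<^sup>I = \<omega>\<^bsup>i\<^sub>1\<^esup> \<and> \<dots> \<and> \<omega>\<^bsup>i\<^sub>p\<^esup>\<close>. Degrees are
  integers, so that there are no nonzero elements in negative degree.\<close>

type_synonym ext = "nat set \<Rightarrow> complex"

definition ext_power :: "nat \<Rightarrow> int \<Rightarrow> ext set" where
  "ext_power N p = {a. \<forall>I. a I \<noteq> 0 \<longrightarrow> I \<subseteq> {..<N} \<and> int (card I) = p}"

definition omega :: "nat set \<Rightarrow> ext" where
  "omega I = (\<lambda>J. if J = I then 1 else 0)"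

definition shuffle_sign :: "nat set \<Rightarrow> nat set \<Rightarrow> complex" where
  "shuffle_sign I J = (-1) ^ card {(i, j). i \<in> I \<and> j \<in> J \<and> j < i}"

definition wedge :: "ext \<Rightarrow> ext \<Rightarrow> ext" where
  "wedge a b = (\<lambda>K. \<Sum>I\<in>Pow K. shuffle_sign I (K - I) * a I * b (K - I))"

definition wedge_list :: "ext list \<Rightarrow> ext" where
  "wedge_list as = foldr wedge as (omega {})"


section \<open>Strongly positive elements\<close>

definition tau :: "quat \<Rightarrow> nat \<Rightarrow> nat \<Rightarrow> complex" where
  "tau a p s =
     (if p = 0 then (if s = 0 then Complex (a $ 1) (- a $ 2) else Complex (- a $ 3) (a $ 4))
      else (if s = 0 then Complex (a $ 3) (a $ 4) else Complex (a $ 1) (a $ 2)))"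

text \<open>A right linear map to the quaternions is its row matrix \<open>(\<eta> 0, \<dots>, \<eta> (n - 1))\<close>.\<close>

definition pullback :: "nat \<Rightarrow> (nat \<Rightarrow> quat) \<Rightarrow> nat \<Rightarrow> ext" where
  "pullback n \<eta> p = (\<lambda>I. \<Sum>j<2*n. tau (\<eta> (j div 2)) p (j mod 2) * omega {j} I)"

text \<open>Right linear maps to the quaternions form a left vector space.\<close>

definition qlin_indep :: "nat \<Rightarrow> (nat \<Rightarrow> quat) list \<Rightarrow> bool" where
  "qlin_indep n \<eta>s \<longleftrightarrow>
     (\<forall>c. (\<forall>l<n. (\<Sum>j<length \<eta>s. qmult (c j) ((\<eta>s ! j) l)) = 0) \<longrightarrow> (\<forall>j<length \<eta>s. c j = 0))"

definition elementary_sp :: "nat \<Rightarrow> nat \<Rightarrow> ext set" where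
  "elementary_sp n k =
     {wedge_list (concat (map (\<lambda>\<eta>. [pullback n \<eta> 0, pullback n \<eta> 1]) \<eta>s)) | \<eta>s.
        length \<eta>s = k \<and> qlin_indep n \<eta>s}"

inductive_set SP :: "nat \<Rightarrow> nat \<Rightarrow> ext set" for n k :: nat where
  zero: "(\<lambda>I. 0) \<in> SP n k"
| elementary: "a \<in> elementary_sp n k \<Longrightarrow> a \<in> SP n k"
| add: "a \<in> SP n k \<Longrightarrow> b \<in> SP n k \<Longrightarrow> (\<lambda>I. a I + b I) \<in> SP n k"
| scale: "a \<in> SP n k \<Longrightarrow> 0 \<le> c \<Longrightarrow> (\<lambda>I. complex_of_real c * a I) \<in> SP n k"


section \<open>Differential forms\<close>

type_synonym 'n qform = "'n qspace \<Rightarrow> ext"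

fun iter_deriv :: "'a list \<Rightarrow> ('a::euclidean_space \<Rightarrow> 'b::real_normed_vector) \<Rightarrow> 'a \<Rightarrow> 'b" where
  "iter_deriv [] f = f"
| "iter_deriv (v # vs) f = (\<lambda>x. frechet_derivative (iter_deriv vs f) (at x) v)"

definition smooth :: "('a::euclidean_space \<Rightarrow> 'b::real_normed_vector) \<Rightarrow> bool" where
  "smooth f \<longleftrightarrow> (\<forall>vs. set vs \<subseteq> Basis \<longrightarrow> iter_deriv vs f differentiable_on UNIV)"

text \<open>\<open>partial l s\<close> for \<open>s = 1, 2, 3, 4\<close> is the partial derivative in the real coordinate
  \<open>x\<^bsub>4l+s-1\<^esub>\<close>.\<close>

definition partial ::
    "nat \<Rightarrow> 4 \<Rightarrow> ('n::{finite,linorder} qspace \<Rightarrow> complex) \<Rightarrow> 'n qspace \<Rightarrow> complex" where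
  "partial l s f x = frechet_derivative f (at x) (axis (coord l) (axis s 1))"

definition nabla ::
    "nat \<Rightarrow> nat \<Rightarrow> ('n::{finite,linorder} qspace \<Rightarrow> complex) \<Rightarrow> 'n qspace \<Rightarrow> complex" where
  "nabla k \<alpha> f x = (let l = k div 2 in
     if even k
     then (if \<alpha> = 0 then partial l 1 f x + \<i> * partial l 2 f x
           else - partial l 3 f x - \<i> * partial l 4 f x)
     else (if \<alpha> = 0 then partial l 3 f x - \<i> * partial l 4 f x
           else partial l 1 f x - \<i> * partial l 2 f x))"

definition d_form :: "nat \<Rightarrow> 'n::{finite,linorder} qform \<Rightarrow> 'n qform" where
  "d_form \<alpha> F = (\<lambda>x J. \<Sum>k<2*CARD('n). \<Sum>I\<in>Pow {..<2*CARD('n)}.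
     nabla k \<alpha> (\<lambda>y. F y I) x * wedge (omega {k}) (omega I) J)"

definition laplace_form :: "'n::{finite,linorder} qform \<Rightarrow> 'n qform" where
  "laplace_form F = d_form 0 (d_form 1 F)"

definition form_integral :: "'n::{finite,linorder} qspace set \<Rightarrow> 'n qform \<Rightarrow> complex" where
  "form_integral \<Omega> F = (LINT x:\<Omega>|lborel. F x {..<2*CARD('n)})"

text \<open>The 0-form of an extended real function; it is meaningful up to null sets if the function
  is finite almost everywhere.\<close>

definition zero_form :: "('n qspace \<Rightarrow> ereal) \<Rightarrow> 'n qform" where
  "zero_form u = (\<lambda>x I. if I = {} then complex_of_real (real_of_ereal (u x)) else 0)"


section \<open>Currents\<close>

definition form_support :: "'n::finite qform \<Rightarrow> 'n qspace set" where
  "form_support \<phi> = closure {x. \<exists>I. \<phi> x I \<noteq> 0}"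

text \<open>Test forms on \<open>\<Omega>\<close> are extended by 0 to the whole space.\<close>

definition test_forms :: "'n::{finite,linorder} qspace set \<Rightarrow> int \<Rightarrow> 'n qform set" where
  "test_forms \<Omega> q = {\<phi>. (\<forall>x. \<phi> x \<in> ext_power (2*CARD('n)) q) \<and> (\<forall>I. smooth (\<lambda>x. \<phi> x I)) \<and>
     compact (form_support \<phi>) \<and> form_support \<phi> \<subseteq> \<Omega>}"

definition form_seminorm :: "nat \<Rightarrow> 'n::{finite,linorder} qform \<Rightarrow> real" where
  "form_seminorm m \<phi> = (\<Sum>vs\<in>{vs. set vs \<subseteq> Basis \<and> length vs \<le> m}. \<Sum>I\<in>Pow {..<2*CARD('n)}.
     (SUP x. cmod (iter_deriv vs (\<lambda>y. \<phi> y I) x)))"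

text \<open>Currents are functionals on forms of which only the values on test forms of complementary
  degree matter. A linear functional on test forms is continuous iff on the test forms
  supported in any given compact set it is bounded by one of the \<open>C\<^sup>m\<close> norms.\<close>

type_synonym 'n functional = "'n qform \<Rightarrow> complex"

definition current :: "'n::{finite,linorder} qspace set \<Rightarrow> int \<Rightarrow> 'n functional \<Rightarrow> bool" where
  "current \<Omega> p T \<longleftrightarrow> (let D = test_forms \<Omega> (2 * int CARD('n) - p) in
     (\<forall>\<phi>\<in>D. \<forall>\<psi>\<in>D. T (\<lambda>x I. \<phi> x I + \<psi> x I) = T \<phi> + T \<psi>) \<and>
     (\<forall>\<phi>\<in>D. \<forall>c. T (\<lambda>x I. c * \<phi> x I) = c * T \<phi>) \<and>
     (\<forall>K. compact K \<longrightarrow> K \<subseteq> \<Omega> \<longrightarrow>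
        (\<exists>C m. \<forall>\<phi>\<in>D. form_support \<phi> \<subseteq> K \<longrightarrow> cmod (T \<phi>) \<le> C * form_seminorm m \<phi>)))"

definition current_of_form ::
    "'n::{finite,linorder} qspace set \<Rightarrow> 'n qform \<Rightarrow> 'n functional" where
  "current_of_form \<Omega> \<psi> = (\<lambda>\<phi>. form_integral \<Omega> (\<lambda>x. wedge (\<psi> x) (\<phi> x)))"

definition d_current :: "nat \<Rightarrow> 'n::{finite,linorder} functional \<Rightarrow> 'n functional" where
  "d_current \<alpha> T = (\<lambda>\<eta>. - T (d_form \<alpha> \<eta>))"

definition laplace_current :: "'n::{finite,linorder} functional \<Rightarrow> 'n functional" where
  "laplace_current T = (\<lambda>\<eta>. T (laplace_form \<eta>))"

definition closed_current ::
    "'n::{finite,linorder} qspace set \<Rightarrow> int \<Rightarrow> 'n functional \<Rightarrow> bool" where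
  "closed_current \<Omega> p T \<longleftrightarrow> (\<forall>\<alpha>\<in>{0, 1}. \<forall>\<eta>\<in>test_forms \<Omega> (2 * int CARD('n) - (p + 1)).
     d_current \<alpha> T \<eta> = 0)"

text \<open>Positivity of a current of degree \<open>2k\<close>, where \<open>k \<le> n\<close>.\<close>

definition positive_current ::
    "'n::{finite,linorder} qspace set \<Rightarrow> nat \<Rightarrow> 'n functional \<Rightarrow> bool" where
  "positive_current \<Omega> k T \<longleftrightarrow> (\<forall>\<eta>\<in>test_forms \<Omega> (2 * int CARD('n) - 2 * int k).
     (\<forall>x. \<eta> x \<in> SP CARD('n) (CARD('n) - k)) \<longrightarrow> T \<eta> \<in> \<real>\<^sub>\<ge>\<^sub>0)"

end

theory Submission
  imports Defs
begin

text \<open>Everything reduces to the behaviour of \<open>u\<close> on the right quaternionic lines \<open>a + b\<lambda>\<close>.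

  For local integrability, the sub-mean value inequality on the line through \<open>a\<close> in direction \<open>b\<close>, integrated
  over all \<open>b\<close> in the unit ball, controls the integral of \<open>u\<close> over a full ball around \<open>a\<close>: for fixed
  \<open>\<lambda>\<close> the map \<open>b \<mapsto> b\<lambda>\<close> is \<open>\<bar>\<lambda>\<bar>\<close> times an isometry, so that after exchanging the integrals one sees
  integrals of \<open>u\<close> over balls of radius \<open>\<bar>\<lambda>\<bar>\<close> (\<open>PSH_ball_integral_finite\<close>). Hence \<open>u\<close> is integrable
  near every point of \<open>\<Omega>\<close> that is a limit of points with \<open>u > -\<infinity>\<close>, the set of these points is open and
  closed in \<open>\<Omega>\<close>, and connectedness finishes the argument (\<open>PSH_loc_integrable\<close>).

  The current is closed for an algebraic reason: the operators \<open>\<nabla>\<^bsub>k\<alpha>\<^esub>\<close> commute and the left multiplications by \<open>\<omega>\<^sup>k\<close> anticommute,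
  therefore \<open>d\<^sub>0\<close> and \<open>d\<^sub>1\<close> anticommute and have square zero, and \<open>\<triangle> d\<^sub>\<alpha> \<eta> = 0\<close> for every test form
  (\<open>laplace_form_d_form\<close>). Since \<open>\<triangle>\<close> is a second order operator with constant coefficients, the
  current is bounded by the \<open>C\<^sup>2\<close> norm (\<open>current_laplace\<close>).

  Positivity is first studied on constant forms. For a constant elementary strongly positive \<open>c\<close> of degree \<open>2n-2\<close> the top coefficient of
  \<open>\<triangle>g \<and> c\<close> is a nonnegative multiple of the Laplacian of \<open>g\<close> along one right line, namely the common kernel
  of the \<open>n-1\<close> linear maps that define \<open>c\<close>; Gaussian elimination over the quaternions brings the maps to
  a form in which this is visible (\<open>elementary_sp_coeff\<close>, \<open>nabla_form_on_line\<close>). The distributional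
  Laplacian of \<open>u\<close> along a line is nonnegative: it is the limit of difference operators, which by
  translation invariance of the integral may be moved from the test function to \<open>u\<close>, where they express
  the sub-mean value inequality (\<open>line_laplace_nonneg\<close>). A test form \<open>\<eta>\<close> with values in the cone of
  strongly positive elements is approximated by the superposition \<open>\<integral> \<eta>(y) \<rho>(x - y) dy\<close> of constant strongly
  positive elements times nonnegative bump functions. The current is nonnegative on each of them, and
  integration by parts identifies the Laplacian of the superposition with the mollification of
  \<open>\<triangle>\<eta>\<close>, which converges uniformly to \<open>\<triangle>\<eta>\<close> (\<open>positive_laplace\<close>).\<close>

section \<open>Quaternions and their complex matrices\<close>

lemma sum_UNIV_4: "(\<Sum>s\<in>(UNIV::4 set). f s) = f 1 + f 2 + f 3 + (f 4 :: 'a::comm_monoid_add)"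
  unfolding sum_4 by (rule refl)

lemma norm_quat_sq: "(norm (a::quat))\<^sup>2 = (a$1)\<^sup>2 + (a$2)\<^sup>2 + (a$3)\<^sup>2 + (a$4)\<^sup>2"
  by (simp add: norm_vec_def L2_set_def sum_UNIV_4 power2_eq_square)

lemma quat_eqI: "(\<And>s::4. s \<in> {1,2,3,4} \<Longrightarrow> (a::quat) $ s = b $ s) \<Longrightarrow> a = b"
  using UNIV_4 by (metis UNIV_I vec_eq_iff)

lemma vector_4_nth [simp]:
  "(vector [w, x, y, z] :: quat) $ 1 = w" "(vector [w, x, y, z] :: quat) $ 2 = x"
  "(vector [w, x, y, z] :: quat) $ 3 = y" "(vector [w, x, y, z] :: quat) $ 4 = z"
  by (simp_all add: vector_def)

lemma qmult_nth [simp]: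
  "qmult a b $ 1 = a $ 1 * b $ 1 - a $ 2 * b $ 2 - a $ 3 * b $ 3 - a $ 4 * b $ 4"
  "qmult a b $ 2 = a $ 1 * b $ 2 + a $ 2 * b $ 1 + a $ 3 * b $ 4 - a $ 4 * b $ 3"
  "qmult a b $ 3 = a $ 1 * b $ 3 - a $ 2 * b $ 4 + a $ 3 * b $ 1 + a $ 4 * b $ 2"
  "qmult a b $ 4 = a $ 1 * b $ 4 + a $ 2 * b $ 3 - a $ 3 * b $ 2 + a $ 4 * b $ 1"
  by (simp_all add: qmult_def)

definition qunit :: quat where
  "qunit = vector [1, 0, 0, 0]"

lemma qunit_nth [simp]: "qunit $ 1 = 1" "qunit $ 2 = 0" "qunit $ 3 = 0" "qunit $ 4 = 0"
  by (simp_all add: qunit_def)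

lemma qmult_qunit [simp]: "qmult a qunit = a" "qmult qunit a = a"
  by (auto intro!: quat_eqI)

lemma qmult_zero [simp]: "qmult a 0 = 0" "qmult 0 a = 0"
  by (auto intro!: quat_eqI)

text \<open>The indices are those of \<open>2 \<times> 2\<close> matrices: \<open>\<tau>\<close> is a homomorphism of rings into the complex matrices.\<close>

lemma tau_qmult: "p < 2 \<Longrightarrow> s < 2 \<Longrightarrow> tau (qmult a b) p s = tau a p 0 * tau b 0 s + tau a p 1 * tau b 1 s"
  by (cases "p = 0"; cases "s = 0") (auto simp: tau_def complex_eq_iff algebra_simps)

lemma tau_add: "tau (a + b) p s = tau a p s + tau b p s"
  by (auto simp: tau_def complex_eq_iff)

lemma tau_uminus: "tau (- a) p s = - tau a p s"
  by (auto simp: tau_def complex_eq_iff)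

lemma tau_zero [simp]: "tau 0 p s = 0"
  by (auto simp: tau_def complex_eq_iff)

lemma tau_qunit: "p < 2 \<Longrightarrow> s < 2 \<Longrightarrow> tau qunit p s = (if p = s then 1 else 0)"
  by (auto simp: tau_def complex_eq_iff)

text \<open>This determinant is real and nonnegative. That is the source of all signs below: multiplying a linear map
  to the quaternions from the left by \<open>c\<close> changes its elementary strongly positive 2-form by the
  factor \<open>det \<tau>(c)\<close>.\<close>

lemma tau_det: "tau c 0 0 * tau c 1 1 - tau c 0 1 * tau c 1 0 = of_real ((norm c)\<^sup>2)"
  unfolding norm_quat_sq by (auto simp: tau_def complex_eq_iff power2_eq_square)

lemma qinv_exists: "c \<noteq> 0 \<Longrightarrow> \<exists>d. qmult d c = qunit"
proof -
  assume "c \<noteq> 0"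
  define N where "N = c$1 * c$1 + c$2 * c$2 + c$3 * c$3 + c$4 * c$4"
  have "N = (norm c)\<^sup>2" unfolding N_def norm_quat_sq by (simp add: power2_eq_square)
  then have "N \<noteq> 0" using \<open>c \<noteq> 0\<close> by simp
  then have "qmult (vector [c$1 / N, - (c$2) / N, - (c$3) / N, - (c$4) / N]) c = qunit"
    by (auto intro!: quat_eqI simp: field_simps) (simp add: N_def)
  then show ?thesis by blast
qed

section \<open>Exterior multiplication by covectors\<close>

text \<open>The sign that arises when \<open>\<omega>\<^sup>j\<close> is moved from the front to its place in \<open>\<omega>\<^sup>K\<close>.\<close>

definition wedge_sign :: "nat \<Rightarrow> nat set \<Rightarrow> complex" where
  "wedge_sign j K = (-1) ^ card {i\<in>K. i < j}"

text \<open>Left multiplication by \<open>\<omega>\<^sup>j\<close> in coordinates. All later computations with \<open>wedge\<close> have a covector as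
  left factor, so this formula and bilinearity replace associativity of the exterior product.
  On infinite index sets \<open>wedge\<close> vanishes, because its sum ranges over an infinite power set.\<close>

lemma wedge_omega1:
  "wedge (omega {j}) a K = (if finite K \<and> j \<in> K then wedge_sign j K * a (K - {j}) else 0)"
proof (cases "finite K \<and> j \<in> K")
  case True
  have eq: "{(i, j'). i \<in> {j} \<and> j' \<in> K - {j} \<and> j' < i} = Pair j ` {i\<in>K. i < j}" by auto
  have "card {(i, j'). i \<in> {j} \<and> j' \<in> K - {j} \<and> j' < i} = card {i\<in>K. i < j}"
    unfolding eq by (rule card_image) (auto simp: inj_on_def)
  then have s: "shuffle_sign {j} (K - {j}) = wedge_sign j K" by (simp add: shuffle_sign_def wedge_sign_def)
  have "wedge (omega {j}) a K = (\<Sum>I\<in>Pow K. if I = {j} then wedge_sign j K * a (K - {j}) else 0)"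
    unfolding wedge_def by (rule sum.cong) (auto simp: omega_def s)
  then show ?thesis using True by simp
next
  case False
  then show ?thesis
    by (cases "finite K") (auto simp: wedge_def omega_def intro!: sum.neutral)
qed

lemma wedge_sign_swap:
  assumes "finite K" "j \<in> K" "k \<in> K" "j \<noteq> k"
  shows "wedge_sign j K * wedge_sign k (K - {j}) = - (wedge_sign k K * wedge_sign j (K - {k}))"
proof -
  have A: "wedge_sign a (K - {b}) = - wedge_sign a K" if "b \<in> K" "b < a" for a b
  proof -
    have e: "{i\<in>K. i < a} = insert b {i\<in>K - {b}. i < a}" using that by auto
    have "card {i\<in>K. i < a} = Suc (card {i\<in>K - {b}. i < a})"
      unfolding e using assms(1) by (subst card_insert_disjoint) auto
    then show ?thesis by (simp add: wedge_sign_def)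
  qed
  have B: "wedge_sign a (K - {b}) = wedge_sign a K" if "\<not> b < a" for a b
  proof -
    have e: "{i\<in>K. i < a} = {i\<in>K - {b}. i < a}" using that by auto
    show ?thesis by (simp add: wedge_sign_def e)
  qed
  show ?thesis using assms A[of j k] A[of k j] B[of j k] B[of k j]
    by (cases "j < k") auto
qed

lemma wedge_omega1_anticommute:
  "wedge (omega {j}) (wedge (omega {k}) a) K = - wedge (omega {k}) (wedge (omega {j}) a) K"
proof (cases "j = k")
  case True then show ?thesis by (simp add: wedge_omega1)
next
  case False
  have "K - {j} - {k} = K - {k} - {j}" by auto
  then show ?thesis using False wedge_sign_swap[of K j k] 
    by (auto simp: wedge_omega1 mult.assoc[symmetric])
qed

definition one_form :: "nat \<Rightarrow> (nat \<Rightarrow> complex) \<Rightarrow> ext" where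
  "one_form N v = (\<lambda>I. \<Sum>j<N. v j * omega {j} I)"

lemma wedge_one_form: "wedge (one_form N v) a K = (\<Sum>j<N. v j * wedge (omega {j}) a K)"
proof -
  have "wedge (one_form N v) a K = (\<Sum>I\<in>Pow K. \<Sum>j<N. v j * (shuffle_sign I (K - I) * omega {j} I * a (K - I)))"
    unfolding wedge_def one_form_def
    by (intro sum.cong refl) (simp add: sum_distrib_left sum_distrib_right algebra_simps)
  also have "\<dots> = (\<Sum>j<N. \<Sum>I\<in>Pow K. v j * (shuffle_sign I (K - I) * omega {j} I * a (K - I)))"
    by (rule sum.swap)
  finally show ?thesis by (simp add: wedge_def sum_distrib_left)
qed

lemma wedge_scale_right: "wedge a (\<lambda>I. c * b I) K = c * wedge a b K"
  by (simp add: wedge_def sum_distrib_left algebra_simps)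

lemma wedge_add_right: "wedge a (\<lambda>I. b I + b' I) K = wedge a b K + wedge a b' K"
  by (simp add: wedge_def sum.distrib algebra_simps)

lemma wedge_zero_right: "wedge a (\<lambda>I. 0) K = 0"
  by (simp add: wedge_def)

lemma wedge_uminus_right: "wedge a (\<lambda>I. - b I) K = - wedge a b K"
  by (simp add: wedge_def sum_negf)

lemma wedge_sum_right: "wedge a (\<lambda>I. \<Sum>j\<in>A. f j I) K = (\<Sum>j\<in>A. wedge a (f j) K)"
  by (induction A rule: infinite_finite_induct) (simp_all add: wedge_add_right wedge_zero_right)

lemma wedge_one_form_anticommute:
  "wedge (one_form N v) (wedge (one_form N w) a) K = - wedge (one_form N w) (wedge (one_form N v) a) K"
proof -
  have E: "wedge (one_form N v) (wedge (one_form N w) a) K =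
    (\<Sum>j<N. \<Sum>k<N. v j * w k * wedge (omega {j}) (wedge (omega {k}) a) K)" for v w
  proof -
    have "wedge (one_form N w) a = (\<lambda>I. \<Sum>j<N. w j * wedge (omega {j}) a I)"
      by (rule ext) (rule wedge_one_form)
    then show ?thesis
      unfolding wedge_one_form[of N v]
      by (simp only: wedge_sum_right wedge_scale_right sum_distrib_left mult.assoc)
  qed
  show ?thesis unfolding E
    by (subst sum.swap, subst wedge_omega1_anticommute)
      (simp add: sum_negf mult.commute mult.left_commute)
qed

lemma wedge_one_form_twice: "wedge (one_form N v) (wedge (one_form N v) a) = (\<lambda>K. 0)"
proof
  fix K
  have "x = 0" if "x = - x" for x :: complex
  proof -
    have "x + x = 0" using that unfolding eq_neg_iff_add_eq_0 .
    then show ?thesis by (simp flip: mult_2)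
  qed
  then show "wedge (one_form N v) (wedge (one_form N v) a) K = 0"
    using wedge_one_form_anticommute by blast
qed

lemma pullback_eq_one_form:
  "pullback n \<eta> p = one_form (2*n) (\<lambda>j. tau (\<eta> (j div 2)) p (j mod 2))"
  by (simp add: pullback_def one_form_def)

section \<open>Row reduction of elementary strongly positive forms\<close>

text \<open>The operator \<open>a \<mapsto> \<eta>\<^sup>*\<omega>\<^sup>0 \<and> \<eta>\<^sup>*\<omega>\<^sup>1 \<and> a\<close>. An elementary strongly positive form is a product of such operators
  applied to the unit. They behave like rows under elementary row operations: they commute,
  \<open>\<eta> \<mapsto> c\<eta>\<close> multiplies by \<open>\<bar>c\<bar>\<^sup>2\<close>, and a left multiple of one row may be added to another row
  without changing the product.\<close>

definition pair_wedge :: "nat \<Rightarrow> (nat \<Rightarrow> quat) \<Rightarrow> ext \<Rightarrow> ext" where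
  "pair_wedge n \<eta> a = wedge (pullback n \<eta> 0) (wedge (pullback n \<eta> 1) a)"

lemma pullback_anticommute:
  "wedge (pullback n \<eta> p) (wedge (pullback n \<zeta> q) a) = (\<lambda>K. - wedge (pullback n \<zeta> q) (wedge (pullback n \<eta> p) a) K)"
  unfolding pullback_eq_one_form by (rule ext) (rule wedge_one_form_anticommute)

lemma pullback_lmult:
  assumes "p < 2"
  shows "wedge (pullback n (\<lambda>l. qmult c (\<eta> l)) p) a =
     (\<lambda>K. tau c p 0 * wedge (pullback n \<eta> 0) a K + tau c p 1 * wedge (pullback n \<eta> 1) a K)"
  unfolding pullback_eq_one_form 
  by (rule ext) (simp add: wedge_one_form tau_qmult assms sum_distrib_left sum.distrib algebra_simps)

lemma pullback_add:
  "wedge (pullback n (\<lambda>l. \<eta> l + \<zeta> l) p) a = (\<lambda>K. wedge (pullback n \<eta> p) a K + wedge (pullback n \<zeta> p) a K)"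
  unfolding pullback_eq_one_form 
  by (rule ext) (simp add: wedge_one_form tau_add sum.distrib algebra_simps)

lemma pullback_cong: "(\<And>l. l < n \<Longrightarrow> \<eta> l = \<zeta> l) \<Longrightarrow> pullback n \<eta> p = pullback n \<zeta> p"
  unfolding pullback_def by (intro ext sum.cong) auto

lemma pair_wedge_cong: "(\<And>l. l < n \<Longrightarrow> \<eta> l = \<zeta> l) \<Longrightarrow> pair_wedge n \<eta> = pair_wedge n \<zeta>"
  unfolding pair_wedge_def using pullback_cong[of n \<eta> \<zeta>] by (intro ext) auto

lemma pair_wedge_scale: "pair_wedge n \<eta> (\<lambda>I. c * a I) = (\<lambda>K. c * pair_wedge n \<eta> a K)"
  unfolding pair_wedge_def wedge_scale_right[abs_def] ..

lemma pair_wedge_commute: "pair_wedge n \<eta> (pair_wedge n \<zeta> a) = pair_wedge n \<zeta> (pair_wedge n \<eta> a)"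
proof -
  let ?T = "\<lambda>\<eta> p. wedge (pullback n \<eta> p)"
  have m: "?T \<eta> p (\<lambda>K. - b K) = (\<lambda>K. - ?T \<eta> p b K)" for \<eta> p b
    by (rule ext) (rule wedge_uminus_right)
  have "?T \<eta> 0 (?T \<eta> 1 (?T \<zeta> 0 (?T \<zeta> 1 a))) = ?T \<zeta> 0 (?T \<zeta> 1 (?T \<eta> 0 (?T \<eta> 1 a)))"
    by (simp only: pullback_anticommute[of n \<eta> _ \<zeta>] m minus_minus)
  then show ?thesis unfolding pair_wedge_def .
qed

lemma pair_wedge_lmult: "pair_wedge n (\<lambda>l. qmult c (\<eta> l)) a = (\<lambda>K. of_real ((norm c)\<^sup>2) * pair_wedge n \<eta> a K)"
proof
  fix K
  let ?T = "\<lambda>p. wedge (pullback n \<eta> p)"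
  have 0: "?T p (?T p b) K = 0" for p b
    unfolding pullback_eq_one_form wedge_one_form_twice by simp
  have 1: "?T (Suc 0) (?T 0 a) K = - ?T 0 (?T (Suc 0) a) K"
    by (rule fun_cong[OF pullback_anticommute])
  show "pair_wedge n (\<lambda>l. qmult c (\<eta> l)) a K = of_real ((norm c)\<^sup>2) * pair_wedge n \<eta> a K"
  proof -
    let ?t = "tau c"
    have "pair_wedge n (\<lambda>l. qmult c (\<eta> l)) a K =
      ?t 0 0 * (?t 1 0 * ?T 0 (?T 0 a) K + ?t 1 1 * ?T 0 (?T (Suc 0) a) K) +
      ?t 0 1 * (?t 1 0 * ?T (Suc 0) (?T 0 a) K + ?t 1 1 * ?T (Suc 0) (?T (Suc 0) a) K)"
      unfolding pair_wedge_def by (simp add: pullback_lmult wedge_add_right wedge_scale_right)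
    also have "\<dots> = (?t 0 0 * ?t 1 1 - ?t 0 1 * ?t 1 0) * ?T 0 (?T (Suc 0) a) K"
      unfolding 0 1 by (simp add: algebra_simps)
    finally show ?thesis unfolding pair_wedge_def tau_det by simp
  qed
qed

text \<open>Moving \<open>\<delta>\<^sup>*\<omega>\<^sup>0\<close> past \<open>\<eta>\<^sup>*\<omega>\<^sup>1\<close> costs only a sign, so every term of the expansion that contains \<open>\<delta>\<close> hits \<open>a\<close>.\<close>

lemma pair_wedge_add_kills:
  assumes "\<And>p. p < 2 \<Longrightarrow> wedge (pullback n \<delta> p) a = (\<lambda>K. 0)"
  shows "pair_wedge n (\<lambda>l. \<eta> l + \<delta> l) a = pair_wedge n \<eta> a"
proof
  fix K
  have "wedge (pullback n \<delta> 0) (wedge (pullback n \<eta> 1) a) = (\<lambda>K. 0)"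
    using assms by (subst pullback_anticommute) (simp add: wedge_zero_right)
  then show "pair_wedge n (\<lambda>l. \<eta> l + \<delta> l) a K = pair_wedge n \<eta> a K"
    using assms[of 1] unfolding pair_wedge_def by (simp add: pullback_add wedge_add_right wedge_zero_right)
qed

lemma pullback_pair_wedge_same:
  "p < 2 \<Longrightarrow> wedge (pullback n \<eta> p) (pair_wedge n \<eta> a) = (\<lambda>K. 0)"
proof -
  assume "p < 2"
  then consider "p = 0" | "p = 1" by linarith
  then show ?thesis
  proof cases
    case 1 then show ?thesis unfolding pair_wedge_def pullback_eq_one_form by (simp add: wedge_one_form_twice)
  next
    case 2 
    have z: "wedge (pullback n \<eta> 1) (wedge (pullback n \<eta> 1) a) = (\<lambda>K. 0)"
      unfolding pullback_eq_one_form by (rule wedge_one_form_twice)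
    have "wedge (pullback n \<eta> 1) (wedge (pullback n \<eta> 0) (wedge (pullback n \<eta> 1) a)) = (\<lambda>K. 0)"
      by (subst pullback_anticommute) (simp only: z wedge_zero_right minus_zero)
    then show ?thesis using 2 unfolding pair_wedge_def by simp
  qed
qed

lemma pullback_lmult_pair_wedge_same:
  "p < 2 \<Longrightarrow> wedge (pullback n (\<lambda>l. qmult c (\<eta> l)) p) (pair_wedge n \<eta> a) = (\<lambda>K. 0)"
  by (simp add: pullback_lmult pullback_pair_wedge_same)

abbreviation pair_wedges :: "nat \<Rightarrow> (nat \<Rightarrow> nat \<Rightarrow> quat) \<Rightarrow> nat list \<Rightarrow> ext" where
  "pair_wedges n r ls \<equiv> foldr (\<lambda>l. pair_wedge n (r l)) ls (omega {})"

lemma pair_wedges_factor: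
  "l \<in> set ls \<Longrightarrow> \<exists>a. pair_wedges n r ls = pair_wedge n (r l) a"
proof (induction ls)
  case (Cons m ls)
  show ?case
  proof (cases "l = m")
    case False
    then obtain a where "pair_wedges n r ls = pair_wedge n (r l) a" using Cons by auto
    then have "pair_wedges n r (m # ls) = pair_wedge n (r l) (pair_wedge n (r m) a)" by (simp add: pair_wedge_commute)
    then show ?thesis by blast
  qed auto
qed simp

lemma pair_wedges_kills:
  assumes "l \<in> set ls" "p < 2"
  shows "wedge (pullback n (\<lambda>m. qmult c (r l m)) p) (pair_wedges n r ls) = (\<lambda>K. 0)"
  using pair_wedges_factor[OF assms(1), of n r] pullback_lmult_pair_wedge_same[OF assms(2)] by metis

text \<open>The row operation that clears the column of the pivot row \<open>\<eta>\<close>.\<close>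

lemma pair_wedge_pair_wedges_reduce:
  "pair_wedge n \<eta> (pair_wedges n (\<lambda>l m. r l m + qmult (d l) (\<eta> m)) ls) = pair_wedge n \<eta> (pair_wedges n r ls)"
proof (induction ls)
  case (Cons l ls)
  let ?r = "\<lambda>l m. r l m + qmult (d l) (\<eta> m)"
  have "pair_wedge n \<eta> (pair_wedges n ?r (l # ls)) = pair_wedge n (?r l) (pair_wedge n \<eta> (pair_wedges n ?r ls))"
    by (simp add: pair_wedge_commute)
  also have "\<dots> = pair_wedge n (?r l) (pair_wedge n \<eta> (pair_wedges n r ls))" by (simp only: Cons)
  also have "\<dots> = pair_wedge n (r l) (pair_wedge n \<eta> (pair_wedges n r ls))"
    by (rule pair_wedge_add_kills) (rule pullback_lmult_pair_wedge_same)
  finally show ?case by (simp add: pair_wedge_commute)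
qed simp

lemma pullback_zero: "pullback n (\<lambda>l. 0) p = (\<lambda>I. 0)"
  by (simp add: pullback_def)

lemma pullback_sum_kills:
  assumes "finite A" "\<And>m p. m \<in> A \<Longrightarrow> p < 2 \<Longrightarrow> wedge (pullback n (f m) p) a = (\<lambda>K. 0)" "p < 2"
  shows "wedge (pullback n (\<lambda>l. \<Sum>m\<in>A. f m l) p) a = (\<lambda>K. 0)"
  using assms(1,2)
proof (induction A)
  case empty then show ?case by (simp add: pullback_zero wedge_def)
next
  case (insert x F)
  then show ?case using assms(3) by (simp add: pullback_add)
qed

text \<open>Gauss-Jordan elimination: a nonzero product of \<open>k\<close> operators equals, up to a nonnegative factor, a product
  whose rows \<open>r l\<close> are indexed by \<open>k\<close> pivot columns \<open>l\<close> and form the identity matrix in these columns.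
  A new row is first cleared in the pivot columns; if nothing is left the product vanishes, otherwise any
  nonzero entry becomes the next pivot, and normalising it contributes the factor \<open>1/\<bar>c\<bar>\<^sup>2\<close>.\<close>

theorem pair_wedge_row_reduction:
  "(foldr (pair_wedge n) \<eta>s (omega {}) = (\<lambda>K. 0)) \<or>
   (\<exists>\<kappa> ls r. 0 \<le> \<kappa> \<and> distinct ls \<and> set ls \<subseteq> {..<n} \<and> length ls = length \<eta>s \<and>
      (\<forall>l\<in>set ls. \<forall>m\<in>set ls. r l m = (if l = m then qunit else 0)) \<and>
      foldr (pair_wedge n) \<eta>s (omega {}) = (\<lambda>K. of_real \<kappa> * pair_wedges n r ls K))"
proof (induction \<eta>s)
  case Nil
  show ?case by (intro disjI2 exI[of _ 1] exI[of _ "[]"]) auto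
next
  case (Cons \<eta> \<eta>s)
  show ?case
  proof (cases "foldr (pair_wedge n) \<eta>s (omega {}) = (\<lambda>K. 0)")
    case True
    then have "foldr (pair_wedge n) (\<eta> # \<eta>s) (omega {}) = (\<lambda>K. 0)"
      by (simp add: pair_wedge_def wedge_zero_right[abs_def])
    then show ?thesis by blast
  next
    case False
    then obtain \<kappa> ls r where \<kappa>: "0 \<le> \<kappa>" and ls: "distinct ls" "set ls \<subseteq> {..<n}" "length ls = length \<eta>s"
      and r: "\<And>l m. l\<in>set ls \<Longrightarrow> m\<in>set ls \<Longrightarrow> r l m = (if l = m then qunit else 0)"
      and eq: "foldr (pair_wedge n) \<eta>s (omega {}) = (\<lambda>K. of_real \<kappa> * pair_wedges n r ls K)"
      using Cons by blast
    define \<zeta> where "\<zeta> = (\<lambda>m. \<eta> m + (\<Sum>l\<in>set ls. qmult (- \<eta> l) (r l m)))"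
    \<comment> \<open>the new row, cleared in the old pivot columns\<close>
    have \<zeta>1: "pair_wedge n \<zeta> (pair_wedges n r ls) = pair_wedge n \<eta> (pair_wedges n r ls)"
      unfolding \<zeta>_def
      by (rule pair_wedge_add_kills, rule pullback_sum_kills) (auto intro!: pair_wedges_kills)
    have \<zeta>0: "\<zeta> m = 0" if "m \<in> set ls" for m
    proof -
      have "(\<Sum>l\<in>set ls. qmult (- \<eta> l) (r l m)) = (\<Sum>l\<in>set ls. if l = m then - \<eta> m else 0)"
        by (rule sum.cong) (use r that in auto)
      then show ?thesis using that by (simp add: \<zeta>_def)
    qed
    have eq2: "foldr (pair_wedge n) (\<eta> # \<eta>s) (omega {}) = (\<lambda>K. of_real \<kappa> * pair_wedge n \<zeta> (pair_wedges n r ls) K)"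
      by (simp add: eq pair_wedge_scale \<zeta>1)
    show ?thesis
    proof (cases "\<forall>m<n. \<zeta> m = 0")
      case True
      then have "pair_wedge n \<zeta> = pair_wedge n (\<lambda>l. 0)" by (intro pair_wedge_cong) auto
      then have "pair_wedge n \<zeta> (pair_wedges n r ls) = (\<lambda>K. 0)"
        by (simp add: pair_wedge_def pullback_zero) (simp add: wedge_def)
      then show ?thesis using eq2 by simp
    next
      case False
      then obtain m where m: "m < n" "\<zeta> m \<noteq> 0" by blast
      then have mls: "m \<notin> set ls" using \<zeta>0 by blast
      obtain c where c: "qmult c (\<zeta> m) = qunit" using qinv_exists m by blast
      have "c \<noteq> 0" using c by (auto simp: vec_eq_iff[of 0 qunit] dest!: spec[of _ 1] sym[of 0])
      then have cp: "(norm c)\<^sup>2 > 0" by simp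
      define \<xi> where "\<xi> = (\<lambda>l. qmult c (\<zeta> l))"
      have "pair_wedge n \<xi> a K = of_real ((norm c)\<^sup>2) * pair_wedge n \<zeta> a K" for a K
        unfolding \<xi>_def pair_wedge_lmult ..
      then have \<zeta>\<xi>: "pair_wedge n \<zeta> a K = of_real (1 / (norm c)\<^sup>2) * pair_wedge n \<xi> a K" for a K
        using cp by simp
      \<comment> \<open>clear the column of the new pivot in the old rows\<close>
      define r' where "r' = (\<lambda>l k. if l = m then \<xi> k else r l k + qmult (- r l m) (\<xi> k))"
      have fc: "pair_wedges n r' ls = pair_wedges n (\<lambda>l k. r l k + qmult (- r l m) (\<xi> k)) ls"
      proof (rule foldr_cong)
        fix l a assume "l \<in> set ls"
        then have "l \<noteq> m" using mls by blast
        then show "pair_wedge n (r' l) a = pair_wedge n (\<lambda>k. r l k + qmult (- r l m) (\<xi> k)) a"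
          by (simp add: r'_def)
      qed auto
      have "pair_wedges n r' (m # ls) = pair_wedge n \<xi> (pair_wedges n r' ls)" by (simp add: r'_def)
      also have "\<dots> = pair_wedge n \<xi> (pair_wedges n r ls)"
        unfolding fc by (rule pair_wedge_pair_wedges_reduce)
      finally have e3: "pair_wedges n r' (m # ls) = pair_wedge n \<xi> (pair_wedges n r ls)" .
      have neg1: "qmult (- a) qunit = - a" for a by simp
      have \<xi>v: "\<xi> m = qunit" "\<And>l. l \<in> set ls \<Longrightarrow> \<xi> l = 0" using c \<zeta>0 by (auto simp: \<xi>_def)
      have r'v: "\<forall>l\<in>set (m # ls). \<forall>k\<in>set (m # ls). r' l k = (if l = k then qunit else 0)"
        using mls r by (auto simp: r'_def \<xi>v)
      show ?thesis
        apply (intro disjI2 exI[of _ "\<kappa> * (1 / (norm c)\<^sup>2)"] exI[of _ "m # ls"] exI[of _ r'] conjI r'v)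
        subgoal using \<kappa> cp by simp
        subgoal using mls ls by simp
        subgoal using m ls by simp
        subgoal using ls by simp
        subgoal unfolding eq2 e3 \<zeta>\<xi> by (simp add: mult.assoc)
        done
    qed
  qed
qed

lemma wedge_omega1_omega:
  assumes "finite I" "j \<notin> I"
  shows "wedge (omega {j}) (omega I) = (\<lambda>K. wedge_sign j I * omega (insert j I) K)"
proof
  fix K
  have "{i \<in> insert j I. i < j} = {i\<in>I. i < j}" by auto
  then have "wedge_sign j (insert j I) = wedge_sign j I" by (simp add: wedge_sign_def)
  then show "wedge (omega {j}) (omega I) K = wedge_sign j I * omega (insert j I) K"
    unfolding wedge_omega1 using assms by (auto simp: omega_def insert_absorb)
qed

text \<open>The two signs agree because no index lies between \<open>2l\<close> and \<open>2l+1\<close>.\<close>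

lemma wedge_omega_pair:
  assumes "finite I" "2*l \<notin> I" "2*l+1 \<notin> I"
  shows "wedge (omega {2*l}) (wedge (omega {2*l+1}) (omega I)) = omega (insert (2*l) (insert (2*l+1) I))"
proof -
  have "{i \<in> I. i < 2*l+1} = {i \<in> I. i < 2*l}" using assms by (auto simp: less_Suc_eq)
  moreover have "{i \<in> insert (2*l+1) I. i < 2*l} = {i \<in> I. i < 2*l}" by auto
  ultimately have s: "wedge_sign (2*l+1) I * wedge_sign (2*l) (insert (2*l+1) I) = 1"
    by (simp add: wedge_sign_def flip: power_add mult_2)
  have "wedge (omega {2*l}) (wedge (omega {2*l+1}) (omega I)) = 
    (\<lambda>K. wedge_sign (2*l+1) I * wedge (omega {2*l}) (omega (insert (2*l+1) I)) K)"
    by (rule ext) (simp only: wedge_omega1_omega[OF assms(1,3)] wedge_scale_right)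
  also have "\<dots> = (\<lambda>K. (wedge_sign (2*l+1) I * wedge_sign (2*l) (insert (2*l+1) I)) * omega (insert (2*l) (insert (2*l+1) I)) K)"
    using assms by (subst wedge_omega1_omega) (auto simp: mult.assoc)
  finally show ?thesis unfolding s by simp
qed

abbreviation qdelta :: "nat \<Rightarrow> nat \<Rightarrow> quat" where
  "qdelta l m \<equiv> (if l = m then qunit else 0)"

lemma wedge_pullback_two_coords:
  assumes "l < n" "m < n" "l \<noteq> m" "p < 2" "\<And>k. k < n \<Longrightarrow> k \<noteq> l \<Longrightarrow> k \<noteq> m \<Longrightarrow> \<eta> k = 0" "\<eta> l = qunit"
  shows "wedge (pullback n \<eta> p) a K = wedge (omega {2*l+p}) a K + 
    (tau (\<eta> m) p 0 * wedge (omega {2*m}) a K + tau (\<eta> m) p 1 * wedge (omega {2*m+1}) a K)"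
proof -
  let ?f = "\<lambda>j. tau (\<eta> (j div 2)) p (j mod 2) * wedge (omega {j}) a K"
  have sub: "{2*l, 2*l+1, 2*m, 2*m+1} \<subseteq> {..<2*n}" using assms by auto
  have "(\<Sum>j<2*n. ?f j) = (\<Sum>j\<in>{2*l, 2*l+1, 2*m, 2*m+1}. ?f j)"
  proof (rule sum.mono_neutral_right)
    show "\<forall>i\<in>{..<2 * n} - {2*l, 2*l+1, 2*m, 2*m+1}. ?f i = 0"
    proof
      fix i assume i: "i \<in> {..<2 * n} - {2*l, 2*l+1, 2*m, 2*m+1}"
      have "i div 2 \<noteq> l" "i div 2 \<noteq> m" using i by auto
      moreover have "i div 2 < n" using i by auto
      ultimately show "?f i = 0" using assms(5) by simp
    qed
  qed (use sub in auto)
  also have "\<dots> = ?f (2*l) + ?f (2*l+1) + ?f (2*m) + ?f (2*m+1)"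
  proof -
    have "2*l \<noteq> 2*m + 1" "2*l+1 \<noteq> 2*m" by presburger+
    then show ?thesis using assms(3) by (simp add: add.assoc)
  qed
  also have "?f (2*l) + ?f (2*l+1) = wedge (omega {2*l+p}) a K"
  proof -
    from assms(4) consider "p = 0" | "p = 1" by linarith
    then show ?thesis using assms(6) by cases (simp_all add: tau_qunit)
  qed
  finally show ?thesis unfolding pullback_eq_one_form wedge_one_form by (simp add: add.assoc)
qed

lemma pair_wedge_qdelta:
  assumes "l < n"
  shows "pair_wedge n (qdelta l) a = wedge (omega {2*l}) (wedge (omega {2*l+1}) a)"
proof -
  have "wedge (pullback n (qdelta l) p) a = wedge (omega {2*l+p}) a" if "p < 2" for p a
  proof
    fix K
    let ?f = "\<lambda>j. tau (qdelta l (j div 2)) p (j mod 2) * wedge (omega {j}) a K"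
    have "(\<Sum>j<2*n. ?f j) = (\<Sum>j<2*n. if j = 2*l+p then wedge (omega {j}) a K else 0)"
    proof (rule sum.cong)
      fix j :: nat
      have "j = 2 * (j div 2) + j mod 2" by simp
      then have "j = 2*l+p \<longleftrightarrow> l = j div 2 \<and> p = j mod 2" using that by auto
      then show "?f j = (if j = 2*l+p then wedge (omega {j}) a K else 0)"
        using that by (auto simp: tau_qunit)
    qed simp
    then show "wedge (pullback n (qdelta l) p) a K = wedge (omega {2*l+p}) a K"
      unfolding pullback_eq_one_form wedge_one_form using that assms by simp
  qed
  then show ?thesis unfolding pair_wedge_def by (metis add.right_neutral one_less_numeral_iff pos2 semiring_norm(76))
qed

lemma pair_wedges_qdelta:
  assumes "distinct ls" "set ls \<subseteq> {..<n}"
  shows "pair_wedges n qdelta ls = omega {j. j div 2 \<in> set ls}"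
  using assms
proof (induction ls)
  case (Cons l ls)
  let ?I = "{j. j div 2 \<in> set ls}"
  have "finite ?I"
  proof (rule finite_subset)
    show "?I \<subseteq> {..<2*n}"
      using Cons.prems by auto
  qed simp
  moreover have "2*l \<notin> ?I" "2*l+1 \<notin> ?I" using Cons.prems by auto
  ultimately have "pair_wedges n qdelta (l # ls) = omega (insert (2*l) (insert (2*l+1) ?I))"
    using Cons by (simp add: pair_wedge_qdelta wedge_omega_pair[simplified])
  also have "insert (2*l) (insert (2*l+1) ?I) = {j. j div 2 \<in> set (l # ls)}"
    by auto
  finally show ?case .
qed simp

text \<open>With \<open>n-1\<close> rows in reduced form exactly one column \<open>m\<close> is not a pivot column, and the kernel of the rows is
  spanned by the vector \<open>b\<close> with \<open>b m = 1\<close> and \<open>b l = - r l m\<close> for the other \<open>l\<close>. Multiplication by row \<open>l\<close>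
  annihilates the product \<open>W\<close> of all rows, which expresses each \<open>\<omega>\<^sup>k \<and> W\<close> through
  \<open>\<omega>\<^bsup>2m\<^esup> \<and> W\<close> and \<open>\<omega>\<^bsup>2m+1\<^esup> \<and> W\<close> with the entries of \<open>\<tau>(b)\<close> as coefficients. Hence the antisymmetric matrix of
  top coefficients of \<open>\<omega>\<^sup>k \<and> \<omega>\<^sup>l \<and> c\<close> consists of the \<open>2 \<times> 2\<close> minors of \<open>\<tau>(b)\<close>, up to the top coefficient of
  \<open>\<omega>\<^bsup>2m\<^esup> \<and> \<omega>\<^bsup>2m+1\<^esup> \<and> W\<close>, which is 1.\<close>

theorem elementary_sp_coeff:
  assumes "c \<in> elementary_sp n (n - 1)" "0 < n"
  shows "\<exists>\<kappa> b. 0 \<le> \<kappa> \<and> (\<exists>l<n. b l \<noteq> (0::quat)) \<and>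
    (\<forall>k<2*n. \<forall>l<2*n. wedge (omega {k}) (wedge (omega {l}) c) {..<2*n} =
       of_real \<kappa> * (tau (b (k div 2)) (k mod 2) 0 * tau (b (l div 2)) (l mod 2) 1
         - tau (b (k div 2)) (k mod 2) 1 * tau (b (l div 2)) (l mod 2) 0))"
proof -
  obtain \<eta>s where \<eta>s: "length \<eta>s = n - 1"
    "c = wedge_list (concat (map (\<lambda>\<eta>. [pullback n \<eta> 0, pullback n \<eta> 1]) \<eta>s))"
    using assms unfolding elementary_sp_def by auto
  have c: "c = foldr (pair_wedge n) \<eta>s (omega {})"
    unfolding \<eta>s(2) wedge_list_def by (induction \<eta>s) (auto simp: pair_wedge_def)
  show ?thesis
  proof (cases "c = (\<lambda>K. 0)")
    case True
    then show ?thesis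
      by (intro exI[of _ 0] exI[of _ "\<lambda>_. qunit"] conjI exI[of _ 0])
        (use assms(2) in \<open>auto simp: wedge_zero_right[abs_def] vec_eq_iff[of qunit 0] intro!: exI[of _ 1]\<close>)
  next
    case False
    then obtain \<kappa> ls r where \<kappa>: "0 \<le> \<kappa>" and ls: "distinct ls" "set ls \<subseteq> {..<n}" "length ls = n - 1"
      and r: "\<And>l m. l\<in>set ls \<Longrightarrow> m\<in>set ls \<Longrightarrow> r l m = (if l = m then qunit else 0)"
      and eq: "c = (\<lambda>K. of_real \<kappa> * pair_wedges n r ls K)"
      using pair_wedge_row_reduction[of n \<eta>s] \<eta>s(1) unfolding c by metis
    have "card (set ls) = n - 1" using ls distinct_card by metis
    then have "card ({..<n} - set ls) = 1" using ls assms(2) by (simp add: card_Diff_subset)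
    then obtain m where m: "{..<n} - set ls = {m}" using card_1_singletonE by blast
    then have mn: "m < n" "m \<notin> set ls" and cover: "\<And>l. l < n \<Longrightarrow> l \<noteq> m \<Longrightarrow> l \<in> set ls" by auto
    define W where "W = pair_wedges n r ls"
    define b where "b = (\<lambda>l. if l = m then qunit else - r l m)"
    define e where "e = (\<lambda>k a. wedge (omega {k}) a)"
    have e_ac: "e k (e l a) K = - e l (e k a) K" for k l a K
      unfolding e_def by (rule wedge_omega1_anticommute)
    let ?B = "\<lambda>k q. tau (b (k div 2)) (k mod 2) q"
    have red: "e k W K = ?B k 0 * e (2*m) W K + ?B k 1 * e (2*m+1) W K" if k: "k < 2*n" for k K
    proof (cases "k div 2 = m")
      case True
      moreover have "k = 2 * (k div 2) + k mod 2" by simp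
      moreover have "k mod 2 = 0 \<or> k mod 2 = 1" by presburger
      ultimately show ?thesis by (auto simp: b_def tau_qunit)
    next
      case False
      let ?l = "k div 2" and ?p = "k mod 2"
      have l: "?l < n" "?l \<in> set ls" using k cover[of ?l] False by auto
      have "wedge (pullback n (\<lambda>j. qmult qunit (r ?l j)) ?p) W = (\<lambda>K. 0)"
        unfolding W_def by (rule pair_wedges_kills) (use l in auto)
      then have "wedge (pullback n (r ?l) ?p) W K = 0" by simp
      moreover have "wedge (pullback n (r ?l) ?p) W K = e (2 * ?l + ?p) W K + 
        (tau (r ?l m) ?p 0 * e (2*m) W K + tau (r ?l m) ?p 1 * e (2*m+1) W K)"
        unfolding e_def
        by (rule wedge_pullback_two_coords) (use l mn False r cover in auto)
      ultimately show ?thesis using False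
        by (simp add: b_def tau_uminus algebra_simps eq_neg_iff_add_eq_0)
    qed
    have e_lin: "e k (e l W) K = ?B l 0 * e k (e (2*m) W) K + ?B l 1 * e k (e (2*m+1) W) K"
      if "l < 2*n" for k l K
    proof -
      have "e l W = (\<lambda>K. ?B l 0 * e (2*m) W K + ?B l 1 * e (2*m+1) W K)"
        using red[OF that] by blast
      then show ?thesis unfolding e_def by (simp add: wedge_add_right wedge_scale_right)
    qed
    have top: "e (2*m) (e (2*m+1) W) {..<2*n} = 1"
    proof -
      \<comment> \<open>modulo the unit row of column m, the reduced rows are unit rows\<close>
      have fc: "pair_wedges n qdelta ls = pair_wedges n (\<lambda>l j. r l j + qmult (- r l m) (qdelta m j)) ls"
      proof (rule foldr_cong)
        fix l a assume "l \<in> set ls"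
        then have "pair_wedge n (\<lambda>j. r l j + qmult (- r l m) (qdelta m j)) = pair_wedge n (qdelta l)"
          using r mn cover by (intro pair_wedge_cong) (auto simp: )
        then show "pair_wedge n (qdelta l) a = pair_wedge n (\<lambda>j. r l j + qmult (- r l m) (qdelta m j)) a" by simp
      qed auto
      have "e (2*m) (e (2*m+1) W) = pair_wedge n (qdelta m) (pair_wedges n r ls)"
        unfolding e_def W_def using pair_wedge_qdelta[OF mn(1)] by simp
      also have "\<dots> = pair_wedges n qdelta (m # ls)"
        using pair_wedge_pair_wedges_reduce[of n "qdelta m" r "\<lambda>l. - r l m" ls] fc by simp
      also have "\<dots> = omega {j. j div 2 \<in> set (m # ls)}"
        by (rule pair_wedges_qdelta) (use ls mn in auto)
      also have "set (m # ls) = {..<n}" using m ls by auto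
      also have "{j. j div 2 \<in> {..<n}} = {..<2*n}" by auto
      finally show ?thesis by (simp add: omega_def)
    qed
    have z: "e k (e k W) K = 0" for k K
      unfolding e_def by (simp add: wedge_omega1)
    have main: "e k (e l W) {..<2*n} = ?B k 0 * ?B l 1 - ?B k 1 * ?B l 0"
      if "k < 2*n" "l < 2*n" for k l
    proof -
      have "e k (e l W) {..<2*n} = - (?B l 0 * e (2*m) (e k W) {..<2*n} + ?B l 1 * e (2*m+1) (e k W) {..<2*n})"
        unfolding e_lin[OF that(2)] by (simp add: e_ac[of k])
      also have "\<dots> = - (?B l 0 * ?B k 1 * e (2*m) (e (2*m+1) W) {..<2*n} 
            + ?B l 1 * ?B k 0 * e (2*m+1) (e (2*m) W) {..<2*n})"
        by (simp add: e_lin[OF that(1)] z)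
      also have "e (2*m+1) (e (2*m) W) {..<2*n} = - 1"
        using top e_ac by metis
      finally show ?thesis unfolding top by simp
    qed
    have "\<exists>l<n. b l \<noteq> 0" using mn by (intro exI[of _ m]) (auto simp: b_def vec_eq_iff[of qunit 0] intro!: exI[of _ 1])
    moreover have "wedge (omega {k}) (wedge (omega {l}) c) {..<2*n} = of_real \<kappa> * e k (e l W) {..<2*n}" for k l
      unfolding eq e_def W_def by (simp add: wedge_scale_right[abs_def])
    ultimately show ?thesis using main \<kappa>
      by (intro exI[of _ \<kappa>] exI[of _ b]) auto
  qed
qed

section \<open>An explicit bump function\<close>

lemma pos_part_power_deriv:
  "((\<lambda>t::real. (max 0 t) ^ Suc (Suc k)) has_real_derivative real (Suc (Suc k)) * (max 0 t) ^ Suc k) (at t)"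
proof -
  consider "t > 0" | "t < 0" | "t = 0" by linarith
  then show ?thesis
  proof cases
    case 1
    have "((\<lambda>t::real. t ^ Suc (Suc k)) has_real_derivative real (Suc (Suc k)) * t ^ Suc k) (at t)"
      using DERIV_pow[of "Suc (Suc k)" t] by simp
    then have "((\<lambda>t::real. (max 0 t) ^ Suc (Suc k)) has_real_derivative real (Suc (Suc k)) * t ^ Suc k) (at t)"
      by (rule has_field_derivative_transform_within_open[where S="{0<..}"]) (use 1 in auto)
    then show ?thesis using 1 by simp
  next
    case 2
    have "((\<lambda>t::real. (max 0 t) ^ Suc (Suc k)) has_real_derivative 0) (at t)"
      by (rule has_field_derivative_transform_within_open[where S="{..<0}" and f="\<lambda>_. 0"]) (use 2 in auto)
    then show ?thesis using 2 by simp
  next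
    case 3
    have "((\<lambda>t::real. (max 0 t) ^ Suc (Suc k)) has_real_derivative 0) (at 0)"
      unfolding CARAT_DERIV
    proof (intro exI[of _ "\<lambda>z. max 0 z ^ Suc k"] conjI allI)
      show "max 0 z ^ Suc (Suc k) - max 0 0 ^ Suc (Suc k) = max 0 z ^ Suc k * (z - 0)" for z :: real
        by (cases "0 \<le> z") (auto simp: max_def)
    qed (auto intro!: continuous_intros)
    then show ?thesis using 3 by simp
  qed
qed

text \<open>The kernel of the mollification. Being given by a formula, it has explicit first and second
  derivatives (in directions \<open>v\<close> and \<open>v, w\<close>); the third power is the smallest one for which the second derivatives
  are continuous across the sphere \<open>\<bar>x\<bar> = eps\<close>. It is not normalised.\<close>

definition bump :: "real \<Rightarrow> 'a::euclidean_space \<Rightarrow> real" where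
  "bump eps x = (max 0 (eps\<^sup>2 - x \<bullet> x)) ^ 3"

definition bump1 :: "real \<Rightarrow> 'a::euclidean_space \<Rightarrow> 'a \<Rightarrow> real" where
  "bump1 eps x v = - 6 * (max 0 (eps\<^sup>2 - x \<bullet> x))\<^sup>2 * (x \<bullet> v)"

definition bump2 :: "real \<Rightarrow> 'a::euclidean_space \<Rightarrow> 'a \<Rightarrow> 'a \<Rightarrow> real" where
  "bump2 eps x v w = 24 * max 0 (eps\<^sup>2 - x \<bullet> x) * (x \<bullet> v) * (x \<bullet> w) - 6 * (max 0 (eps\<^sup>2 - x \<bullet> x))\<^sup>2 * (v \<bullet> w)"

lemma pos_part_comp_deriv:
  fixes x :: "'a::euclidean_space"
  shows "((\<lambda>x. (max 0 (eps\<^sup>2 - x \<bullet> x)) ^ Suc (Suc k)) has_derivative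
     (\<lambda>v. (real (Suc (Suc k)) * (max 0 (eps\<^sup>2 - x \<bullet> x)) ^ Suc k) * (- 2 * (x \<bullet> v)))) (at x)"
proof -
  have "((\<lambda>x. eps\<^sup>2 - x \<bullet> x) has_derivative (\<lambda>v. - 2 * (x \<bullet> v))) (at x)"
    by (auto intro!: derivative_eq_intros simp: inner_commute)
  moreover have "((\<lambda>t::real. (max 0 t) ^ Suc (Suc k)) has_derivative
      (*) (real (Suc (Suc k)) * (max 0 (eps\<^sup>2 - x \<bullet> x)) ^ Suc k)) (at (eps\<^sup>2 - x \<bullet> x))"
    using pos_part_power_deriv[of k "eps\<^sup>2 - x \<bullet> x"] unfolding has_field_derivative_def .
  ultimately show ?thesis by (rule has_derivative_compose)
qed

lemma bump_deriv: "(bump eps has_derivative bump1 eps x) (at x)"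
  using pos_part_comp_deriv[of eps 1 x]
  by (simp add: bump_def[abs_def] bump1_def[abs_def] numeral_3_eq_3 power2_eq_square algebra_simps)

lemma bump1_deriv: "((\<lambda>x. bump1 eps x v) has_derivative bump2 eps x v) (at x)"
proof -
  have m: "((\<lambda>x. (max 0 (eps\<^sup>2 - x \<bullet> x))\<^sup>2) has_derivative 
     (\<lambda>w. (2 * (max 0 (eps\<^sup>2 - x \<bullet> x))) * (- 2 * (x \<bullet> w)))) (at x)"
    using pos_part_comp_deriv[of eps 0 x] by (simp add: numeral_2_eq_2)
  have "((\<lambda>x. - 6 * (max 0 (eps\<^sup>2 - x \<bullet> x))\<^sup>2 * (x \<bullet> v)) has_derivative
    (\<lambda>w. - 6 * (max 0 (eps\<^sup>2 - x \<bullet> x))\<^sup>2 * (w \<bullet> v) + - 6 * ((2 * (max 0 (eps\<^sup>2 - x \<bullet> x))) * (- 2 * (x \<bullet> w))) * (x \<bullet> v))) (at x)"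
    by (rule derivative_eq_intros m refl)+ (auto simp: algebra_simps)
  then show ?thesis 
    by (simp add: bump1_def[abs_def] bump2_def[abs_def] algebra_simps inner_commute)
qed

lemma continuous_bump [continuous_intros]:
  "continuous_on S f \<Longrightarrow> continuous_on S (\<lambda>x. bump eps (f x))"
  "continuous_on S f \<Longrightarrow> continuous_on S (\<lambda>x. bump1 eps (f x) v)"
  "continuous_on S f \<Longrightarrow> continuous_on S (\<lambda>x. bump2 eps (f x) v w)"
  unfolding bump_def bump1_def bump2_def by (intro continuous_intros; assumption)+

lemma bump_nonneg: "bump eps x \<ge> 0" by (simp add: bump_def)

lemma bump_zero:
  assumes "norm x \<ge> eps" "eps > 0"
  shows "bump eps x = 0" "bump1 eps x v = 0" "bump2 eps x v w = 0"
proof -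
  have "eps\<^sup>2 \<le> x \<bullet> x" using assms by (simp add: power2_norm_eq_inner[symmetric] power_mono)
  then show "bump eps x = 0" "bump1 eps x v = 0" "bump2 eps x v w = 0"
    by (simp_all add: bump_def bump1_def bump2_def)
qed

lemma bump2_commute: "bump2 eps x v w = bump2 eps x w v"
  by (simp add: bump2_def inner_commute algebra_simps)

lemma bump_minus: "bump eps (- x) = bump eps x" "bump2 eps (- x) v w = bump2 eps x v w"
  by (simp_all add: bump_def bump2_def)

section \<open>Integration by parts and symmetry of second derivatives\<close>

lemma integrable_continuous_compact_support:
  fixes f :: "'a::euclidean_space \<Rightarrow> 'b::{banach, second_countable_topology}"
  assumes "continuous_on UNIV f" "compact K" "\<And>x. x \<notin> K \<Longrightarrow> f x = 0"
  shows "integrable lborel f"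
proof -
  have "integrable lborel (\<lambda>x. indicator K x *\<^sub>R f x)"
    by (rule borel_integrable_compact) (use assms continuous_on_subset[OF assms(1)] in auto)
  also have "(\<lambda>x. indicator K x *\<^sub>R f x) = f" using assms(3) by (auto simp: indicator_def)
  finally show ?thesis .
qed

lemma bounded_continuous_compact_support:
  fixes f :: "'a::euclidean_space \<Rightarrow> 'b::real_normed_vector"
  assumes "continuous_on UNIV f" "compact K" "\<And>x. x \<notin> K \<Longrightarrow> f x = 0"
  obtains B where "0 \<le> B" "\<And>x. norm (f x) \<le> B"
proof -
  have "bounded (f ` K)"
    by (intro compact_imp_bounded compact_continuous_image continuous_on_subset[OF assms(1)] assms(2)) auto
  then obtain B where "0 < B" "\<And>x. x \<in> K \<Longrightarrow> norm (f x) \<le> B" unfolding bounded_pos by auto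
  then show thesis using assms(3) by (intro that[of B]) (force+)
qed

lemma lborel_integral_shift:
  fixes f :: "'a::euclidean_space \<Rightarrow> 'b::{banach, second_countable_topology}"
  assumes "f \<in> borel_measurable borel"
  shows "(LBINT x. f (x + c)) = (LBINT x. f x)"
proof -
  have "(LBINT x. f x) = (\<integral>x. f x \<partial>(distr lborel borel ((+) c)))"
    by (simp add: lborel_distr_plus)
  also have "\<dots> = (LBINT x. f (c + x))" by (rule integral_distr) (use assms in auto)
  finally show ?thesis by (simp add: add.commute)
qed

lemma diff_quot_limit:
  fixes h :: "'a::real_normed_vector \<Rightarrow> 'b::real_normed_vector"
  assumes "(h has_derivative D) (at x)"
  shows "(\<lambda>n. real (Suc n) *\<^sub>R (h (x + (1 / real (Suc n)) *\<^sub>R v) - h x)) \<longlonglongrightarrow> D v"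
proof (cases "v = 0")
  case True
  then show ?thesis using assms by (simp add: has_derivative_def bounded_linear.linear linear_0)
next
  case False
  have bl: "bounded_linear D" and L: "(\<lambda>k. norm (h (x + k) - h x - D k) / norm k) \<midarrow>0\<rightarrow> 0"
    using assms unfolding has_derivative_at by auto
  let ?k = "\<lambda>n. (1 / real (Suc n)) *\<^sub>R v"
  have "?k \<longlonglongrightarrow> 0" 
    using tendsto_scaleR[OF LIMSEQ_inverse_real_of_nat tendsto_const[of v]] by (simp add: inverse_eq_divide)
  then have "filterlim ?k (at 0) sequentially"
    using False by (simp add: filterlim_at)
  from filterlim_compose[OF L this]
  have "(\<lambda>n. norm (h (x + ?k n) - h x - D (?k n)) / norm (?k n)) \<longlonglongrightarrow> 0" .
  from tendsto_mult_right[OF this, of "norm v"]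
  have "(\<lambda>n. norm (h (x + ?k n) - h x - D (?k n)) / norm (?k n) * norm v) \<longlonglongrightarrow> 0" by simp
  also have "(\<lambda>n. norm (h (x + ?k n) - h x - D (?k n)) / norm (?k n) * norm v) =
     (\<lambda>n. norm (real (Suc n) *\<^sub>R (h (x + ?k n) - h x) - D v))"
  proof
    fix n
    let ?N = "real (Suc n)"
    have "?N *\<^sub>R D (?k n) = D (?N *\<^sub>R ?k n)" using bl by (simp only: bounded_linear.linear linear_cmul)
    then have e: "?N *\<^sub>R (h (x + ?k n) - h x) - D v = ?N *\<^sub>R (h (x + ?k n) - h x - D (?k n))"
      by (simp add: scaleR_diff_right)
    show "norm (h (x + ?k n) - h x - D (?k n)) / norm (?k n) * norm v = norm (?N *\<^sub>R (h (x + ?k n) - h x) - D v)"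
      unfolding e norm_scaleR using False by simp
  qed
  finally show ?thesis using Lim_null tendsto_norm_zero_iff by blast
qed

lemma deriv_zero_off_support:
  fixes h :: "'a::euclidean_space \<Rightarrow> 'b::real_normed_vector"
  assumes "(h has_derivative D) (at x)" "compact K" "\<And>x. x \<notin> K \<Longrightarrow> h x = 0" "x \<notin> K"
  shows "D v = 0"
proof -
  have "(h has_derivative (\<lambda>_. 0)) (at x)"
    by (rule has_derivative_transform_within_open[where f="\<lambda>_. 0" and s="- K"])
      (use assms compact_imp_closed in auto)
  then have "D = (\<lambda>_. 0)" using assms(1) has_derivative_unique by blast
  then show ?thesis by simp
qed

text \<open>The integral of a difference quotient of \<open>h\<close> vanishes by translation invariance, and the difference quotients
  converge boundedly, with supports in a common compact set \<open>K1\<close>, to the derivative.\<close>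

lemma integral_directional_derivative_zero:
  fixes h :: "'a::euclidean_space \<Rightarrow> 'b::euclidean_space"
  assumes d: "\<And>x. (h has_derivative h' x) (at x)" and c: "continuous_on UNIV (\<lambda>x. h' x v)"
    and K: "compact K" and z: "\<And>x. x \<notin> K \<Longrightarrow> h x = 0"
  shows "(LBINT x. h' x v) = 0"
proof -
  have ch: "continuous_on UNIV h"
    using d has_derivative_continuous by (metis continuous_at_imp_continuous_on)
  have hm: "h \<in> borel_measurable borel" using ch by (rule borel_measurable_continuous_onI)
  have h'm: "(\<lambda>x. h' x v) \<in> borel_measurable borel" using c by (rule borel_measurable_continuous_onI)
  have z': "h' x v = 0" if "x \<notin> K" for x
    using deriv_zero_off_support[OF d K z that] .
  obtain B where B: "0 \<le> B" "\<And>x. norm (h' x v) \<le> B"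
    using bounded_continuous_compact_support[OF c K z'] by blast
  define K1 where "K1 = (\<lambda>(x, t). x - t *\<^sub>R v) ` (K \<times> {0..1::real})"
  have cK1: "compact K1" unfolding K1_def
    by (intro compact_continuous_image compact_Times K) (auto simp: case_prod_unfold intro!: continuous_intros)
  have inh: "integrable lborel h"
    using integrable_continuous_compact_support[OF ch K z] .
  have hm2: "(\<lambda>x. h (x + w)) \<in> borel_measurable borel" for w
    using hm by measurable
  have inh2: "integrable lborel (\<lambda>x. h (x + w))" for w
  proof (rule integrable_continuous_compact_support)
    show "continuous_on UNIV (\<lambda>x. h (x + w))"
      by (rule continuous_on_compose2[OF ch]) (auto intro!: continuous_intros)
    show "compact ((\<lambda>x. x - w) ` K)" by (intro compact_continuous_image K continuous_intros)
    show "h (x + w) = 0" if "x \<notin> (\<lambda>x. x - w) ` K" for x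
      using z[of "x + w"] that by (metis add_diff_cancel image_eqI)
  qed
  let ?s = "\<lambda>n x. real (Suc n) *\<^sub>R (h (x + (1 / real (Suc n)) *\<^sub>R v) - h x)"
  have bd: "norm (?s n x) \<le> B * indicator K1 x" for n x
  proof (cases "x \<in> K1")
    case False
    have "y \<notin> K" if "y = x + t *\<^sub>R v" "0 \<le> t" "t \<le> 1" for y t
    proof
      assume "y \<in> K"
      then have "(\<lambda>(x, t). x - t *\<^sub>R v) (y, t) \<in> K1" unfolding K1_def using that by (intro imageI) auto
      then show False using that False by simp
    qed
    from this[of x 0] this[of "x + (1 / real (Suc n)) *\<^sub>R v" "1 / real (Suc n)"] 
    have "?s n x = 0" using z by simp
    then show ?thesis using B by simp
  next
    case True
    let ?t = "1 / real (Suc n)"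
    have dp: "((\<lambda>t. h (x + t *\<^sub>R v)) has_derivative (\<lambda>s. h' (x + t *\<^sub>R v) (s *\<^sub>R v))) (at t within {0..?t})" for t
    proof -
      have "((\<lambda>t. x + t *\<^sub>R v) has_derivative (\<lambda>s. s *\<^sub>R v)) (at t within {0..?t})"
        by (auto intro!: derivative_eq_intros)
      then show ?thesis by (rule has_derivative_compose) (rule d)
    qed
    have on: "onorm (\<lambda>s. h' (x + t *\<^sub>R v) (s *\<^sub>R v)) \<le> B" for t
    proof (rule onorm_le)
      fix s
      have "h' (x + t *\<^sub>R v) (s *\<^sub>R v) = s *\<^sub>R h' (x + t *\<^sub>R v) v"
        using d has_derivative_linear linear_cmul by blast
      then show "norm (h' (x + t *\<^sub>R v) (s *\<^sub>R v)) \<le> B * norm s"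
        using mult_right_mono[OF B(2)[of "x + t *\<^sub>R v"], of "norm s"] by (simp add: mult.commute)
    qed
    have "norm (h (x + ?t *\<^sub>R v) - h (x + 0 *\<^sub>R v)) \<le> B * norm (?t - 0)"
      by (rule differentiable_bound[where S="{0..?t}", OF _ dp on]) auto
    then have "real (Suc n) * norm (h (x + ?t *\<^sub>R v) - h x) \<le> B" 
      by (simp add: field_simps)
    then show ?thesis using True by simp
  qed
  have "(\<lambda>n. LBINT x. ?s n x) \<longlonglongrightarrow> (LBINT x. h' x v)"
  proof (rule integral_dominated_convergence[where w="\<lambda>x. B * indicator K1 x"])
    show "integrable lborel (\<lambda>x. B * indicator K1 x)"
      using cK1 emeasure_bounded_finite[OF compact_imp_bounded[OF cK1]]
      by (intro integrable_mult_right integrable_real_indicator)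
        (auto simp: compact_imp_closed borel_closed)
    show "AE x in lborel. (\<lambda>n. ?s n x) \<longlonglongrightarrow> h' x v"
      using diff_quot_limit[OF d] by simp
    show "AE x in lborel. norm (?s n x) \<le> B * indicator K1 x" for n using bd by simp
    show "?s n \<in> borel_measurable lborel" for n using hm hm2 by measurable
  qed (use h'm in simp)
  moreover have "(LBINT x. ?s n x) = 0" for n
    using inh inh2 lborel_integral_shift[OF hm] by (simp add: Bochner_Integration.integral_diff)
  ultimately show ?thesis by (simp add: LIMSEQ_const_iff)
qed

abbreviation dd :: "'a::real_normed_vector \<Rightarrow> ('a \<Rightarrow> 'b::real_normed_vector) \<Rightarrow> 'a \<Rightarrow> 'b" where
  "dd v f \<equiv> (\<lambda>x. frechet_derivative f (at x) v)"

lemma integration_by_parts: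
  fixes f :: "'a::euclidean_space \<Rightarrow> 'b::euclidean_space"
  assumes f: "f differentiable_on UNIV" "continuous_on UNIV (dd v f)"
    and g: "\<And>x. (g has_derivative g' x) (at x)" "continuous_on UNIV (\<lambda>x. g' x v)"
    and K: "compact K" "\<And>x. x \<notin> K \<Longrightarrow> g x = 0"
  shows "(LBINT x. g x *\<^sub>R dd v f x) = - (LBINT x. g' x v *\<^sub>R f x)"
proof -
  have df: "(f has_derivative frechet_derivative f (at x)) (at x)" for x
    using f(1) by (simp add: differentiable_on_def frechet_derivative_works)
  have cf: "continuous_on UNIV f" using f(1) by (rule differentiable_imp_continuous_on)
  have cg: "continuous_on UNIV g"
    using g(1) has_derivative_continuous by (metis continuous_at_imp_continuous_on)
  have g'0: "g' x v = 0" if "x \<notin> K" for x using deriv_zero_off_support[OF g(1) K that] .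
  have "(LBINT x. (g x *\<^sub>R dd v f x + g' x v *\<^sub>R f x)) = 0"
  proof (rule integral_directional_derivative_zero[where h="\<lambda>x. g x *\<^sub>R f x" 
        and h'="\<lambda>x v. g x *\<^sub>R frechet_derivative f (at x) v + g' x v *\<^sub>R f x", OF _ _ K(1)])
    show "((\<lambda>x. g x *\<^sub>R f x) has_derivative (\<lambda>v. g x *\<^sub>R frechet_derivative f (at x) v + g' x v *\<^sub>R f x)) (at x)" for x
      by (rule has_derivative_scaleR[OF g(1) df])
  qed (use cf cg f g K in \<open>auto intro!: continuous_intros\<close>)
  moreover have "integrable lborel (\<lambda>x. g x *\<^sub>R dd v f x)"
    by (rule integrable_continuous_compact_support[OF _ K(1)]) (use cg f K in \<open>auto intro!: continuous_intros\<close>)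
  moreover have "integrable lborel (\<lambda>x. g' x v *\<^sub>R f x)"
    by (rule integrable_continuous_compact_support[OF _ K(1)]) (use cf g g'0 K in \<open>auto intro!: continuous_intros\<close>)
  ultimately show ?thesis by (simp add: Bochner_Integration.integral_add eq_neg_iff_add_eq_0)
qed

text \<open>Two integrations by parts move the derivatives from \<open>f\<close> to the kernel; the signs from the two steps and from the
  reflection \<open>y \<mapsto> x - y\<close> cancel.\<close>

lemma bump_convolution_dd:
  fixes f :: "'a::euclidean_space \<Rightarrow> 'b::euclidean_space"
  assumes eps: "eps > 0" and f: "f differentiable_on UNIV" "dd v f differentiable_on UNIV"
    "continuous_on UNIV (dd w (dd v f))"
  shows "(LBINT y. bump eps (x - y) *\<^sub>R dd w (dd v f) y) = (LBINT y. bump2 eps (x - y) v w *\<^sub>R f y)"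
proof -
  have cf: "continuous_on UNIV (dd v f)" using f(2) by (rule differentiable_imp_continuous_on)
  have sub: "((\<lambda>y. x - y) has_derivative (\<lambda>v. - v)) (at y)" for y
    by (auto intro!: derivative_eq_intros)
  have d0: "((\<lambda>y. bump eps (x - y)) has_derivative (\<lambda>v. bump1 eps (x - y) (- v))) (at y)" for y
    by (rule has_derivative_compose[OF sub bump_deriv])
  have d1: "((\<lambda>y. bump1 eps (x - y) (- w)) has_derivative (\<lambda>v. bump2 eps (x - y) (- w) (- v))) (at y)" for y
    by (rule has_derivative_compose[OF sub bump1_deriv])
  have out: "norm (x - y) \<ge> eps" if "y \<notin> cball x eps" for y using that by (simp add: dist_norm)
  have "(LBINT y. bump eps (x - y) *\<^sub>R dd w (dd v f) y) = - (LBINT y. bump1 eps (x - y) (- w) *\<^sub>R dd v f y)"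
    by (rule integration_by_parts[OF f(2,3) d0 _ compact_cball[of x eps]])
      (use out eps in \<open>auto intro!: continuous_intros bump_zero\<close>)
  also have "(LBINT y. bump1 eps (x - y) (- w) *\<^sub>R dd v f y) = - (LBINT y. bump2 eps (x - y) (- w) (- v) *\<^sub>R f y)"
    by (rule integration_by_parts[OF f(1) cf d1 _ compact_cball[of x eps]])
      (use out eps in \<open>auto intro!: continuous_intros bump_zero\<close>)
  also have "(\<lambda>y. bump2 eps (x - y) (- w) (- v)) = (\<lambda>y. bump2 eps (x - y) v w)"
    by (simp add: bump2_def algebra_simps inner_commute)
  finally show ?thesis by simp
qed

lemma integrable_bump_shift: "eps > 0 \<Longrightarrow> integrable lborel (\<lambda>y. bump eps (x - y :: 'a::euclidean_space))"
  by (rule integrable_continuous_compact_support[OF _ compact_cball[of x eps]])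
    (auto intro!: continuous_intros bump_zero simp: dist_norm)

lemma integral_bump_shift: "(LBINT y. bump eps (x - y :: 'a::euclidean_space)) = (LBINT y. bump eps (y::'a))"
proof -
  have "bump eps (x - y) = bump eps (y + (- x))" for y using bump_minus(1)[of eps "x - y"] by simp
  then show ?thesis 
    using lborel_integral_shift[of "bump eps" "- x"]
    by (simp add: borel_measurable_continuous_onI continuous_intros)
qed

lemma bump_mass_pos:
  assumes "eps > 0" shows "(LBINT y. bump eps (y::'a::euclidean_space)) > 0"
proof -
  let ?c = "(eps\<^sup>2 - (eps/2)\<^sup>2)^3"
  have c: "?c > 0" using assms by (simp add: power2_eq_square)
  have "?c * indicator (cball (0::'a) (eps/2)) y \<le> bump eps y" for y
  proof (cases "y \<in> cball (0::'a) (eps/2)")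
    case True
    then have "y \<bullet> y \<le> (eps/2)\<^sup>2" by (simp add: power2_norm_eq_inner[symmetric] power_mono)
    then have "?c \<le> bump eps y" unfolding bump_def using assms
      by (intro power_mono max.coboundedI2) (auto simp: power2_eq_square)
    then show ?thesis using True by simp
  qed (simp add: bump_nonneg)
  moreover have fin: "emeasure lborel (cball (0::'a) (eps/2)) < \<infinity>"
    by (rule emeasure_bounded_finite) simp
  moreover have "integrable lborel (\<lambda>y. ?c * indicator (cball (0::'a) (eps/2)) y :: real)"
    by (intro integrable_mult_right integrable_real_indicator fin) auto
  ultimately have "(LBINT y. ?c * indicator (cball (0::'a) (eps/2)) y) \<le> (LBINT y. bump eps (y::'a))"
    using integrable_bump_shift[OF assms, of 0] by (intro integral_mono) (auto simp: bump_minus)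
  moreover have "(LBINT y. ?c * indicator (cball (0::'a) (eps/2)) y) = ?c * measure lborel (cball (0::'a) (eps/2))"
    by simp
  moreover have "measure lborel (cball (0::'a) (eps/2)) > 0"
    using assms content_cball_pos[of "eps/2" "0::'a"] by (simp add: measure_completion)
  ultimately show ?thesis using c by (smt (verit) mult_pos_pos)
qed

lemma bump_mollify:
  fixes G :: "'a::euclidean_space \<Rightarrow> 'b::euclidean_space"
  assumes eps: "eps > 0" and G: "continuous_on UNIV G" and \<delta>: "\<And>y. norm (x - y) \<le> eps \<Longrightarrow> norm (G y - G x) \<le> \<delta>"
  defines "N \<equiv> (LBINT y. bump eps (y::'a))"
  shows "norm ((LBINT y. bump eps (x - y) *\<^sub>R G y) - N *\<^sub>R G x) \<le> \<delta> * N"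
proof -
  have i1: "integrable lborel (\<lambda>y. bump eps (x - y) *\<^sub>R G y)"
    by (rule integrable_continuous_compact_support[OF _ compact_cball[of x eps]])
      (use eps G in \<open>auto intro!: continuous_intros simp: bump_zero dist_norm\<close>)
  have i2: "integrable lborel (\<lambda>y. bump eps (x - y) *\<^sub>R G x)"
    using integrable_bump_shift[OF eps, of x] by simp
  have "(LBINT y. bump eps (x - y) *\<^sub>R G y) - N *\<^sub>R G x = (LBINT y. bump eps (x - y) *\<^sub>R G y - bump eps (x - y) *\<^sub>R G x)"
    using i1 i2 integrable_bump_shift[OF eps, of x]
    by (simp add: Bochner_Integration.integral_diff N_def integral_bump_shift)
  also have "norm \<dots> \<le> (LBINT y. norm (bump eps (x - y) *\<^sub>R G y - bump eps (x - y) *\<^sub>R G x))"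
    by (rule integral_norm_bound)
  also have "\<dots> \<le> (LBINT y. \<delta> * bump eps (x - y))"
  proof (rule integral_mono)
    fix y
    show "norm (bump eps (x - y) *\<^sub>R G y - bump eps (x - y) *\<^sub>R G x) \<le> \<delta> * bump eps (x - y)"
    proof (cases "norm (x - y) \<le> eps")
      case True
      then show ?thesis 
        using mult_left_mono[OF \<delta>[OF True] bump_nonneg[of eps "x - y"]]
        by (simp flip: scaleR_diff_right add: mult.commute abs_of_nonneg[OF bump_nonneg])
    qed (use eps in \<open>simp add: bump_zero\<close>)
  qed (use i1 i2 integrable_bump_shift[OF eps] in auto)
  finally show ?thesis by (simp add: N_def integral_bump_shift)
qed

text \<open>Both mixed derivatives have the same mollifications, because those can be computed with the
  second derivatives of the bump function, and these are visibly symmetric.\<close>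

theorem mixed_dd_commute:
  fixes f :: "'a::euclidean_space \<Rightarrow> 'b::euclidean_space"
  assumes f: "f differentiable_on UNIV" "dd v f differentiable_on UNIV" "dd w f differentiable_on UNIV"
    and c: "continuous_on UNIV (dd w (dd v f))" "continuous_on UNIV (dd v (dd w f))"
  shows "dd w (dd v f) x = dd v (dd w f) x"
proof -
  let ?P = "dd w (dd v f)" and ?Q = "dd v (dd w f)"
  have "norm (?P x - ?Q x) \<le> 0 + \<delta>" if "\<delta> > 0" for \<delta>
  proof -
    have "\<exists>d>0. \<forall>y. dist y x < d \<longrightarrow> dist (g y) (g x) < \<delta>/2" 
      if "continuous_on UNIV g" for g :: "'a \<Rightarrow> 'b"
      using that \<open>\<delta> > 0\<close> unfolding continuous_on_iff by (metis UNIV_I half_gt_zero)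
    from this[OF c(1)] this[OF c(2)] obtain d1 d2 where d: "d1 > 0" "d2 > 0"
      "\<And>y. dist y x < d1 \<Longrightarrow> dist (?P y) (?P x) < \<delta>/2" "\<And>y. dist y x < d2 \<Longrightarrow> dist (?Q y) (?Q x) < \<delta>/2"
      by blast
    define eps where "eps = min d1 d2 / 2"
    have eps: "eps > 0" "eps < d1" "eps < d2" using d unfolding eps_def by linarith+
    define N where "N = (LBINT y. bump eps (y::'a))"
    define I where "I = (LBINT y. bump2 eps (x - y) v w *\<^sub>R f y)"
    have N: "N > 0" using bump_mass_pos[OF eps(1)] by (simp add: N_def)
    have 1: "norm (I - N *\<^sub>R ?P x) \<le> \<delta>/2 * N"
      unfolding I_def bump_convolution_dd[OF eps(1) f(1,2) c(1), symmetric] N_def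
    proof (rule bump_mollify[OF eps(1) c(1)])
      fix y assume "norm (x - y) \<le> eps"
      then show "norm (?P y - ?P x) \<le> \<delta>/2" using d(3)[of y] eps by (simp add: dist_norm norm_minus_commute)
    qed
    have 2: "norm (I - N *\<^sub>R ?Q x) \<le> \<delta>/2 * N"
      unfolding I_def bump2_commute[of _ _ v w] bump_convolution_dd[OF eps(1) f(1,3) c(2), symmetric] N_def
    proof (rule bump_mollify[OF eps(1) c(2)])
      fix y assume "norm (x - y) \<le> eps"
      then show "norm (?Q y - ?Q x) \<le> \<delta>/2" using d(4)[of y] eps by (simp add: dist_norm norm_minus_commute)
    qed
    have "norm (N *\<^sub>R ?P x - N *\<^sub>R ?Q x) \<le> N * \<delta>"
      using norm_triangle_ineq4[of "I - N *\<^sub>R ?Q x" "I - N *\<^sub>R ?P x"] 1 2 by (simp add: algebra_simps)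
    then have "N * norm (?P x - ?Q x) \<le> N * \<delta>"
      using N by (simp flip: scaleR_diff_right)
    then show ?thesis using N by simp
  qed
  then have "norm (?P x - ?Q x) \<le> 0" by (rule field_le_epsilon)
  then show ?thesis by simp
qed

section \<open>Lebesgue measure under isometries and homotheties\<close>

lemma lborel_nn_integral_shift:
  fixes f :: "'a::euclidean_space \<Rightarrow> ennreal"
  assumes "f \<in> borel_measurable borel"
  shows "(\<integral>\<^sup>+x. f (x + c) \<partial>lborel) = (\<integral>\<^sup>+x. f x \<partial>lborel)"
proof -
  have "(\<integral>\<^sup>+x. f x \<partial>lborel) = (\<integral>\<^sup>+x. f x \<partial>(distr lborel borel ((+) c)))"
    by (simp add: lborel_distr_plus)
  also have "\<dots> = (\<integral>\<^sup>+x. f (c + x) \<partial>lborel)" by (rule nn_integral_distr) (use assms in auto)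
  finally show ?thesis by (simp add: add.commute)
qed

lemma emeasure_cball_pos_finite:
  assumes "0 < r"
  shows "0 < emeasure lborel (cball (a::'a::euclidean_space) r)" "emeasure lborel (cball a r) < \<infinity>"
proof -
  show f: "emeasure lborel (cball a r) < \<infinity>" by (rule emeasure_bounded_finite) simp
  have "measure lborel (cball a r) > 0"
    using assms content_cball_pos[of r a] by (simp add: measure_completion)
  then show "0 < emeasure lborel (cball a r)"
    using f by (simp add: measure_def enn2real_positive_iff)
qed

text \<open>The argument for uniqueness of Haar measure: the double integral of \<open>1\<^sub>A(f x) 1\<^sub>B(y - f x)\<close> over \<open>x\<close> and \<open>y\<close>, where \<open>B\<close> is
  the unit ball, is evaluated in both orders.
  The ball is invariant under \<open>f\<close>, which makes the two factors comparable.\<close>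

theorem lborel_distr_isometry:
  fixes f :: "'a::euclidean_space \<Rightarrow> 'a"
  assumes lin: "linear f" and nrm: "\<And>x. norm (f x) = norm x"
  shows "distr lborel borel f = lborel"
proof (rule measure_eqI)
  show "sets (distr lborel borel f) = sets lborel" by simp
next
  fix A assume "A \<in> sets (distr lborel borel f)"
  then have A[measurable]: "A \<in> sets borel" by simp
  have [measurable]: "f \<in> borel_measurable borel"
    using lin by (intro borel_measurable_continuous_onI linear_continuous_on) (simp add: linear_conv_bounded_linear)
  have "inj f"
    using lin nrm by (metis linear_injective_0 norm_eq_zero)
  then have surj: "surj f" using lin linear_injective_imp_surjective by blast
  let ?B = "cball (0::'a) 1"
  let ?c = "emeasure lborel ?B"
  have [measurable]: "?B \<in> sets borel" by simp
  have indB: "(indicator ?B :: 'a \<Rightarrow> ennreal) \<in> borel_measurable borel"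
    by (intro borel_measurable_indicator) simp
  have "emeasure (distr lborel borel f) A = (\<integral>\<^sup>+x. indicator A x \<partial>distr lborel borel f)"
    by simp
  also have "\<dots> = (\<integral>\<^sup>+x. indicator A (f x) \<partial>lborel)"
    by (rule nn_integral_distr) auto
  finally have vimg: "emeasure (distr lborel borel f) A = (\<integral>\<^sup>+x. indicator A (f x) \<partial>lborel)" .
  have "emeasure (distr lborel borel f) A * ?c = (\<integral>\<^sup>+x. indicator A (f x) * ?c \<partial>lborel)"
    unfolding vimg by (rule nn_integral_multc[symmetric]) simp
  also have "\<dots> = (\<integral>\<^sup>+x. \<integral>\<^sup>+y. indicator A (f x) * indicator ?B (y - f x) \<partial>lborel \<partial>lborel)"
  proof (intro nn_integral_cong)
    fix x
    have "(\<integral>\<^sup>+y. indicator A (f x) * indicator ?B (y - f x) \<partial>lborel) = indicator A (f x) * (\<integral>\<^sup>+y. indicator ?B (y - f x) \<partial>lborel)"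
    proof (rule nn_integral_cmult)
      have "(\<lambda>y. y - f x) \<in> borel_measurable borel" by measurable
      then have "(\<lambda>y. indicator ?B (y - f x) :: ennreal) \<in> borel_measurable borel"
        by (rule measurable_compose) (rule indB)
      then show "(\<lambda>y. indicator ?B (y - f x) :: ennreal) \<in> borel_measurable lborel" by simp
    qed
    also have "(\<integral>\<^sup>+y. indicator ?B (y - f x) \<partial>lborel) = ?c"
      using lborel_nn_integral_shift[OF indB, of "- f x"] by simp
    finally show "indicator A (f x) * ?c = (\<integral>\<^sup>+y. indicator A (f x) * indicator ?B (y - f x) \<partial>lborel)" by simp
  qed
  also have "\<dots> = (\<integral>\<^sup>+y. \<integral>\<^sup>+x. indicator A (f x) * indicator ?B (y - f x) \<partial>lborel \<partial>lborel)"
    by (rule lborel_pair.Fubini') measurable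
  also have "\<dots> = (\<integral>\<^sup>+y. \<integral>\<^sup>+x. indicator A (f x + y) * indicator ?B x \<partial>lborel \<partial>lborel)"
  proof (rule nn_integral_cong)
    fix y
    obtain z where z: "f z = y" using surj by (metis surjD)
    have "(\<integral>\<^sup>+x. indicator A (f x) * indicator ?B (y - f x) \<partial>lborel) 
      = (\<integral>\<^sup>+x. indicator A (f (x + z)) * indicator ?B (y - f (x + z)) \<partial>lborel)"
      by (rule lborel_nn_integral_shift[symmetric]) measurable
    also have "\<dots> = (\<integral>\<^sup>+x. indicator A (f x + y) * indicator ?B x \<partial>lborel)"
      using nrm by (intro nn_integral_cong) (auto simp: linear_add[OF lin] z indicator_def)
    finally show "(\<integral>\<^sup>+x. indicator A (f x) * indicator ?B (y - f x) \<partial>lborel) = 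
       (\<integral>\<^sup>+x. indicator A (f x + y) * indicator ?B x \<partial>lborel)" .
  qed
  also have "\<dots> = (\<integral>\<^sup>+x. \<integral>\<^sup>+y. indicator A (f x + y) * indicator ?B x \<partial>lborel \<partial>lborel)"
    by (rule lborel_pair.Fubini'[symmetric]) measurable
  also have "\<dots> = (\<integral>\<^sup>+x. emeasure lborel A * indicator ?B x \<partial>lborel)"
  proof (intro nn_integral_cong)
    fix x
    have "(\<integral>\<^sup>+y. indicator A (f x + y) * indicator ?B x \<partial>lborel) = (\<integral>\<^sup>+y. indicator A (y + f x) \<partial>lborel) * indicator ?B x"
      by (subst nn_integral_multc[symmetric]) (auto simp: add.commute)
    also have "(\<integral>\<^sup>+y. indicator A (y + f x) \<partial>lborel) = emeasure lborel A"
      by (subst lborel_nn_integral_shift) auto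
    finally show "(\<integral>\<^sup>+y. indicator A (f x + y) * indicator ?B x \<partial>lborel) = emeasure lborel A * indicator ?B x" .
  qed
  also have "\<dots> = emeasure lborel A * ?c"
    by (subst nn_integral_cmult) auto
  finally have "emeasure (distr lborel borel f) A * ?c = emeasure lborel A * ?c" .
  then show "emeasure (distr lborel borel f) A = emeasure lborel A"
    using emeasure_cball_pos_finite[of 1 "0::'a"] by (auto simp: mult.commute[of _ ?c] ennreal_mult_cancel_left)
qed

lemma linear_borel_measurable:
  fixes f :: "'a::euclidean_space \<Rightarrow> 'b::euclidean_space"
  shows "linear f \<Longrightarrow> f \<in> borel_measurable borel"
  by (intro borel_measurable_continuous_onI linear_continuous_on) (simp add: linear_conv_bounded_linear)

lemma nn_integral_isometry:
  fixes f :: "'a::euclidean_space \<Rightarrow> 'a"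
  assumes "linear f" "\<And>x. norm (f x) = norm x" "g \<in> borel_measurable borel"
  shows "(\<integral>\<^sup>+x. g (f x) \<partial>lborel) = (\<integral>\<^sup>+x. g x \<partial>lborel)"
  using nn_integral_distr[of f lborel borel g] assms
  by (simp add: lborel_distr_isometry linear_borel_measurable)

lemma integral_isometry:
  fixes f :: "'a::euclidean_space \<Rightarrow> 'a" and g :: "'a \<Rightarrow> real"
  assumes "linear f" "\<And>x. norm (f x) = norm x" "g \<in> borel_measurable borel"
  shows "(LBINT x. g (f x)) = (LBINT x. g x)"
  using integral_distr[of f lborel borel g] assms
  by (simp add: lborel_distr_isometry linear_borel_measurable)

lemma nn_integral_homothety:
  fixes f :: "'a::euclidean_space \<Rightarrow> 'a"
  assumes lin: "linear f" and nrm: "\<And>x. norm (f x) = s * norm x" and s: "0 < s"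
    and g[measurable]: "g \<in> borel_measurable borel"
  shows "ennreal (s ^ DIM('a)) * (\<integral>\<^sup>+x. g (f x) \<partial>lborel) = (\<integral>\<^sup>+x. g x \<partial>lborel)"
proof -
  let ?f = "\<lambda>x. (1/s) *\<^sub>R f x"
  have l: "linear ?f" using lin by (intro linear_compose_scale_right)
  have [measurable]: "f \<in> borel_measurable borel" using lin by (rule linear_borel_measurable)
  have "(\<integral>\<^sup>+x. g x \<partial>lborel) = (\<integral>\<^sup>+x. g x \<partial>density (distr lborel borel (\<lambda>x. 0 + s *\<^sub>R x)) (\<lambda>_. \<bar>s\<bar> ^ DIM('a)))"
    using s by (subst lborel_affine[of s "0::'a"]) auto
  also have "\<dots> = (\<integral>\<^sup>+x. ennreal (s ^ DIM('a)) * g (s *\<^sub>R x) \<partial>lborel)"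
    using s by (simp add: nn_integral_density nn_integral_distr)
  also have "\<dots> = ennreal (s ^ DIM('a)) * (\<integral>\<^sup>+x. g (s *\<^sub>R x) \<partial>lborel)"
    by (rule nn_integral_cmult) simp
  also have "(\<integral>\<^sup>+x. g (s *\<^sub>R x) \<partial>lborel) = (\<integral>\<^sup>+x. g (s *\<^sub>R ?f x) \<partial>lborel)"
    by (rule nn_integral_isometry[OF l, symmetric]) (use nrm s in auto)
  also have "(\<lambda>x. g (s *\<^sub>R ?f x)) = (\<lambda>x. g (f x))" using s by simp
  finally show ?thesis by simp
qed

text \<open>Mixed moments vanish by reflection in a coordinate hyperplane, and the second moments agree by exchanging
  two coordinates.\<close>

lemma integral_cball_moments:
  fixes s t :: "'k::finite"
  defines "m \<equiv> \<lambda>s t. (\<integral>x. indicator (cball 0 1) x * (x $ s * x $ t) \<partial>(lborel :: (real^'k) measure))"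
  shows "s \<noteq> t \<Longrightarrow> m s t = 0" "m s s = m t t" "m s s > 0"
proof -
  have meas: "(\<lambda>x::real^'k. indicator (cball 0 1) x * (x $ i * x $ j)) \<in> borel_measurable borel" for i j
    by (intro borel_measurable_times borel_measurable_indicator borel_measurable_continuous_onI)
      (auto intro!: continuous_intros)
  show "m s t = 0" if "s \<noteq> t"
  proof -
    let ?f = "\<lambda>x::real^'k. (\<chi> i. if i = s then - x $ i else x $ i)"
    have l: "linear ?f" by (intro linearI) (auto simp: vec_eq_iff)
    have n: "norm (?f x) = norm x" for x
      unfolding norm_vec_def L2_set_def by (intro arg_cong[of _ _ sqrt] sum.cong) auto
    have "m s t = (LBINT x. indicator (cball 0 1) (?f x) * (?f x $ s * ?f x $ t))"
      unfolding m_def by (rule integral_isometry[OF l n meas, symmetric])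
    also have "\<dots> = (LBINT x. - (indicator (cball 0 1) x * (x $ s * x $ t)))"
      using that n by (intro Bochner_Integration.integral_cong) (auto simp: indicator_def)
    also have "\<dots> = - m s t" by (simp add: m_def)
    finally show ?thesis by simp
  qed
  show "m s s = m t t"
  proof -
    let ?\<pi> = "\<lambda>i. if i = s then t else if i = t then s else i"
    let ?f = "\<lambda>x::real^'k. (\<chi> i. x $ ?\<pi> i)"
    have l: "linear ?f" by (intro linearI) (auto simp: vec_eq_iff)
    have n: "norm (?f x) = norm x" for x
    proof -
      have "bij ?\<pi>" by (rule o_bij[of ?\<pi>]) auto
      then have "(\<Sum>i\<in>UNIV. (norm (x $ ?\<pi> i))\<^sup>2) = (\<Sum>i\<in>UNIV. (norm (x $ i))\<^sup>2)"
        by (rule sum.reindex_bij_betw)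
      then show ?thesis unfolding norm_vec_def L2_set_def by simp
    qed
    have "m s s = (LBINT x. indicator (cball 0 1) (?f x) * (?f x $ s * ?f x $ s))"
      unfolding m_def by (rule integral_isometry[OF l n meas, symmetric])
    also have "\<dots> = m t t"
      unfolding m_def using n by (intro Bochner_Integration.integral_cong) (auto simp: indicator_def)
    finally show ?thesis .
  qed
  show "m s s > 0"
  proof -
    let ?C = "cball (axis s (1/2) :: real^'k) (1/4)"
    have int: "integrable lborel (\<lambda>x::real^'k. indicator (cball 0 1) x * (x $ s * x $ s))"
    proof -
      have "continuous_on (cball (0::real^'k) 1) (\<lambda>x. x $ s * x $ s)" by (intro continuous_intros)
      from borel_integrable_compact[OF compact_cball this] show ?thesis by simp
    qed
    have fin: "emeasure lborel ?C < \<infinity>" by (rule emeasure_bounded_finite) simp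
    have le: "(1/16) * indicator ?C x \<le> indicator (cball 0 1) x * (x $ s * x $ s)" for x
    proof (cases "x \<in> ?C")
      case True
      have "\<bar>(axis s (1/2) - x) $ s\<bar> \<le> 1/4"
        using component_le_norm_cart[of "axis s (1/2) - x" s] True by (simp add: dist_norm)
      then have "\<bar>1/2 - x $ s\<bar> \<le> 1/4" by simp
      then have "x $ s \<ge> 1/4" by linarith
      then have 1: "x $ s * x $ s \<ge> 1/4 * (1/4)" by (intro mult_mono) auto
      have "norm x \<le> norm (axis s (1/2) :: real^'k) + norm (axis s (1/2) - x)"
        using norm_triangle_ineq4[of "axis s (1/2)" "axis s (1/2) - x"] by simp
      moreover have "norm (axis s (1/2) :: real^'k) = 1/2"
        by (simp add: norm_eq_sqrt_inner inner_axis_axis real_sqrt_divide)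
      ultimately have "norm x \<le> 1" using True by (simp add: dist_norm)
      then show ?thesis using 1 True by simp
    qed simp
    have "0 < (1/16) * measure lborel ?C"
      using emeasure_cball_pos_finite[of "1/4" "axis s (1/2) :: real^'k"]
      by (simp add: measure_def enn2real_positive_iff)
    also have "\<dots> = (LBINT x. (1/16) * indicator ?C x)" by simp
    also have "\<dots> \<le> m s s"
      unfolding m_def
      by (rule integral_mono[OF _ int le]) (intro integrable_mult_right integrable_real_indicator fin, simp)
    finally show ?thesis .
  qed
qed

section \<open>Right quaternionic lines\<close>

lemma norm_qmult: "norm (qmult a b) = norm a * norm b"
proof -
  have "(norm (qmult a b))\<^sup>2 = (norm a * norm b)\<^sup>2"
    unfolding power_mult_distrib norm_quat_sq qmult_nth by algebra
  then show ?thesis by (simp add: power2_eq_iff_nonneg)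
qed

text \<open>Right multiplication of a quaternionic vector by a scalar, so that \<open>a + qact b \<lambda>\<close> runs through
  the right line through \<open>a\<close> in direction \<open>b\<close>.\<close>

definition qact :: "'n qspace \<Rightarrow> quat \<Rightarrow> 'n::finite qspace" where
  "qact b lam = (\<chi> l. qmult (b $ l) lam)"

lemma qline_eq: "qline a b lam = a + qact b lam"
  by (simp add: qline_def qact_def)

lemma norm_qact: "norm (qact b lam) = norm lam * norm b"
proof -
  have "(norm (qact b lam))\<^sup>2 = (norm lam * norm b)\<^sup>2"
    unfolding norm_vec_def[of b] norm_vec_def[of "qact b lam"] L2_set_def power_mult_distrib
    by (simp add: sum_nonneg qact_def norm_qmult sum_distrib_left power_mult_distrib mult.commute)
  then show ?thesis by (simp add: power2_eq_iff_nonneg)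
qed

lemma qmult_add: "qmult (a + a') b = qmult a b + qmult a' b" "qmult a (b + b') = qmult a b + qmult a b'"
  and qmult_scaleR: "qmult (c *\<^sub>R a) b = c *\<^sub>R qmult a b" "qmult a (c *\<^sub>R b) = c *\<^sub>R qmult a b"
  by (auto intro!: quat_eqI simp: algebra_simps)

lemma bounded_bilinear_qact: "bounded_bilinear qact"
proof
  show "\<exists>K. \<forall>a b. norm (qact a b) \<le> norm a * norm b * K"
    by (rule exI[of _ 1]) (simp add: norm_qact mult.commute)
qed (simp_all add: qact_def vec_eq_iff qmult_add qmult_scaleR)

lemmas linear_qact_left = bounded_bilinear.bounded_linear_left[OF bounded_bilinear_qact, THEN bounded_linear.linear]
lemmas linear_qact_right = bounded_bilinear.bounded_linear_right[OF bounded_bilinear_qact, THEN bounded_linear.linear]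
lemmas continuous_qact [continuous_intros] = bounded_bilinear.continuous_on[OF bounded_bilinear_qact]

lemma qact_zero [simp]: "qact 0 lam = 0" "qact b 0 = 0"
  using linear_0[OF linear_qact_left] linear_0[OF linear_qact_right] by auto

lemma qact_measurable [measurable (raw)]:
  assumes [measurable]: "f \<in> borel_measurable M" "g \<in> borel_measurable M"
  shows "(\<lambda>x. qact (f x) (g x)) \<in> borel_measurable M"
proof -
  have "continuous_on UNIV (\<lambda>p. qact (fst p) (snd p))"
    by (intro continuous_intros)
  then have "(\<lambda>p. qact (fst p) (snd p)) \<in> borel_measurable borel" by (rule borel_measurable_continuous_onI)
  from measurable_compose[OF _ this, of "\<lambda>x. (f x, g x)" M] show ?thesis by simp
qed

section \<open>The sub-mean value inequality on lines\<close>

lemma usc_open: "usc_on \<Omega> u \<Longrightarrow> open \<Omega> \<Longrightarrow> open {x \<in> \<Omega>. u x < c}"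
  unfolding usc_on_def by (metis openin_open_eq)

text \<open>Outside \<open>\<Omega>\<close> nothing is known about \<open>u\<close>, hence the default value 0.\<close>

lemma usc_borel:
  assumes "usc_on \<Omega> u" "open \<Omega>"
  shows "(\<lambda>x. if x \<in> \<Omega> then u x else 0) \<in> borel_measurable borel"
proof (rule borel_measurableI_less)
  fix c :: ereal
  have "{x \<in> space borel. (if x \<in> \<Omega> then u x else 0) < c} = {x \<in> \<Omega>. u x < c} \<union> (if 0 < c then - \<Omega> else {})"
    by auto
  also have "\<dots> \<in> sets borel"
    using usc_open[OF assms] assms(2) by auto
  finally show "{x \<in> space borel. (if x \<in> \<Omega> then u x else 0) < c} \<in> sets borel" .
qed

lemma usc_bounded_above:
  assumes "usc_on \<Omega> u" "open \<Omega>" "compact K" "K \<subseteq> \<Omega>"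
  obtains M :: real where "0 \<le> M" "\<And>x. x \<in> K \<Longrightarrow> u x \<le> ereal M"
proof -
  let ?U = "\<lambda>n::nat. {x \<in> \<Omega>. u x < ereal (real n)}"
  have sub: "K \<subseteq> (\<Union>n. ?U n)"
  proof
    fix x assume "x \<in> K"
    then have "x \<in> \<Omega>" "u x < \<infinity>" using assms unfolding usc_on_def by blast+
    then have "u x \<noteq> \<infinity>" by simp
    then obtain n :: nat where "u x < ereal (real n)" unfolding less_PInf_Ex_of_nat ..
    then show "x \<in> (\<Union>n. ?U n)" using \<open>x \<in> \<Omega>\<close> by blast
  qed
  obtain N where N: "finite N" "K \<subseteq> (\<Union>n\<in>N. ?U n)"
    by (rule compactE_image[OF assms(3) _ sub]) (auto intro: usc_open[OF assms(1,2)])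
  show thesis
  proof (rule that[of "real (Max (insert 0 N))"])
    fix x assume "x \<in> K"
    then obtain n where n: "n \<in> N" "u x < ereal (real n)" using N(2) by blast
    then have "n \<le> Max (insert 0 N)" using N(1) by (intro Max_ge) auto
    then have "ereal (real n) \<le> ereal (real (Max (insert 0 N)))" by simp
    with n(2) show "u x \<le> ereal (real (Max (insert 0 N)))"
      by (rule order_trans[OF less_imp_le])
  qed simp
qed

text \<open>The inequality for \<open>u\<close> turned into one for the nonnegative function \<open>M - u\<close>. In this form
  it can be integrated over families of lines by Tonelli's theorem, with the value \<open>M - u = \<infinity>\<close> at points where
  \<open>u = -\<infinity>\<close>.\<close>

theorem PSH_line_mean:
  fixes u :: "'n::finite qspace \<Rightarrow> ereal"
  assumes u: "u \<in> PSH \<Omega>" and op: "open \<Omega>" and b: "b \<noteq> 0" and r: "0 < r"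
    and in\<Omega>: "\<And>lam. lam \<in> cball 0 r \<Longrightarrow> a + qact b lam \<in> \<Omega>"
    and M: "0 \<le> M" "\<And>lam. lam \<in> cball 0 r \<Longrightarrow> u (a + qact b lam) \<le> ereal M"
  shows "(\<integral>\<^sup>+lam. e2ennreal (ereal M - u (a + qact b lam)) * indicator (cball 0 r) lam \<partial>lborel)
     \<le> emeasure lborel (cball (0::quat) r) * e2ennreal (ereal M - u a)"
proof -
  define C where "C = cball (0::quat) r"
  have usc: "usc_on \<Omega> u" using u by (simp add: PSH_def)
  define u0 where "u0 = (\<lambda>x. if x \<in> \<Omega> then u x else 0)"
  have [measurable]: "u0 \<in> borel_measurable borel" unfolding u0_def by (rule usc_borel[OF usc op])
  have [measurable]: "C \<in> sets borel" by (simp add: C_def)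
  define w where "w = (\<lambda>lam. u0 (a + qact b lam))"
  have [measurable]: "w \<in> borel_measurable borel" unfolding w_def by measurable
  have w: "w lam = u (a + qact b lam)" "w lam \<le> ereal M" if "lam \<in> C" for lam
    using that in\<Omega> M by (auto simp: w_def u0_def C_def)
  have 0: "(0::quat) \<in> C" using r by (simp add: C_def)
  define V where "V = measure lborel C"
  have fin: "emeasure lborel C < \<infinity>" "0 < emeasure lborel C" using emeasure_cball_pos_finite[OF r] by (auto simp: C_def)
  have V: "emeasure lborel C = ennreal V"
    unfolding V_def using fin(1) by (intro emeasure_eq_ennreal_measure) simp
  have Vpos: "0 < V" using fin(2) unfolding V by simp
  note V = V Vpos
  define P where "P = (\<integral>\<^sup>+lam. e2ennreal (w lam) * indicator C lam \<partial>lborel)"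
  define N where "N = (\<integral>\<^sup>+lam. e2ennreal (- w lam) * indicator C lam \<partial>lborel)"
  define J where "J = (\<integral>\<^sup>+lam. e2ennreal (ereal M - w lam) * indicator C lam \<partial>lborel)"
  have sub: "u a \<le> (enn2ereal P - enn2ereal N) / ereal V"
  proof -
    have "subharmonic_on {lam. qline a b lam \<in> \<Omega>} (\<lambda>lam. u (qline a b lam))"
      using u b by (simp add: PSH_def)
    moreover have "cball 0 r \<subseteq> {lam. qline a b lam \<in> \<Omega>}" using in\<Omega> by (auto simp: qline_eq)
    ultimately have "u (qline a b 0) \<le> ereal_integral_on C (\<lambda>lam. u (qline a b lam)) / ereal V"
      using r unfolding subharmonic_on_def C_def V_def by blast
    moreover have "ereal_integral_on C (\<lambda>lam. u (qline a b lam)) = enn2ereal P - enn2ereal N"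
    proof -
      have "(\<integral>\<^sup>+lam. e2ennreal (u (qline a b lam)) * indicator C lam \<partial>lborel) = P"
        "(\<integral>\<^sup>+lam. e2ennreal (- u (qline a b lam)) * indicator C lam \<partial>lborel) = N"
        unfolding P_def N_def using w by (auto intro!: nn_integral_cong simp: qline_eq indicator_def)
      then show ?thesis unfolding ereal_integral_on_def by simp
    qed
    ultimately show ?thesis by (simp add: qline_eq)
  qed
  \<comment> \<open>where u is at most M, both sides of (M - u) + max u 0 = M + max (- u) 0 make sense in the nonnegative reals with infinity\<close>
  have "J + P = (\<integral>\<^sup>+lam. (e2ennreal (ereal M - w lam) + e2ennreal (w lam)) * indicator C lam \<partial>lborel)"
    unfolding J_def P_def by (subst nn_integral_add[symmetric]) (auto simp: distrib_right)
  also have "\<dots> = (\<integral>\<^sup>+lam. (ennreal M + e2ennreal (- w lam)) * indicator C lam \<partial>lborel)"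
  proof (intro nn_integral_cong)
    fix lam :: quat
    have "e2ennreal (ereal M - w lam) + e2ennreal (w lam) = ennreal M + e2ennreal (- w lam)" if "lam \<in> C"
    proof (cases "w lam")
      case (real x)
      then have "x \<le> M" using w(2)[OF that] by simp
      then show ?thesis using real M(1)
        by (cases "0 \<le> x") (auto simp: e2ennreal_ereal ennreal_neg simp flip: ennreal_plus)
    next
      case PInf then show ?thesis using w(2)[OF that] by simp
    next
      case MInf then show ?thesis by simp
    qed
    then show "(e2ennreal (ereal M - w lam) + e2ennreal (w lam)) * indicator C lam = (ennreal M + e2ennreal (- w lam)) * indicator C lam"
      by (auto simp: indicator_def)
  qed
  also have "\<dots> = ennreal M * emeasure lborel C + N"
    unfolding N_def distrib_right by (subst nn_integral_add) (auto simp: nn_integral_cmult)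
  finally have JP: "J + P = ennreal (M * V) + N" using V M by (simp add: ennreal_mult)
  have Pfin: "P < \<infinity>"
  proof -
    have "P \<le> (\<integral>\<^sup>+lam. ennreal M * indicator C lam \<partial>lborel)"
      unfolding P_def
    proof (intro nn_integral_mono)
      fix lam :: quat
      show "e2ennreal (w lam) * indicator C lam \<le> ennreal M * indicator C lam"
        using w(2)[of lam] e2ennreal_mono[of "w lam" "ereal M"] by (auto simp: indicator_def e2ennreal_ereal)
    qed
    also have "\<dots> < \<infinity>" using V by (simp add: nn_integral_cmult ennreal_mult_less_top)
    finally show ?thesis .
  qed
  have "J \<le> emeasure lborel C * e2ennreal (ereal M - u a)"
  proof (cases "u a")
    case PInf
    then show ?thesis using w(2)[OF 0] w(1)[OF 0] by simp
  next
    case MInf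
    then show ?thesis using V by (simp add: ennreal_mult_top)
  next
    case (real x)
    have xM: "x \<le> M" using w(2)[OF 0] w(1)[OF 0] real by simp
    have Nfin: "N < \<infinity>"
    proof (rule ccontr)
      assume "\<not> N < \<infinity>"
      then have "N = \<infinity>" by (metis infinity_ennreal_def top.not_eq_extremum)
      then have "enn2ereal P - enn2ereal N = - \<infinity>" using Pfin 
        by (cases P rule: ennreal_cases) (auto simp: enn2ereal_ennreal)
      then have "u a \<le> - \<infinity>" using sub V by simp
      then show False using real by simp
    qed
    obtain p where p: "P = ennreal p" "0 \<le> p" using Pfin by (cases P rule: ennreal_cases) auto
    obtain m where m: "N = ennreal m" "0 \<le> m" using Nfin by (cases N rule: ennreal_cases) auto
    have "x \<le> (p - m) / V" using sub V p m real by (simp add: enn2ereal_ennreal)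
    then have xV: "x * V \<le> p - m" using V by (simp add: field_simps)
    have "J + P < \<infinity>" unfolding JP m(1) by simp
    then have "J < \<infinity>" by (rule le_less_trans[rotated]) simp
    then obtain j where j: "J = ennreal j" "0 \<le> j" by (cases J rule: ennreal_cases) auto
    have "ennreal (j + p) = ennreal (M * V + m)" using JP p m j M V by (simp add: ennreal_plus)
    then have "j + p = M * V + m" using p m j M V by (subst (asm) ennreal_inj) auto
    then have "j \<le> V * (M - x)" using xV by (simp add: algebra_simps)
    then show ?thesis using j V xM real by (simp add: e2ennreal_ereal ennreal_mult[symmetric] ennreal_leI)
  qed
  moreover have "J = (\<integral>\<^sup>+lam. e2ennreal (ereal M - u (a + qact b lam)) * indicator C lam \<partial>lborel)"
    unfolding J_def using w by (auto intro!: nn_integral_cong simp: indicator_def)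
  ultimately show ?thesis by (simp add: C_def)
qed

text \<open>Integrate the inequality on the line in direction \<open>b\<close> over \<open>b\<close> in the unit ball. In the resulting double integral
  the integral over \<open>b\<close> for fixed \<open>\<lambda>\<close> is \<open>\<bar>\<lambda>\<bar>\<^bsup>-4n\<^esup>\<close> times the integral of \<open>M - u\<close> over the ball of radius \<open>\<bar>\<lambda>\<bar>\<close>, and
  the ball \<open>A\<close> of radius \<open>r/4\<close> contains only \<open>\<lambda>\<close> with \<open>r/2 \<le> \<bar>\<lambda>\<bar> \<le> r\<close>.\<close>

theorem PSH_ball_integral_finite:
  fixes u :: "'n::finite qspace \<Rightarrow> ereal"
  assumes u: "u \<in> PSH \<Omega>" and op: "open \<Omega>" and r: "0 < r" "cball a r \<subseteq> \<Omega>" and ua: "u a \<noteq> - \<infinity>"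
    and M: "0 \<le> M" "\<And>x. x \<in> cball a r \<Longrightarrow> u x \<le> ereal M"
  shows "(\<integral>\<^sup>+x. e2ennreal (ereal M - u x) * indicator (cball a (r/2)) x \<partial>lborel) < \<infinity>"
proof -
  let ?D = "DIM('n qspace)"
  have usc: "usc_on \<Omega> u" using u by (simp add: PSH_def)
  define u0 where "u0 = (\<lambda>x. if x \<in> \<Omega> then u x else 0)"
  have [measurable]: "u0 \<in> borel_measurable borel" unfolding u0_def by (rule usc_borel[OF usc op])
  define v where "v = (\<lambda>x. e2ennreal (ereal M - u0 (a + x)))"
  have [measurable]: "v \<in> borel_measurable borel" unfolding v_def by measurable
  have v: "v x = e2ennreal (ereal M - u (a + x))" if "norm x \<le> r" for x
  proof -
    have "a + x \<in> cball a r" using that by (simp add: dist_norm)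
    then show ?thesis using r by (auto simp: v_def u0_def)
  qed
  let ?B = "cball (0::'n qspace) 1" and ?C = "cball (0::quat) r"
  have [measurable]: "?B \<in> sets borel" "?C \<in> sets borel" by auto
  have [measurable]: "cball (0::'n qspace) s \<in> sets borel" for s by auto
  define I where "I = (\<integral>\<^sup>+x. v x * indicator (cball 0 (r/2)) x \<partial>lborel)"
  have v0: "v 0 < \<infinity>"
  proof -
    have "u a \<le> ereal M" using M(2)[of a] r by simp
    then obtain x where "u a = ereal x" using ua by (cases "u a") auto
    then show ?thesis using v[of 0] r by (simp add: e2ennreal_ereal)
  qed
  have Vf: "emeasure lborel ?C < \<infinity>" "emeasure lborel ?B < \<infinity>"
    using emeasure_cball_pos_finite(2)[OF r(1)] emeasure_cball_pos_finite(2)[of 1] by auto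
  have line: "(\<integral>\<^sup>+lam. v (qact b lam) * indicator ?C lam \<partial>lborel) \<le> emeasure lborel ?C * v 0" if "b \<in> ?B" for b
  proof -
    have nb: "norm (qact b lam) \<le> r" if "lam \<in> ?C" for lam
    proof -
      have "norm lam * norm b \<le> r * 1" using that \<open>b \<in> ?B\<close> r by (intro mult_mono) auto
      then show ?thesis by (simp add: norm_qact)
    qed
    show ?thesis
    proof (cases "b = 0")
      case True
      then show ?thesis by (simp add: nn_integral_cmult mult.commute)
    next
      case False
      have mem: "a + qact b lam \<in> cball a r" if "lam \<in> ?C" for lam
        using nb[OF that] by (simp add: dist_norm)
      have "(\<integral>\<^sup>+lam. v (qact b lam) * indicator ?C lam \<partial>lborel) = 
        (\<integral>\<^sup>+lam. e2ennreal (ereal M - u (a + qact b lam)) * indicator ?C lam \<partial>lborel)"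
        using v nb by (auto intro!: nn_integral_cong simp: indicator_def)
      also have "\<dots> \<le> emeasure lborel ?C * e2ennreal (ereal M - u a)"
        by (rule PSH_line_mean[OF u op False r(1) _ M(1)]) (use mem r M in auto)
      finally show ?thesis using v[of 0] r by simp
    qed
  qed
  define T where "T = (\<integral>\<^sup>+b. \<integral>\<^sup>+lam. v (qact b lam) * indicator ?C lam * indicator ?B b \<partial>lborel \<partial>lborel)"
  have "T \<le> (\<integral>\<^sup>+b. (emeasure lborel ?C * v 0) * indicator ?B b \<partial>lborel)"
    unfolding T_def
  proof (rule nn_integral_mono)
    fix b
    have "(\<integral>\<^sup>+lam. v (qact b lam) * indicator ?C lam * indicator ?B b \<partial>lborel) = 
       (\<integral>\<^sup>+lam. v (qact b lam) * indicator ?C lam \<partial>lborel) * indicator ?B b"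
      by (rule nn_integral_multc) measurable
    then show "(\<integral>\<^sup>+lam. v (qact b lam) * indicator ?C lam * indicator ?B b \<partial>lborel) \<le> (emeasure lborel ?C * v 0) * indicator ?B b"
      using line[of b] by (auto simp: indicator_def)
  qed
  also have "\<dots> < \<infinity>" using v0 Vf by (simp add: nn_integral_cmult ennreal_mult_less_top)
  finally have T: "T < \<infinity>" .
  have Teq: "T = (\<integral>\<^sup>+lam. \<integral>\<^sup>+b. v (qact b lam) * indicator ?C lam * indicator ?B b \<partial>lborel \<partial>lborel)"
    unfolding T_def by (rule lborel_pair.Fubini') measurable
  let ?A = "cball (axis 1 (3*r/4) :: quat) (r/4)"
  have nax: "norm (axis 1 (3*r/4) :: quat) = 3*r/4"
    using r by (simp add: norm_quat_sq[THEN real_sqrt_unique, symmetric] norm_vec_def L2_set_def sum_UNIV_4 axis_def)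
  have A: "r/2 \<le> norm lam \<and> norm lam \<le> r" if "lam \<in> ?A" for lam
    using that norm_triangle_ineq2[of "axis 1 (3*r/4)" lam] norm_triangle_ineq2[of lam "axis 1 (3*r/4)"] nax
    by (auto simp: dist_norm norm_minus_commute)
  have inner: "I \<le> ennreal (r ^ ?D) * (\<integral>\<^sup>+b. v (qact b lam) * indicator ?C lam * indicator ?B b \<partial>lborel)" if "lam \<in> ?A" for lam
  proof -
    let ?s = "norm lam"
    have s: "r/2 \<le> ?s" "?s \<le> r" "0 < ?s" using A[OF that] r by auto
    have "I \<le> (\<integral>\<^sup>+x. v x * indicator (cball 0 ?s) x \<partial>lborel)"
      unfolding I_def using s by (intro nn_integral_mono) (auto simp: indicator_def)
    also have "\<dots> = ennreal (?s ^ ?D) * (\<integral>\<^sup>+b. v (qact b lam) * indicator (cball 0 ?s) (qact b lam) \<partial>lborel)"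
      by (rule nn_integral_homothety[symmetric, OF linear_qact_left norm_qact s(3)]) measurable
    also have "(\<lambda>b::'n qspace. v (qact b lam) * indicator (cball 0 ?s) (qact b lam)) = 
       (\<lambda>b. v (qact b lam) * indicator ?C lam * indicator ?B b)"
      using s by (auto simp: indicator_def norm_qact fun_eq_iff)
    also have "ennreal (?s ^ ?D) * (\<integral>\<^sup>+b. v (qact b lam) * indicator ?C lam * indicator ?B b \<partial>lborel)
      \<le> ennreal (r ^ ?D) * (\<integral>\<^sup>+b. v (qact b lam) * indicator ?C lam * indicator ?B b \<partial>lborel)"
      using s by (intro mult_right_mono ennreal_leI power_mono) auto
    finally show ?thesis .
  qed
  have "I * emeasure lborel ?A = (\<integral>\<^sup>+lam. I * indicator ?A lam \<partial>lborel)"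
    by (rule nn_integral_cmult_indicator[symmetric]) simp
  also have "\<dots> \<le> (\<integral>\<^sup>+lam. ennreal (r ^ ?D) * (\<integral>\<^sup>+b. v (qact b lam) * indicator ?C lam * indicator ?B b \<partial>lborel) \<partial>lborel)"
    using inner by (intro nn_integral_mono) (auto simp: indicator_def)
  also have "\<dots> = ennreal (r ^ ?D) * T"
    unfolding Teq by (rule nn_integral_cmult) measurable
  also have "\<dots> < \<infinity>" using T by (simp add: ennreal_mult_less_top)
  finally have "I * emeasure lborel ?A < \<infinity>" .
  moreover have "0 < emeasure lborel ?A" using r by (intro emeasure_cball_pos_finite(1)) simp
  ultimately have "I < \<infinity>" by (auto simp: ennreal_mult_less_top)
  moreover have "(\<integral>\<^sup>+x. e2ennreal (ereal M - u x) * indicator (cball a (r/2)) x \<partial>lborel) = I"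
  proof -
    have "(\<integral>\<^sup>+x. e2ennreal (ereal M - u x) * indicator (cball a (r/2)) x \<partial>lborel) = 
      (\<integral>\<^sup>+x. v (x - a) * indicator (cball 0 (r/2)) (x - a) \<partial>lborel)"
      using r v by (intro nn_integral_cong) (auto simp: indicator_def dist_norm norm_minus_commute)
    also have "\<dots> = I"
      unfolding I_def using lborel_nn_integral_shift[of "\<lambda>x. v x * indicator (cball 0 (r/2)) x" "- a"] by simp
    finally show ?thesis .
  qed
  ultimately show ?thesis by simp
qed

section \<open>Local integrability\<close>

lemma PSH_integrable_near:
  fixes u :: "'n::finite qspace \<Rightarrow> ereal"
  assumes u: "u \<in> PSH \<Omega>" and op: "open \<Omega>" and x: "x \<in> \<Omega>" "x \<in> closure {y \<in> \<Omega>. u y \<noteq> - \<infinity>}"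
  shows "\<exists>e>0. cball x e \<subseteq> \<Omega> \<and> set_integrable lborel (cball x e) (\<lambda>y. real_of_ereal (u y)) \<and>
     (AE y in lborel. y \<in> cball x e \<longrightarrow> u y \<noteq> - \<infinity>)"
proof -
  have usc: "usc_on \<Omega> u" using u by (simp add: PSH_def)
  obtain R where R: "R > 0" "cball x R \<subseteq> \<Omega>" using op x(1) open_contains_cball by blast
  define r where "r = R / 2"
  have r: "r > 0" "cball x (2 * r) \<subseteq> \<Omega>" using R by (auto simp: r_def)
  obtain y where y: "y \<in> \<Omega>" "u y \<noteq> - \<infinity>" "dist y x < r / 4"
    using x(2) r(1) unfolding closure_approachable by (metis (mono_tags, lifting) divide_pos_pos mem_Collect_eq zero_less_numeral)
  have sub1: "cball y r \<subseteq> \<Omega>"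
  proof
    fix z assume "z \<in> cball y r"
    then have "dist x z \<le> 2 * r" using y(3) r(1) dist_triangle[of x z y] by (simp add: dist_commute)
    then show "z \<in> \<Omega>" using r(2) by auto
  qed
  have sub2: "cball x (r/4) \<subseteq> cball y (r/2)"
  proof
    fix z assume "z \<in> cball x (r/4)"
    then show "z \<in> cball y (r/2)" using y(3) r(1) dist_triangle[of y z x] by simp
  qed
  obtain M where M: "0 \<le> M" "\<And>z. z \<in> cball y r \<Longrightarrow> u z \<le> ereal M"
    using usc_bounded_above[OF usc op compact_cball sub1] by blast
  have fin: "(\<integral>\<^sup>+z. e2ennreal (ereal M - u z) * indicator (cball y (r/2)) z \<partial>lborel) < \<infinity>"
    by (rule PSH_ball_integral_finite[OF u op r(1) sub1 y(2) M])
  define u0 where "u0 = (\<lambda>x. if x \<in> \<Omega> then u x else 0)"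
  have [measurable]: "u0 \<in> borel_measurable borel" unfolding u0_def by (rule usc_borel[OF usc op])
  let ?C = "cball y (r/2)"
  have [measurable]: "?C \<in> sets borel" "cball x (r/4) \<in> sets borel" by auto
  have u0: "u0 z = u z" "u z \<le> ereal M" if "z \<in> ?C" for z
  proof -
    have "z \<in> cball y r" using that r by auto
    then show "u0 z = u z" "u z \<le> ereal M" using sub1 M by (auto simp: u0_def)
  qed
  let ?v = "\<lambda>z. e2ennreal (ereal M - u0 z) * indicator ?C z"
  have fin0: "(\<integral>\<^sup>+z. ?v z \<partial>lborel) < \<infinity>"
  proof -
    have "(\<integral>\<^sup>+z. ?v z \<partial>lborel) = (\<integral>\<^sup>+z. e2ennreal (ereal M - u z) * indicator ?C z \<partial>lborel)"
      using u0 by (intro nn_integral_cong) (auto simp: indicator_def)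
    then show ?thesis using fin by simp
  qed
  have ae: "AE z in lborel. ?v z \<noteq> \<infinity>"
    using fin0 by (intro nn_integral_noteq_infinite) auto
  have "AE z in lborel. z \<in> cball x (r/4) \<longrightarrow> u z \<noteq> - \<infinity>"
    using ae
  proof (rule AE_mp, intro AE_I2 impI)
    fix z assume "?v z \<noteq> \<infinity>" "z \<in> cball x (r/4)"
    then show "u z \<noteq> - \<infinity>" using u0[of z] sub2 by (auto simp: indicator_def)
  qed
  moreover have "set_integrable lborel (cball x (r/4)) (\<lambda>y. real_of_ereal (u y))"
    unfolding set_integrable_def
  proof (rule integrableI_bounded)
    have "(\<lambda>z. indicator (cball x (r/4)) z *\<^sub>R real_of_ereal (u z)) = 
       (\<lambda>z. indicator (cball x (r/4)) z *\<^sub>R real_of_ereal (u0 z))"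
      using u0 sub2 by (auto simp: indicator_def fun_eq_iff)
    then show "(\<lambda>z. indicator (cball x (r/4)) z *\<^sub>R real_of_ereal (u z)) \<in> borel_measurable lborel" by simp
    have "(\<integral>\<^sup>+z. ennreal (norm (indicator (cball x (r/4)) z *\<^sub>R real_of_ereal (u z))) \<partial>lborel) \<le>
      (\<integral>\<^sup>+z. ?v z + ennreal M * indicator ?C z \<partial>lborel)"
    proof (rule nn_integral_mono)
      fix z
      show "ennreal (norm (indicator (cball x (r/4)) z *\<^sub>R real_of_ereal (u z))) \<le> ?v z + ennreal M * indicator ?C z"
      proof (cases "z \<in> cball x (r/4)")
        case True
        then have z: "z \<in> ?C" using sub2 by blast
        show ?thesis
        proof (cases "u z")
          case (real t)
          then have "t \<le> M" using u0(2)[OF z] by simp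
          then have "ennreal \<bar>t\<bar> \<le> ennreal (M - t + M)" using M(1) by (intro ennreal_leI) auto
          then show ?thesis using real True z u0(1)[OF z] \<open>t \<le> M\<close> M(1) 
            by (simp add: e2ennreal_ereal flip: ennreal_plus)
        qed (use True in auto)
      qed simp
    qed
    also have "\<dots> = (\<integral>\<^sup>+z. ?v z \<partial>lborel) + ennreal M * emeasure lborel ?C"
      by (subst nn_integral_add) (auto simp: nn_integral_cmult_indicator)
    also have "\<dots> < \<infinity>" 
      using fin0 emeasure_bounded_finite[of ?C] by (simp add: ennreal_mult_less_top)
    finally show "(\<integral>\<^sup>+z. ennreal (norm (indicator (cball x (r/4)) z *\<^sub>R real_of_ereal (u z))) \<partial>lborel) < \<infinity>" .
  qed
  moreover have "cball x (r/4) \<subseteq> \<Omega>" using r by auto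
  ultimately show ?thesis using r(1) by (intro exI[of _ "r/4"]) auto
qed

text \<open>Near a limit point \<open>x\<close> of \<open>A = {u > -\<infinity>}\<close> the function is integrable, hence finite almost everywhere, hence a whole
  neighbourhood of \<open>x\<close> lies in the closure of \<open>A\<close>.\<close>

theorem PSH_loc_integrable:
  fixes u :: "'n::finite qspace \<Rightarrow> ereal"
  assumes op: "open \<Omega>" and con: "connected \<Omega>" and u: "u \<in> PSH \<Omega>" and ne: "\<exists>x\<in>\<Omega>. u x \<noteq> - \<infinity>"
  shows "loc_integrable_on \<Omega> u"
proof -
  have usc: "usc_on \<Omega> u" using u by (simp add: PSH_def)
  let ?A = "{y \<in> \<Omega>. u y \<noteq> - \<infinity>}"
  let ?S = "\<Omega> \<inter> closure ?A"
  note near = PSH_integrable_near[OF u op]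
  have "openin (top_of_set \<Omega>) ?S"
    unfolding openin_contains_ball
  proof (intro conjI ballI)
    fix x assume x: "x \<in> ?S"
    then obtain e where e: "e > 0" "cball x e \<subseteq> \<Omega>" "AE y in lborel. y \<in> cball x e \<longrightarrow> u y \<noteq> - \<infinity>"
      using near[of x] by blast
    have "ball x e \<subseteq> closure ?A"
    proof
      fix z assume z: "z \<in> ball x e"
      show "z \<in> closure ?A"
        unfolding closure_approachable
      proof (intro allI impI)
        fix d :: real assume d: "d > 0"
        show "\<exists>y\<in>?A. dist y z < d"
        proof (rule ccontr)
          assume no: "\<not> (\<exists>y\<in>?A. dist y z < d)"
          define d' where "d' = min d (e - dist x z) / 2"
          have d': "0 < d'" "d' < d" "d' < e - dist x z" using d z by (auto simp: d'_def min_def)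
          have "AE y in lborel. y \<notin> cball z d'"
            using e(3)
          proof (rule AE_mp, intro AE_I2 impI notI)
            fix y assume y: "y \<in> cball x e \<longrightarrow> u y \<noteq> - \<infinity>" "y \<in> cball z d'"
            have "dist x y \<le> e" using y(2) d' dist_triangle[of x y z] by simp
            then have "y \<in> ?A" using y(1) e(2) by auto
            moreover have "dist y z < d" using y(2) d' by (simp add: dist_commute)
            ultimately show False using no by blast
          qed
          then have "emeasure lborel (cball z d') = 0"
            by (subst (asm) AE_iff_measurable[of "cball z d'"]) auto
          then show False using emeasure_cball_pos_finite(1)[OF d'(1), of z] by simp
        qed
      qed
    qed
    then show "\<exists>e>0. ball x e \<inter> \<Omega> \<subseteq> ?S" using e by blast
  qed simp
  moreover have "closedin (top_of_set \<Omega>) ?S" by (simp add: closedin_closed_Int)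
  moreover have "?S \<noteq> {}" using ne closure_subset[of ?A] by blast
  ultimately have S: "?S = \<Omega>" using con unfolding connected_clopen by blast
  have "\<forall>x\<in>\<Omega>. \<exists>e. e > 0 \<and> cball x e \<subseteq> \<Omega> \<and> set_integrable lborel (cball x e) (\<lambda>y. real_of_ereal (u y)) \<and>
     (AE y in lborel. y \<in> cball x e \<longrightarrow> u y \<noteq> - \<infinity>)"
    using near S by blast
  from bchoice[OF this] obtain e where e: "\<And>x. x \<in> \<Omega> \<Longrightarrow> e x > 0" "\<And>x. x \<in> \<Omega> \<Longrightarrow> cball x (e x) \<subseteq> \<Omega>"
    "\<And>x. x \<in> \<Omega> \<Longrightarrow> set_integrable lborel (cball x (e x)) (\<lambda>y. real_of_ereal (u y))"
    "\<And>x. x \<in> \<Omega> \<Longrightarrow> AE y in lborel. y \<in> cball x (e x) \<longrightarrow> u y \<noteq> - \<infinity>"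
    by blast
  let ?\<F> = "(\<lambda>x. ball x (e x)) ` \<Omega>"
  have cover: "\<Omega> \<subseteq> \<Union>?\<F>" using e(1) by force
  show ?thesis
    unfolding loc_integrable_on_def
  proof (intro conjI allI impI)
    obtain \<G> where \<G>: "\<G> \<subseteq> ?\<F>" "countable \<G>" "\<Union>\<G> = \<Union>?\<F>"
      by (rule Lindelof[of ?\<F>]) auto
    obtain D where D: "D \<subseteq> \<Omega>" "countable D" "\<G> = (\<lambda>x. ball x (e x)) ` D"
    proof -
      have "countable \<G> \<and> \<G> \<subseteq> ?\<F>" using \<G> by blast
      then have "\<exists>D. countable D \<and> D \<subseteq> \<Omega> \<and> \<G> = (\<lambda>x. ball x (e x)) ` D"
        unfolding countable_subset_image .
      then show thesis using that by blast
    qed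
    have "AE y in lborel. \<forall>x\<in>D. y \<in> cball x (e x) \<longrightarrow> u y \<noteq> - \<infinity>"
      using D e(4) by (subst AE_ball_countable) auto
    then show "AE y in lborel. y \<in> \<Omega> \<longrightarrow> \<bar>u y\<bar> \<noteq> \<infinity>"
    proof (rule AE_mp, intro AE_I2 impI)
      fix y assume y: "\<forall>x\<in>D. y \<in> cball x (e x) \<longrightarrow> u y \<noteq> - \<infinity>" "y \<in> \<Omega>"
      then have "y \<in> \<Union>\<G>" using cover \<G>(3) by blast
      then have "u y \<noteq> - \<infinity>" using y(1) unfolding D(3) by force
      moreover have "u y < \<infinity>" using usc y(2) unfolding usc_on_def by blast
      ultimately show "\<bar>u y\<bar> \<noteq> \<infinity>" by (cases "u y") auto
    qed
  next
    fix K assume K: "compact K" "K \<subseteq> \<Omega>"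
    obtain D where D: "D \<subseteq> \<Omega>" "finite D" "K \<subseteq> (\<Union>x\<in>D. ball x (e x))"
    proof (rule compactE_image[OF K(1), of \<Omega> "\<lambda>x. ball x (e x)"])
      show "K \<subseteq> (\<Union>x\<in>\<Omega>. ball x (e x))" using K(2) cover by blast
    qed auto
    have "set_integrable lborel (\<Union>x\<in>D. cball x (e x)) (\<lambda>y. real_of_ereal (u y))"
      using D by (intro set_integrable_UN) (auto intro: e(3))
    then show "set_integrable lborel K (\<lambda>y. real_of_ereal (u y))"
    proof (rule set_integrable_subset)
      show "K \<in> sets lborel" using K(1) by (simp add: compact_imp_closed)
      have "(\<Union>x\<in>D. ball x (e x)) \<subseteq> (\<Union>x\<in>D. cball x (e x))" by (rule UN_mono) auto
      then show "K \<subseteq> (\<Union>x\<in>D. cball x (e x))" using D(3) by blast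
    qed
  qed
qed

section \<open>Smooth forms and the operators d\<close>

lemma dd_lincomb:
  fixes f g :: "'a::real_normed_vector \<Rightarrow> complex"
  assumes "f differentiable at x" "g differentiable at x"
  shows "dd v (\<lambda>y. c * f y + d * g y) x = c * dd v f x + d * dd v g x"
proof -
  have "((\<lambda>y. c * f y + d * g y) has_derivative
     (\<lambda>v. c * frechet_derivative f (at x) v + d * frechet_derivative g (at x) v)) (at x)"
    using assms unfolding frechet_derivative_works
    by (intro derivative_eq_intros) auto
  from frechet_derivative_at[OF this] show ?thesis by metis
qed

lemma smooth_differentiable: "smooth f \<Longrightarrow> f differentiable_on UNIV"
  unfolding smooth_def by (metis empty_subsetI iter_deriv.simps(1) list.set(1))

lemma smooth_differentiable_at: "smooth f \<Longrightarrow> f differentiable at x"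
  using smooth_differentiable unfolding differentiable_on_def by auto

lemma iter_deriv_append: "iter_deriv (vs @ [v]) f = iter_deriv vs (dd v f)"
  by (induction vs) auto

lemma smooth_dd: 
  assumes "smooth f" "v \<in> Basis"
  shows "smooth (dd v f)"
  unfolding smooth_def
proof (intro allI impI)
  fix vs :: "'a list" assume "set vs \<subseteq> Basis"
  then have "set (vs @ [v]) \<subseteq> Basis" using assms(2) by simp
  then show "iter_deriv vs (dd v f) differentiable_on UNIV"
    using assms(1) unfolding smooth_def iter_deriv_append[symmetric] by blast
qed

lemma smooth_continuous: "smooth f \<Longrightarrow> continuous_on UNIV f"
  using smooth_differentiable differentiable_imp_continuous_on by blast

lemma smooth_lincomb:
  fixes f g :: "'a::euclidean_space \<Rightarrow> complex"
  assumes "smooth f" "smooth g"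
  shows "smooth (\<lambda>x. c * f x + d * g x)"
  unfolding smooth_def
proof (intro allI impI)
  fix vs :: "'a list" assume vs: "set vs \<subseteq> Basis"
  have d: "iter_deriv vs f differentiable_on UNIV" "iter_deriv vs g differentiable_on UNIV" if "set vs \<subseteq> Basis" for vs
    using that assms unfolding smooth_def by auto
  have "iter_deriv vs (\<lambda>x. c * f x + d * g x) = (\<lambda>x. c * iter_deriv vs f x + d * iter_deriv vs g x)"
    using vs
  proof (induction vs)
    case (Cons v vs)
    have "iter_deriv (v # vs) (\<lambda>x. c * f x + d * g x) = dd v (\<lambda>x. c * iter_deriv vs f x + d * iter_deriv vs g x)"
      using Cons by simp
    also have "\<dots> = (\<lambda>x. c * dd v (iter_deriv vs f) x + d * dd v (iter_deriv vs g) x)"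
    proof
      fix x
      have "iter_deriv vs f differentiable at x" "iter_deriv vs g differentiable at x"
        using d[of vs] Cons.prems unfolding differentiable_on_def by auto
      then show "dd v (\<lambda>x. c * iter_deriv vs f x + d * iter_deriv vs g x) x = 
          c * dd v (iter_deriv vs f) x + d * dd v (iter_deriv vs g) x"
        by (rule dd_lincomb)
    qed
    finally show ?case by simp
  qed simp
  then show "iter_deriv vs (\<lambda>x. c * f x + d * g x) differentiable_on UNIV"
    using d[OF vs] by (auto intro!: derivative_intros)
qed

lemma iter_deriv_zero: "iter_deriv vs (\<lambda>x. 0) = (\<lambda>x. 0)"
  by (induction vs) auto

lemma smooth_zero: "smooth (\<lambda>x. 0)"
  by (simp add: smooth_def iter_deriv_zero)

lemma smooth_sum:
  fixes f :: "'i \<Rightarrow> 'a::euclidean_space \<Rightarrow> complex"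
  assumes "\<And>i. i \<in> A \<Longrightarrow> smooth (f i)"
  shows "smooth (\<lambda>x. \<Sum>i\<in>A. c i * f i x)"
  using assms
proof (induction A rule: infinite_finite_induct)
  case (insert i A)
  have "smooth (\<lambda>x. c i * f i x + 1 * (\<Sum>i\<in>A. c i * f i x))"
    by (rule smooth_lincomb) (use insert in auto)
  then show ?case using insert by simp
qed (auto simp: smooth_zero)

lemma dd_sum:
  fixes f :: "'i \<Rightarrow> 'a::euclidean_space \<Rightarrow> complex"
  assumes "\<And>i. i \<in> A \<Longrightarrow> smooth (f i)"
  shows "dd v (\<lambda>x. \<Sum>i\<in>A. c i * f i x) x = (\<Sum>i\<in>A. c i * dd v (f i) x)"
  using assms
proof (induction A rule: infinite_finite_induct)
  case (insert i A)
  have "dd v (\<lambda>x. c i * f i x + 1 * (\<Sum>i\<in>A. c i * f i x)) x = c i * dd v (f i) x + 1 * dd v (\<lambda>x. \<Sum>i\<in>A. c i * f i x) x"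
    by (rule dd_lincomb) (use insert smooth_sum[of A f c] in \<open>auto intro: smooth_differentiable_at\<close>)
  then show ?case using insert by simp
qed auto

lemma smooth_dd_commute:
  fixes f :: "'a::euclidean_space \<Rightarrow> complex"
  assumes "smooth f" "v \<in> Basis" "w \<in> Basis"
  shows "dd w (dd v f) x = dd v (dd w f) x"
  by (rule mixed_dd_commute) (use assms in \<open>auto intro: smooth_dd smooth_differentiable smooth_continuous\<close>)

text \<open>The four real coordinate directions of \<open>q\<^sub>l\<close>, addressed by \<open>k = 2l\<close> or \<open>k = 2l+1\<close> as in
  \<open>\<nabla>\<^bsub>k\<alpha>\<^esub>\<close>; \<open>ncoef\<close> below lists the coefficients of \<open>\<nabla>\<^bsub>k\<alpha>\<^esub>\<close> in these directions.\<close>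

definition bvec :: "nat \<Rightarrow> 4 \<Rightarrow> 'n::{finite,linorder} qspace" where
  "bvec k s = axis (coord (k div 2)) (axis s 1)"

definition ncoef :: "nat \<Rightarrow> nat \<Rightarrow> 4 \<Rightarrow> complex" where
  "ncoef k \<alpha> s = 
    (if even k then (if \<alpha> = 0 then (if s = 1 then 1 else if s = 2 then \<i> else 0)
                     else (if s = 3 then - 1 else if s = 4 then - \<i> else 0))
     else (if \<alpha> = 0 then (if s = 3 then 1 else if s = 4 then - \<i> else 0)
           else (if s = 1 then 1 else if s = 2 then - \<i> else 0)))"

lemma bvec_Basis: "bvec k s \<in> Basis"
  by (simp add: bvec_def axis_in_Basis_iff)

lemma nabla_eq: "nabla k \<alpha> f x = (\<Sum>s\<in>UNIV. ncoef k \<alpha> s * dd (bvec k s) f x)"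
  by (simp add: nabla_def ncoef_def bvec_def partial_def sum_UNIV_4 Let_def)

lemma smooth_nabla: "smooth f \<Longrightarrow> smooth (nabla k \<alpha> f)"
  unfolding nabla_eq[abs_def] by (intro smooth_sum smooth_dd bvec_Basis)

lemma nabla_sum:
  assumes "\<And>i. i \<in> A \<Longrightarrow> smooth (f i)"
  shows "nabla k \<alpha> (\<lambda>x. \<Sum>i\<in>A. c i * f i x) x = (\<Sum>i\<in>A. c i * nabla k \<alpha> (f i) x)"
proof -
  have "nabla k \<alpha> (\<lambda>x. \<Sum>i\<in>A. c i * f i x) x = (\<Sum>s\<in>UNIV. ncoef k \<alpha> s * (\<Sum>i\<in>A. c i * dd (bvec k s) (f i) x))"
    unfolding nabla_eq by (intro sum.cong refl arg_cong2[of _ _ _ _ "(*)"] dd_sum assms)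
  also have "\<dots> = (\<Sum>i\<in>A. \<Sum>s\<in>UNIV. ncoef k \<alpha> s * (c i * dd (bvec k s) (f i) x))"
    unfolding sum_distrib_left by (rule sum.swap)
  finally show ?thesis by (simp add: nabla_eq sum_distrib_left mult.left_commute)
qed

lemma nabla_nabla:
  assumes "smooth f"
  shows "nabla k \<alpha> (nabla l \<beta> f) x = (\<Sum>s\<in>UNIV. \<Sum>t\<in>UNIV. ncoef k \<alpha> s * ncoef l \<beta> t * dd (bvec k s) (dd (bvec l t) f) x)"
  unfolding nabla_eq[of k] nabla_eq[of l, abs_def]
  using assms by (subst dd_sum) (auto intro: smooth_dd bvec_Basis simp: sum_distrib_left mult.assoc)

lemma nabla_commute:
  assumes "smooth f"
  shows "nabla k \<alpha> (nabla l \<beta> f) x = nabla l \<beta> (nabla k \<alpha> f) x"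
  unfolding nabla_nabla[OF assms]
  by (subst sum.swap, subst smooth_dd_commute[OF assms]) (auto simp: bvec_Basis mult.commute)

lemma d_form_eq:
  fixes F :: "'n::{finite,linorder} qform"
  shows "d_form \<alpha> F x J = (if J \<subseteq> {..<2*CARD('n)} then \<Sum>k\<in>J. wedge_sign k J * nabla k \<alpha> (\<lambda>y. F y (J - {k})) x else 0)"
proof -
  let ?N = "2*CARD('n)"
  have "(\<Sum>I\<in>Pow {..<?N}. nabla k \<alpha> (\<lambda>y. F y I) x * wedge (omega {k}) (omega I) J) = 
    (if J \<subseteq> {..<?N} \<and> k \<in> J then wedge_sign k J * nabla k \<alpha> (\<lambda>y. F y (J - {k})) x else 0)" if "k < ?N" for k
  proof -
    have "(\<Sum>I\<in>Pow {..<?N}. nabla k \<alpha> (\<lambda>y. F y I) x * wedge (omega {k}) (omega I) J) = 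
      (\<Sum>I\<in>Pow {..<?N}. if I = J - {k} then (if finite J \<and> k \<in> J then wedge_sign k J * nabla k \<alpha> (\<lambda>y. F y (J - {k})) x else 0) else 0)"
      unfolding wedge_omega1 by (rule sum.cong) (auto simp: omega_def)
    also have "\<dots> = (if J \<subseteq> {..<?N} \<and> k \<in> J then wedge_sign k J * nabla k \<alpha> (\<lambda>y. F y (J - {k})) x else 0)"
    proof (cases "J \<subseteq> {..<?N}")
      case True
      then have "finite J" "J - {k} \<in> Pow {..<?N}" using finite_subset by auto
      then show ?thesis using True by simp
    next
      case False
      then have "k \<in> J \<Longrightarrow> J - {k} \<notin> Pow {..<?N}" using that by auto
      then show ?thesis using False by auto
    qed
    finally show ?thesis .
  qed
  then have "d_form \<alpha> F x J = (\<Sum>k<?N. if J \<subseteq> {..<?N} \<and> k \<in> J then wedge_sign k J * nabla k \<alpha> (\<lambda>y. F y (J - {k})) x else 0)"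
    unfolding d_form_def by (intro sum.cong) auto
  also have "\<dots> = (if J \<subseteq> {..<?N} then \<Sum>k\<in>J. wedge_sign k J * nabla k \<alpha> (\<lambda>y. F y (J - {k})) x else 0)"
  proof (cases "J \<subseteq> {..<?N}")
    case True
    then show ?thesis by (auto simp: sum.inter_restrict[symmetric] Int_absorb1)
  qed auto
  finally show ?thesis .
qed

lemma smooth_d_form:
  fixes F :: "'n::{finite,linorder} qform"
  assumes "\<And>I. smooth (\<lambda>x. F x I)"
  shows "smooth (\<lambda>x. d_form \<alpha> F x J)"
proof (cases "J \<subseteq> {..<2*CARD('n)}")
  case True
  then show ?thesis unfolding d_form_eq by (simp add: smooth_sum smooth_nabla assms)
qed (simp add: d_form_eq smooth_zero)

lemma d_form_d_form:
  fixes F :: "'n::{finite,linorder} qform"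
  assumes "\<And>I. smooth (\<lambda>x. F x I)" and J: "J \<subseteq> {..<2*CARD('n)}"
  shows "d_form \<alpha> (d_form \<beta> F) x J = (\<Sum>k\<in>J. \<Sum>l\<in>J - {k}. wedge_sign k J * wedge_sign l (J - {k}) * 
    nabla k \<alpha> (nabla l \<beta> (\<lambda>y. F y (J - {k} - {l}))) x)"
proof -
  have "nabla k \<alpha> (\<lambda>y. d_form \<beta> F y (J - {k})) x = (\<Sum>l\<in>J - {k}. wedge_sign l (J - {k}) * nabla k \<alpha> (nabla l \<beta> (\<lambda>y. F y (J - {k} - {l}))) x)" for k
  proof -
    have "(\<lambda>y. d_form \<beta> F y (J - {k})) = (\<lambda>y. \<Sum>l\<in>J - {k}. wedge_sign l (J - {k}) * nabla l \<beta> (\<lambda>y. F y (J - {k} - {l})) y)"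
    proof -
      have "J - {k} \<subseteq> {..<2*CARD('n)}" using J by blast
      then show ?thesis unfolding d_form_eq by simp
    qed
    then show ?thesis using assms by (simp add: nabla_sum smooth_nabla)
  qed
  then show ?thesis
    unfolding d_form_eq[of \<alpha>] using J by (simp add: sum_distrib_left mult.assoc)
qed

text \<open>Exchanging the two indices changes the sign of the reordering (\<open>wedge_sign_swap\<close>) but not the second
  order derivative.\<close>

lemma d_form_anticommute:
  fixes F :: "'n::{finite,linorder} qform"
  assumes F: "\<And>I. smooth (\<lambda>x. F x I)"
  shows "d_form \<alpha> (d_form \<beta> F) x J = - d_form \<beta> (d_form \<alpha> F) x J"
proof (cases "J \<subseteq> {..<2*CARD('n)}")
  case J: True
  then have fin: "finite J" using finite_subset by blast
  let ?f = "\<lambda>\<alpha> \<beta> k l. wedge_sign k J * wedge_sign l (J - {k}) * nabla k \<alpha> (nabla l \<beta> (\<lambda>y. F y (J - {k} - {l}))) x"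
  have "d_form \<alpha> (d_form \<beta> F) x J = (\<Sum>k\<in>J. \<Sum>l\<in>J - {k}. ?f \<alpha> \<beta> k l)"
    by (rule d_form_d_form[OF F J])
  also have "\<dots> = (\<Sum>l\<in>J. \<Sum>k\<in>J - {l}. ?f \<alpha> \<beta> k l)"
  proof -
    have "(\<Sum>k\<in>J. \<Sum>l\<in>J - {k}. ?f \<alpha> \<beta> k l) = (\<Sum>k\<in>J. \<Sum>l\<in>{l\<in>J. l \<noteq> k}. ?f \<alpha> \<beta> k l)"
      by (intro sum.cong) auto
    also have "\<dots> = (\<Sum>l\<in>J. \<Sum>k\<in>{k\<in>J. l \<noteq> k}. ?f \<alpha> \<beta> k l)"
      by (rule sum.swap_restrict[OF fin fin])
    also have "\<dots> = (\<Sum>l\<in>J. \<Sum>k\<in>J - {l}. ?f \<alpha> \<beta> k l)"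
      by (intro sum.cong) auto
    finally show ?thesis .
  qed
  also have "\<dots> = (\<Sum>l\<in>J. \<Sum>k\<in>J - {l}. - ?f \<beta> \<alpha> l k)"
  proof (intro sum.cong refl)
    fix l k assume "l \<in> J" "k \<in> J - {l}"
    then have "wedge_sign k J * wedge_sign l (J - {k}) = - (wedge_sign l J * wedge_sign k (J - {l}))"
      using fin by (intro wedge_sign_swap) auto
    moreover have "J - {k} - {l} = J - {l} - {k}" by auto
    ultimately show "?f \<alpha> \<beta> k l = - ?f \<beta> \<alpha> l k"
      using nabla_commute[OF F, of k \<alpha> l \<beta>] by simp
  qed
  also have "\<dots> = - d_form \<beta> (d_form \<alpha> F) x J"
    unfolding d_form_d_form[OF F J] by (simp add: sum_negf)
  finally show ?thesis .
qed (simp add: d_form_eq)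

lemma d_form_zero: "d_form \<alpha> (\<lambda>x J. 0) = (\<lambda>x J. 0)"
  by (intro ext) (simp add: d_form_eq nabla_eq)

lemma d_form_twice:
  assumes F: "\<And>I. smooth (\<lambda>x. F x I)"
  shows "d_form \<alpha> (d_form \<alpha> F) = (\<lambda>x J. 0)"
proof (intro ext)
  fix x J
  have "d_form \<alpha> (d_form \<alpha> F) x J + d_form \<alpha> (d_form \<alpha> F) x J = 0"
    using d_form_anticommute[OF F, where \<alpha>=\<alpha> and \<beta>=\<alpha> and x=x and J=J] unfolding eq_neg_iff_add_eq_0 .
  then show "d_form \<alpha> (d_form \<alpha> F) x J = 0" by (simp flip: mult_2)
qed

text \<open>For \<open>\<alpha> = 0\<close> the factor \<open>d\<^sub>1\<close> is first moved out of the way: \<open>d\<^sub>0 d\<^sub>1 d\<^sub>0 = - d\<^sub>1 d\<^sub>0 d\<^sub>0\<close>.\<close>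

lemma laplace_form_d_form:
  assumes F: "\<And>I. smooth (\<lambda>x. F x I)" and \<alpha>: "\<alpha> \<in> {0, 1}"
  shows "laplace_form (d_form \<alpha> F) x J = 0"
proof (cases "\<alpha> = 1")
  case True
  then show ?thesis unfolding laplace_form_def using d_form_twice[OF F, where \<alpha>=1] by (simp add: d_form_zero)
next
  case False
  then have "\<alpha> = 0" using \<alpha> by auto
  have "d_form 0 (d_form 1 (d_form 0 F)) x J = - d_form 1 (d_form 0 (d_form 0 F)) x J"
    by (rule d_form_anticommute) (rule smooth_d_form[OF F])
  also have "\<dots> = 0" unfolding d_form_twice[OF F] d_form_zero by simp
  finally show ?thesis unfolding laplace_form_def \<open>\<alpha> = 0\<close> .
qed

text \<open>The sign of \<open>\<omega>\<^sup>k \<and> \<omega>\<^sup>l \<and> \<omega>\<^sup>I\<close> relative to the top form, where \<open>I\<close> is the complement of \<open>{k, l}\<close>.\<close>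

definition top_sign :: "nat \<Rightarrow> nat \<Rightarrow> nat \<Rightarrow> complex" where
  "top_sign N k l = (if k \<noteq> l then wedge_sign k {..<N} * wedge_sign l ({..<N} - {k}) else 0)"

lemma wedge_omega2_top:
  "k < N \<Longrightarrow> l < N \<Longrightarrow> wedge (omega {k}) (wedge (omega {l}) c) {..<N} = top_sign N k l * c ({..<N} - {k} - {l})"
  by (auto simp: wedge_omega1 top_sign_def)

lemma laplace_form_top:
  fixes \<phi> :: "'n::{finite,linorder} qform"
  assumes "\<And>I. smooth (\<lambda>x. \<phi> x I)" 
  defines "N \<equiv> 2*CARD('n)"
  shows "laplace_form \<phi> x {..<N} = (\<Sum>k<N. \<Sum>l<N. \<Sum>s\<in>UNIV. \<Sum>t\<in>UNIV.
    ncoef k 0 s * ncoef l 1 t * top_sign N k l * dd (bvec k s) (dd (bvec l t) (\<lambda>y. \<phi> y ({..<N} - {k} - {l}))) x)"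
proof -
  have "laplace_form \<phi> x {..<N} = (\<Sum>k<N. \<Sum>l\<in>{..<N} - {k}. wedge_sign k {..<N} * wedge_sign l ({..<N} - {k}) * 
    nabla k 0 (nabla l 1 (\<lambda>y. \<phi> y ({..<N} - {k} - {l}))) x)"
    unfolding laplace_form_def N_def by (rule d_form_d_form[OF assms(1)]) simp
  also have "\<dots> = (\<Sum>k<N. \<Sum>l<N. top_sign N k l * nabla k 0 (nabla l 1 (\<lambda>y. \<phi> y ({..<N} - {k} - {l}))) x)"
    by (intro sum.cong refl sum.mono_neutral_cong_left) (auto simp: top_sign_def)
  finally show ?thesis
    using assms(1) by (simp add: nabla_nabla sum_distrib_left mult_ac)
qed

section \<open>The closed current\<close>

abbreviation cutoff :: "('n::finite qspace \<Rightarrow> ereal) \<Rightarrow> 'n qspace set \<Rightarrow> 'n qspace \<Rightarrow> real" where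
  "cutoff u K \<equiv> (\<lambda>x. indicator K x * real_of_ereal (u x))"

lemma wedge_zero_form: "finite K \<Longrightarrow> wedge (zero_form u x) b K = complex_of_real (real_of_ereal (u x)) * b K"
proof -
  assume K: "finite K"
  have "wedge (zero_form u x) b K = (\<Sum>I\<in>Pow K. if I = {} then complex_of_real (real_of_ereal (u x)) * b K else 0)"
    unfolding wedge_def by (rule sum.cong) (auto simp: zero_form_def shuffle_sign_def)
  then show ?thesis using K by simp
qed

lemma laplace_current_zero_form:
  fixes u :: "'n::{finite,linorder} qspace \<Rightarrow> ereal"
  shows "laplace_current (current_of_form \<Omega> (zero_form u)) \<phi> =
    (LINT x:\<Omega>|lborel. complex_of_real (real_of_ereal (u x)) * laplace_form \<phi> x {..<2*CARD('n)})"
  unfolding laplace_current_def current_of_form_def form_integral_def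
  by (simp add: wedge_zero_form)

text \<open>Replacing \<open>u\<close> on \<open>\<Omega>\<close> by the globally integrable function \<open>cutoff u K\<close>, which agrees with \<open>u\<close> wherever the test
  function does not vanish.\<close>

lemma loc_integrable_mult_compact_support:
  fixes G :: "'n::finite qspace \<Rightarrow> complex"
  assumes u: "loc_integrable_on \<Omega> u" and K: "compact K" "K \<subseteq> \<Omega>"
    and G: "continuous_on UNIV G" "\<And>x. x \<notin> K \<Longrightarrow> G x = 0"
  shows "integrable lborel (\<lambda>x. cutoff u K x *\<^sub>R G x)"
    and "set_integrable lborel \<Omega> (\<lambda>x. complex_of_real (real_of_ereal (u x)) * G x)"
    and "(LINT x:\<Omega>|lborel. complex_of_real (real_of_ereal (u x)) * G x) = (LBINT x. cutoff u K x *\<^sub>R G x)"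
proof -
  have W: "integrable lborel (cutoff u K)"
    using u K unfolding loc_integrable_on_def set_integrable_def by simp
  obtain B where B: "0 \<le> B" "\<And>x. norm (G x) \<le> B"
    using bounded_continuous_compact_support[OF G(1) K(1) G(2)] by blast
  show i: "integrable lborel (\<lambda>x. cutoff u K x *\<^sub>R G x)"
  proof (rule Bochner_Integration.integrable_bound[of lborel "\<lambda>x. B * cutoff u K x"])
    show "integrable lborel (\<lambda>x. B * cutoff u K x)" using W by simp
    show "(\<lambda>x. cutoff u K x *\<^sub>R G x) \<in> borel_measurable lborel"
      using borel_measurable_integrable[OF W] borel_measurable_continuous_onI[OF G(1)] by simp
    show "AE x in lborel. norm (cutoff u K x *\<^sub>R G x) \<le> norm (B * cutoff u K x)"
    proof (rule AE_I2)
      fix x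
      have "\<bar>cutoff u K x\<bar> * norm (G x) \<le> \<bar>cutoff u K x\<bar> * B"
        using B by (intro mult_left_mono) auto
      then show "norm (cutoff u K x *\<^sub>R G x) \<le> norm (B * cutoff u K x)"
        using B(1) by (simp only: norm_scaleR real_norm_def abs_mult abs_of_nonneg mult.commute)
    qed
  qed
  have e: "(\<lambda>x. indicator \<Omega> x *\<^sub>R (complex_of_real (real_of_ereal (u x)) * G x)) = (\<lambda>x. cutoff u K x *\<^sub>R G x)"
  proof
    fix x
    show "indicator \<Omega> x *\<^sub>R (complex_of_real (real_of_ereal (u x)) * G x) = cutoff u K x *\<^sub>R G x"
      using G(2)[of x] K(2) by (cases "x \<in> K") (auto simp: scaleR_conv_of_real)
  qed
  show "set_integrable lborel \<Omega> (\<lambda>x. complex_of_real (real_of_ereal (u x)) * G x)"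
    unfolding set_integrable_def e by (rule i)
  show "(LINT x:\<Omega>|lborel. complex_of_real (real_of_ereal (u x)) * G x) = (LBINT x. cutoff u K x *\<^sub>R G x)"
    unfolding set_lebesgue_integral_def e ..
qed

lemma test_formsD:
  assumes "\<phi> \<in> test_forms \<Omega> q"
  shows "\<And>I. smooth (\<lambda>x. \<phi> x I)" "compact (form_support \<phi>)" "form_support \<phi> \<subseteq> \<Omega>"
  using assms unfolding test_forms_def by auto

lemma form_support_zero: "x \<notin> form_support \<phi> \<Longrightarrow> \<phi> x I = 0"
  unfolding form_support_def using closure_subset[of "{x. \<exists>I. \<phi> x I \<noteq> 0}"] by auto

lemma iter_deriv_off_support:
  fixes f :: "'a::euclidean_space \<Rightarrow> complex"
  assumes "smooth f" "compact K" "\<And>x. x \<notin> K \<Longrightarrow> f x = 0" "set vs \<subseteq> Basis" "x \<notin> K"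
  shows "iter_deriv vs f x = 0"
  using assms(4,5)
proof (induction vs arbitrary: x)
  case (Cons v vs)
  have "iter_deriv vs f differentiable at x"
    using assms(1) Cons.prems unfolding smooth_def differentiable_on_def by auto
  then have "(iter_deriv vs f has_derivative frechet_derivative (iter_deriv vs f) (at x)) (at x)"
    by (simp add: frechet_derivative_works)
  from deriv_zero_off_support[OF this assms(2) _ Cons.prems(2), of v] Cons show ?case by simp
qed (use assms in simp)

lemma iter_deriv_bdd_above:
  fixes f :: "'a::euclidean_space \<Rightarrow> complex"
  assumes "smooth f" "compact K" "\<And>x. x \<notin> K \<Longrightarrow> f x = 0" "set vs \<subseteq> Basis"
  shows "bdd_above (range (\<lambda>x. cmod (iter_deriv vs f x)))"
proof -
  have "continuous_on UNIV (iter_deriv vs f)"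
    using assms(1,4) unfolding smooth_def by (blast intro: differentiable_imp_continuous_on)
  from bounded_continuous_compact_support[OF this assms(2) iter_deriv_off_support[OF assms]]
  obtain B where "\<And>x. norm (iter_deriv vs f x) \<le> B" by blast
  then show ?thesis by (intro bdd_aboveI2)
qed

lemma form_seminorm_bound:
  fixes \<phi> :: "'n::{finite,linorder} qform"
  assumes \<phi>: "\<And>I. smooth (\<lambda>x. \<phi> x I)" "compact (form_support \<phi>)"
    and vs: "set vs \<subseteq> Basis" "length vs \<le> m" and I: "I \<subseteq> {..<2*CARD('n)}"
  shows "cmod (iter_deriv vs (\<lambda>y. \<phi> y I) x) \<le> form_seminorm m \<phi>"
proof -
  let ?V = "{vs::'n qspace list. set vs \<subseteq> Basis \<and> length vs \<le> m}"
  let ?s = "\<lambda>vs I. SUP x. cmod (iter_deriv vs (\<lambda>y. \<phi> y I) x)"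
  have bdd: "bdd_above (range (\<lambda>x. cmod (iter_deriv vs (\<lambda>y. \<phi> y I) x)))" if "set vs \<subseteq> Basis" for vs I
    by (rule iter_deriv_bdd_above[OF \<phi> _ that]) (rule form_support_zero)
  have le: "cmod (iter_deriv vs (\<lambda>y. \<phi> y I) x) \<le> ?s vs I" if "set vs \<subseteq> Basis" for vs I x
    by (rule cSUP_upper[OF UNIV_I bdd[OF that]])
  have nn: "0 \<le> ?s vs I" if "set vs \<subseteq> Basis" for vs I
    using le[OF that, of I 0] norm_ge_zero order_trans by blast
  have fin: "finite ?V" by (rule finite_lists_length_le) simp
  have "cmod (iter_deriv vs (\<lambda>y. \<phi> y I) x) \<le> ?s vs I" by (rule le[OF vs(1)])
  also have "\<dots> \<le> (\<Sum>I\<in>Pow {..<2*CARD('n)}. ?s vs I)"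
    by (rule member_le_sum) (use I nn vs in auto)
  also have "\<dots> \<le> (\<Sum>vs\<in>?V. \<Sum>I\<in>Pow {..<2*CARD('n)}. ?s vs I)"
    by (rule member_le_sum[where f="\<lambda>vs. \<Sum>I\<in>Pow {..<2*CARD('n)}. ?s vs I"]) (use vs fin nn in \<open>auto intro!: sum_nonneg\<close>)
  finally show ?thesis by (simp add: form_seminorm_def)
qed

lemma laplace_form_top_continuous:
  fixes \<phi> :: "'n::{finite,linorder} qform"
  assumes "\<And>I. smooth (\<lambda>x. \<phi> x I)"
  shows "continuous_on UNIV (\<lambda>x. laplace_form \<phi> x {..<2*CARD('n)})"
  unfolding laplace_form_def
  by (rule smooth_continuous, rule smooth_d_form, rule smooth_d_form, rule assms)

lemma dd2_off_support:
  fixes \<phi> :: "'n::{finite,linorder} qform"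
  assumes "\<And>I. smooth (\<lambda>x. \<phi> x I)" "compact (form_support \<phi>)" "x \<notin> form_support \<phi>" "v \<in> Basis" "w \<in> Basis"
  shows "dd v (dd w (\<lambda>y. \<phi> y I)) x = 0"
proof -
  have "iter_deriv [v, w] (\<lambda>y. \<phi> y I) x = 0"
    by (rule iter_deriv_off_support[OF assms(1,2)]) (use assms(3-) in \<open>simp_all add: form_support_zero\<close>)
  then show ?thesis by simp
qed

lemma laplace_form_top_off_support:
  fixes \<phi> :: "'n::{finite,linorder} qform"
  assumes "\<And>I. smooth (\<lambda>x. \<phi> x I)" "compact (form_support \<phi>)" "x \<notin> form_support \<phi>"
  shows "laplace_form \<phi> x {..<2*CARD('n)} = 0"
  unfolding laplace_form_top[OF assms(1)]
  by (intro sum.neutral ballI) (simp add: dd2_off_support[OF assms] bvec_Basis)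

definition laplace_bound :: "nat \<Rightarrow> real" where
  "laplace_bound N = (\<Sum>k<N. \<Sum>l<N. \<Sum>s\<in>UNIV. \<Sum>t\<in>UNIV. cmod (ncoef k 0 s * ncoef l 1 t * top_sign N k l))"

lemma laplace_form_top_bound:
  fixes \<phi> :: "'n::{finite,linorder} qform"
  assumes \<phi>: "\<And>I. smooth (\<lambda>x. \<phi> x I)" "compact (form_support \<phi>)"
  shows "cmod (laplace_form \<phi> x {..<2*CARD('n)}) \<le> laplace_bound (2*CARD('n)) * form_seminorm 2 \<phi>"
proof -
  let ?N = "2*CARD('n)"
  have "cmod (ncoef k 0 s * ncoef l 1 t * top_sign ?N k l * dd (bvec k s) (dd (bvec l t) (\<lambda>y. \<phi> y ({..<?N} - {k} - {l}))) x)
    \<le> cmod (ncoef k 0 s * ncoef l 1 t * top_sign ?N k l) * form_seminorm 2 \<phi>" for k l s t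
    using form_seminorm_bound[OF \<phi>, of "[bvec k s, bvec l t]" 2 "{..<?N} - {k} - {l}" x]
    by (subst norm_mult) (auto intro!: mult_left_mono simp: bvec_Basis)
  then show ?thesis
    unfolding laplace_form_top[OF \<phi>(1)] laplace_bound_def sum_distrib_right
    by (intro sum_norm_le)
qed

theorem current_laplace:
  fixes \<Omega> :: "'n::{finite,linorder} qspace set"
  assumes u: "loc_integrable_on \<Omega> u"
  shows "current \<Omega> 2 (laplace_current (current_of_form \<Omega> (zero_form u)))"
  unfolding current_def Let_def
proof (intro conjI ballI allI impI)
  let ?T = "laplace_current (current_of_form \<Omega> (zero_form u))"
  let ?N = "2*CARD('n)" and ?D = "test_forms \<Omega> (2 * int CARD('n) - 2)"
  note T = laplace_current_zero_form[of \<Omega> u]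
  have int: "set_integrable lborel \<Omega> (\<lambda>x. complex_of_real (real_of_ereal (u x)) * laplace_form \<phi> x {..<?N})" 
    if "\<phi> \<in> ?D" for \<phi>
    using test_formsD[OF that] 
    by (intro loc_integrable_mult_compact_support(2)[OF u, of "form_support \<phi>"] laplace_form_top_continuous laplace_form_top_off_support) auto
  fix \<phi> assume \<phi>: "\<phi> \<in> ?D"
  have lin: "laplace_form (\<lambda>x I. c * \<phi> x I + d * \<psi> x I) x {..<?N} = c * laplace_form \<phi> x {..<?N} + d * laplace_form \<psi> x {..<?N}"
    if "\<psi> \<in> ?D" for \<psi> x and c d :: complex
  proof -
    note sm = test_formsD(1)[OF \<phi>] test_formsD(1)[OF that]
    have 1: "dd v (dd w (\<lambda>y. c * \<phi> y I + d * \<psi> y I)) x = c * dd v (dd w (\<lambda>y. \<phi> y I)) x + d * dd v (dd w (\<lambda>y. \<psi> y I)) x"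
      if "w \<in> Basis" for v w I
    proof -
      have "dd w (\<lambda>y. c * \<phi> y I + d * \<psi> y I) = (\<lambda>x. c * dd w (\<lambda>y. \<phi> y I) x + d * dd w (\<lambda>y. \<psi> y I) x)"
        by (rule ext, rule dd_lincomb) (intro smooth_differentiable_at sm)+
      then show ?thesis
        using dd_lincomb[OF smooth_differentiable_at[OF smooth_dd[OF sm(1) that]] smooth_differentiable_at[OF smooth_dd[OF sm(2) that]]]
        by simp
    qed
    have "smooth (\<lambda>x. c * \<phi> x I + d * \<psi> x I)" for I by (intro smooth_lincomb sm)
    then have lc: "\<And>I. smooth (\<lambda>x. c * \<phi> x I + d * \<psi> x I)" .
    show ?thesis
      unfolding laplace_form_top[OF lc] laplace_form_top[OF sm(1)] laplace_form_top[OF sm(2)] 1[OF bvec_Basis]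
        sum_distrib_left sum.distrib[symmetric]
      by (intro sum.cong refl) (simp add: algebra_simps)
  qed
  {
    fix \<psi> assume \<psi>: "\<psi> \<in> ?D"
    show "?T (\<lambda>x I. \<phi> x I + \<psi> x I) = ?T \<phi> + ?T \<psi>"
      using lin[OF \<psi>, of 1 1] set_integral_add(2)[OF int[OF \<phi>] int[OF \<psi>]]
      unfolding T by (simp add: distrib_left)
  }
  {
    fix c
    show "?T (\<lambda>x I. c * \<phi> x I) = c * ?T \<phi>"
      using lin[OF \<phi>, of c 0] unfolding T
      by (simp add: mult.left_commute[of _ c] set_integral_mult_right)
  }
next
  let ?T = "laplace_current (current_of_form \<Omega> (zero_form u))"
  let ?N = "2*CARD('n)" and ?D = "test_forms \<Omega> (2 * int CARD('n) - 2)"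
  fix K :: "'n qspace set" assume K: "compact K" "K \<subseteq> \<Omega>"
  have W: "integrable lborel (cutoff u K)"
    using u K unfolding loc_integrable_on_def set_integrable_def by simp
  show "\<exists>C m. \<forall>\<phi>\<in>?D. form_support \<phi> \<subseteq> K \<longrightarrow> cmod (?T \<phi>) \<le> C * form_seminorm m \<phi>"
  proof (intro exI ballI impI)
    fix \<phi> assume \<phi>: "\<phi> \<in> ?D" and supp: "form_support \<phi> \<subseteq> K"
    note sm = test_formsD(1,2)[OF \<phi>]
    let ?L = "\<lambda>x. laplace_form \<phi> x {..<?N}"
    have c: "continuous_on UNIV ?L" and z: "\<And>x. x \<notin> K \<Longrightarrow> ?L x = 0"
      using laplace_form_top_continuous[of \<phi>] laplace_form_top_off_support[of \<phi>] sm supp by auto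
    note i = loc_integrable_mult_compact_support[OF u K c z]
    have "cmod (?T \<phi>) = cmod (LBINT x. cutoff u K x *\<^sub>R ?L x)"
      using i(3) unfolding laplace_current_zero_form by simp
    also have "\<dots> \<le> (LBINT x. norm (cutoff u K x *\<^sub>R ?L x))" by (rule integral_norm_bound)
    also have "\<dots> \<le> (LBINT x. \<bar>cutoff u K x\<bar> * (laplace_bound ?N * form_seminorm 2 \<phi>))"
    proof (rule integral_mono)
      show "integrable lborel (\<lambda>x. norm (cutoff u K x *\<^sub>R ?L x))" using i(1) by (rule integrable_norm)
      show "integrable lborel (\<lambda>x. \<bar>cutoff u K x\<bar> * (laplace_bound ?N * form_seminorm 2 \<phi>))"
        using W by (intro integrable_mult_left integrable_abs)
      show "norm (cutoff u K x *\<^sub>R ?L x) \<le> \<bar>cutoff u K x\<bar> * (laplace_bound ?N * form_seminorm 2 \<phi>)" for x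
        unfolding norm_scaleR real_norm_def by (intro mult_left_mono laplace_form_top_bound sm) simp
    qed
    also have "\<dots> = (LBINT x. \<bar>cutoff u K x\<bar>) * (laplace_bound ?N * form_seminorm 2 \<phi>)" by simp
    finally show "cmod (?T \<phi>) \<le> ((LBINT x. \<bar>cutoff u K x\<bar>) * laplace_bound ?N) * form_seminorm 2 \<phi>"
      by (simp only: mult.assoc)
  qed
qed

theorem closed_laplace:
  "closed_current \<Omega> 2 (laplace_current (current_of_form \<Omega> (zero_form u)))"
  unfolding closed_current_def
proof (intro ballI)
  fix \<alpha> :: nat and \<eta> :: "'a qform"
  assume "\<alpha> \<in> {0, 1}" "\<eta> \<in> test_forms \<Omega> (2 * int CARD('a) - (2 + 1))"
  then have "laplace_form (d_form \<alpha> \<eta>) x J = 0" for x J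
    by (intro laplace_form_d_form test_formsD(1))
  then show "d_current \<alpha> (laplace_current (current_of_form \<Omega> (zero_form u))) \<eta> = 0"
    unfolding d_current_def laplace_current_zero_form by simp
qed

section \<open>Nonnegativity of the Laplacian along a line\<close>

lemma bump_second_difference:
  fixes z p :: "'a::euclidean_space"
  shows "\<exists>\<xi> \<zeta>. \<bar>\<xi>\<bar> \<le> \<bar>t\<bar> \<and> \<bar>\<zeta>\<bar> \<le> \<bar>t\<bar> \<and>
    bump eps (z + t *\<^sub>R p) + bump eps (z - t *\<^sub>R p) - 2 * bump eps z = t\<^sup>2 / 2 * (bump2 eps (z + \<xi> *\<^sub>R p) p p + bump2 eps (z + \<zeta> *\<^sub>R p) p p)"
proof -
  let ?diff = "\<lambda>(m::nat) s. if m = 0 then bump eps (z + s *\<^sub>R p) else if m = 1 then bump1 eps (z + s *\<^sub>R p) p else bump2 eps (z + s *\<^sub>R p) p p"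
  have lin: "((\<lambda>s. z + s *\<^sub>R p) has_derivative (\<lambda>h. h *\<^sub>R p)) (at s)" for s
    by (auto intro!: derivative_eq_intros)
  have 0: "((\<lambda>s. bump eps (z + s *\<^sub>R p)) has_real_derivative bump1 eps (z + s *\<^sub>R p) p) (at s)" for s
    using has_derivative_compose[OF lin bump_deriv, of eps s]
    unfolding has_field_derivative_def
    by (rule has_derivative_eq_rhs) (auto simp: bump1_def fun_eq_iff)
  have 1: "((\<lambda>s. bump1 eps (z + s *\<^sub>R p) p) has_real_derivative bump2 eps (z + s *\<^sub>R p) p p) (at s)" for s
    using has_derivative_compose[OF lin bump1_deriv, of eps p s]
    unfolding has_field_derivative_def
    by (rule has_derivative_eq_rhs) (auto simp: bump2_def fun_eq_iff algebra_simps)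
  have D: "DERIV (?diff m) s :> ?diff (Suc m) s" if "m < 2" for m s
    using that 0 1 by (cases "m = 0") (auto simp: less_2_cases_iff)
  have T: "\<exists>\<xi>. \<bar>\<xi>\<bar> \<le> \<bar>s\<bar> \<and> bump eps (z + s *\<^sub>R p) = bump eps z + bump1 eps z p * s + bump2 eps (z + \<xi> *\<^sub>R p) p p / 2 * s\<^sup>2" for s
  proof -
    have "\<exists>\<xi>. \<bar>\<xi>\<bar> \<le> \<bar>s\<bar> \<and> bump eps (z + s *\<^sub>R p) = (\<Sum>m<2. ?diff m 0 / fact m * s ^ m) + ?diff 2 \<xi> / fact 2 * s ^ 2"
      by (rule Maclaurin_bi_le) (use D in auto)
    then show ?thesis by (simp add: numeral_2_eq_2)
  qed
  obtain \<xi> where \<xi>: "\<bar>\<xi>\<bar> \<le> \<bar>t\<bar>" "bump eps (z + t *\<^sub>R p) = bump eps z + bump1 eps z p * t + bump2 eps (z + \<xi> *\<^sub>R p) p p / 2 * t\<^sup>2"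
    using T[of t] by blast
  obtain \<zeta> where \<zeta>: "\<bar>\<zeta>\<bar> \<le> \<bar>- t\<bar>" "bump eps (z + (- t) *\<^sub>R p) = bump eps z + bump1 eps z p * (- t) + bump2 eps (z + \<zeta> *\<^sub>R p) p p / 2 * (- t)\<^sup>2"
    using T[of "- t"] by blast
  have "bump eps (z + t *\<^sub>R p) + bump eps (z - t *\<^sub>R p) - 2 * bump eps z = t\<^sup>2 / 2 * (bump2 eps (z + \<xi> *\<^sub>R p) p p + bump2 eps (z + \<zeta> *\<^sub>R p) p p)"
    using \<xi>(2) \<zeta>(2) by (simp add: algebra_simps)
  then show ?thesis using \<xi>(1) \<zeta>(1) by (intro exI[of _ \<xi>] exI[of _ \<zeta>]) simp
qed

text \<open>The constant is \<open>24 + 6\<close>; only the shape \<open>C \<bar>p\<bar>\<^sup>2\<close> matters, as it makes the difference quotients in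
  direction \<open>b\<lambda>\<close> bounded uniformly for \<open>\<bar>\<lambda>\<bar> \<le> 1\<close>.\<close>

lemma bump2_bound:
  assumes "eps > 0"
  shows "\<bar>bump2 eps z p p\<bar> \<le> 30 * eps ^ 4 * (norm p)\<^sup>2"
proof (cases "norm z \<ge> eps")
  case True
  then show ?thesis using bump_zero(3)[OF True assms] by simp
next
  case False
  define m where "m = max 0 (eps\<^sup>2 - z \<bullet> z)"
  have m: "0 \<le> m" "m \<le> eps\<^sup>2" by (auto simp: m_def)
  have "\<bar>z \<bullet> p\<bar> \<le> eps * norm p"
    using Cauchy_Schwarz_ineq2[of z p] False mult_right_mono[of "norm z" eps "norm p"] by simp
  then have "(z \<bullet> p)\<^sup>2 \<le> (eps * norm p)\<^sup>2" by (metis abs_ge_zero power2_abs power_mono)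
  then have zp: "(z \<bullet> p) * (z \<bullet> p) \<le> eps\<^sup>2 * (norm p)\<^sup>2" by (simp add: power2_eq_square mult_ac)
  have "m * ((z \<bullet> p) * (z \<bullet> p)) \<le> eps\<^sup>2 * (eps\<^sup>2 * (norm p)\<^sup>2)" by (rule mult_mono) (use m zp in auto)
  moreover have "0 \<le> m * ((z \<bullet> p) * (z \<bullet> p))" using m by simp
  moreover have "m\<^sup>2 \<le> (eps\<^sup>2)\<^sup>2" using m by (intro power_mono)
  then have "m\<^sup>2 * (norm p)\<^sup>2 \<le> eps\<^sup>2 * (eps\<^sup>2 * (norm p)\<^sup>2)" 
    using mult_right_mono[of "m\<^sup>2" "(eps\<^sup>2)\<^sup>2" "(norm p)\<^sup>2"] by (simp add: power2_eq_square mult_ac)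
  moreover have "0 \<le> m\<^sup>2 * (norm p)\<^sup>2" by simp
  moreover have "bump2 eps z p p = 24 * (m * ((z \<bullet> p) * (z \<bullet> p))) - 6 * (m\<^sup>2 * (norm p)\<^sup>2)"
    by (simp add: bump2_def m_def power2_norm_eq_inner)
  moreover have "30 * eps ^ 4 * (norm p)\<^sup>2 = 30 * (eps\<^sup>2 * (eps\<^sup>2 * (norm p)\<^sup>2))" by (simp add: power2_eq_square power4_eq_xxxx)
  ultimately show ?thesis unfolding abs_le_iff by linarith
qed

lemma bump_second_difference_bound:
  assumes "eps > 0"
  shows "\<bar>bump eps (z + t *\<^sub>R p) + bump eps (z - t *\<^sub>R p) - 2 * bump eps z\<bar> \<le> t\<^sup>2 * (30 * eps ^ 4 * (norm p)\<^sup>2)"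
proof -
  obtain \<xi> \<zeta> where e: "bump eps (z + t *\<^sub>R p) + bump eps (z - t *\<^sub>R p) - 2 * bump eps z = t\<^sup>2 / 2 * (bump2 eps (z + \<xi> *\<^sub>R p) p p + bump2 eps (z + \<zeta> *\<^sub>R p) p p)"
    using bump_second_difference[of t eps z p] by blast
  have "\<bar>bump2 eps (z + \<xi> *\<^sub>R p) p p + bump2 eps (z + \<zeta> *\<^sub>R p) p p\<bar> \<le> 2 * (30 * eps ^ 4 * (norm p)\<^sup>2)"
    using bump2_bound[OF assms, of "z + \<xi> *\<^sub>R p" p] bump2_bound[OF assms, of "z + \<zeta> *\<^sub>R p" p] by linarith
  from mult_left_mono[OF this, of "t\<^sup>2 / 2"] show ?thesis unfolding e by (simp add: abs_mult)
qed

lemma bump_second_difference_limit: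
  fixes z p :: "'a::euclidean_space"
  shows "(\<lambda>n. (real (Suc n))\<^sup>2 * (bump eps (z + (1 / real (Suc n)) *\<^sub>R p) + bump eps (z - (1 / real (Suc n)) *\<^sub>R p) - 2 * bump eps z))
    \<longlonglongrightarrow> bump2 eps z p p"
proof -
  have "\<forall>n. \<exists>\<xi> \<zeta>. \<bar>\<xi>\<bar> \<le> 1 / real (Suc n) \<and> \<bar>\<zeta>\<bar> \<le> 1 / real (Suc n) \<and>
    bump eps (z + (1 / real (Suc n)) *\<^sub>R p) + bump eps (z - (1 / real (Suc n)) *\<^sub>R p) - 2 * bump eps z = 
     (1 / real (Suc n))\<^sup>2 / 2 * (bump2 eps (z + \<xi> *\<^sub>R p) p p + bump2 eps (z + \<zeta> *\<^sub>R p) p p)"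
    using bump_second_difference[of "1 / real (Suc _)" eps z p] by simp
  then obtain \<xi> \<zeta> where \<xi>: "\<And>n. \<bar>\<xi> n\<bar> \<le> 1 / real (Suc n)" and \<zeta>: "\<And>n. \<bar>\<zeta> n\<bar> \<le> 1 / real (Suc n)" and
    eq: "\<And>n. bump eps (z + (1 / real (Suc n)) *\<^sub>R p) + bump eps (z - (1 / real (Suc n)) *\<^sub>R p) - 2 * bump eps z = 
     (1 / real (Suc n))\<^sup>2 / 2 * (bump2 eps (z + \<xi> n *\<^sub>R p) p p + bump2 eps (z + \<zeta> n *\<^sub>R p) p p)"
    by metis
  have lim0: "(\<lambda>n. 1 / real (Suc n)) \<longlonglongrightarrow> 0"
    using LIMSEQ_inverse_real_of_nat by (simp add: inverse_eq_divide)
  have c: "isCont (\<lambda>s. bump2 eps (z + s *\<^sub>R p) p p) 0"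
  proof -
    have "continuous_on UNIV (\<lambda>s. bump2 eps (z + s *\<^sub>R p) p p)" by (intro continuous_intros)
    then show ?thesis by (simp add: continuous_on_eq_continuous_at)
  qed
  have L: "(\<lambda>n. bump2 eps (z + x n *\<^sub>R p) p p) \<longlonglongrightarrow> bump2 eps z p p" if "\<And>n. \<bar>x n\<bar> \<le> 1 / real (Suc n)" for x
  proof -
    have "x \<longlonglongrightarrow> 0" by (rule Lim_null_comparison[OF _ lim0]) (use that in simp)
    from isCont_tendsto_compose[OF c this] show ?thesis by simp
  qed
  have "(\<lambda>n. (bump2 eps (z + \<xi> n *\<^sub>R p) p p + bump2 eps (z + \<zeta> n *\<^sub>R p) p p) / 2) \<longlonglongrightarrow> (bump2 eps z p p + bump2 eps z p p) / 2"
    by (intro tendsto_intros L \<xi> \<zeta>) simp_all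
  moreover have "(\<lambda>n. (real (Suc n))\<^sup>2 * (bump eps (z + (1 / real (Suc n)) *\<^sub>R p) + bump eps (z - (1 / real (Suc n)) *\<^sub>R p) - 2 * bump eps z)) 
    = (\<lambda>n. (bump2 eps (z + \<xi> n *\<^sub>R p) p p + bump2 eps (z + \<zeta> n *\<^sub>R p) p p) / 2)"
  proof
    fix n
    show "(real (Suc n))\<^sup>2 * (bump eps (z + (1 / real (Suc n)) *\<^sub>R p) + bump eps (z - (1 / real (Suc n)) *\<^sub>R p) - 2 * bump eps z) =
      (bump2 eps (z + \<xi> n *\<^sub>R p) p p + bump2 eps (z + \<zeta> n *\<^sub>R p) p p) / 2"
      unfolding eq by (simp add: power_divide del: of_nat_Suc)
  qed
  ultimately show ?thesis by simp
qed

text \<open>The Laplacian of the function \<open>\<lambda> \<mapsto> bump (z + b\<lambda>)\<close> at 0.\<close>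

definition line_laplace :: "real \<Rightarrow> 'n qspace \<Rightarrow> 'n::finite qspace \<Rightarrow> real" where
  "line_laplace eps b z = (\<Sum>s\<in>UNIV. bump2 eps z (qact b (axis s 1)) (qact b (axis s 1)))"

lemma bump2_bilinear: "bilinear (bump2 eps z)"
  unfolding bilinear_def by (auto intro!: linearI simp: bump2_def algebra_simps)

lemma bump2_qact_expand:
  "bump2 eps z (qact b lam) (qact b lam) = 
    (\<Sum>s\<in>UNIV. \<Sum>t\<in>UNIV. (lam $ s * lam $ t) * bump2 eps z (qact b (axis s 1)) (qact b (axis t 1)))"
proof -
  have "lam = (\<Sum>s\<in>UNIV. (lam $ s) *\<^sub>R axis s 1)"
    using basis_expansion[of lam] by (simp add: scalar_mult_eq_scaleR)
  then have e: "qact b lam = (\<Sum>s\<in>UNIV. (lam $ s) *\<^sub>R qact b (axis s 1))"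
    by (metis (no_types, lifting) linear_qact_right linear_sum linear_cmul sum.cong)
  have "bump2 eps z (qact b lam) (qact b lam) = (\<Sum>(s, t)\<in>UNIV \<times> UNIV. bump2 eps z ((lam $ s) *\<^sub>R qact b (axis s 1)) ((lam $ t) *\<^sub>R qact b (axis t 1)))"
    unfolding e by (rule bilinear_sum[OF bump2_bilinear])
  also have "\<dots> = (\<Sum>s\<in>UNIV. \<Sum>t\<in>UNIV. bump2 eps z ((lam $ s) *\<^sub>R qact b (axis s 1)) ((lam $ t) *\<^sub>R qact b (axis t 1)))"
    by (rule sum.cartesian_product[symmetric])
  finally show ?thesis
    by (simp add: bilinear_lmul[OF bump2_bilinear] bilinear_rmul[OF bump2_bilinear] mult.left_commute mult.assoc)
qed

text \<open>Averaging the second derivative in direction \<open>b\<lambda>\<close> over the unit ball gives a positive multiple of the Laplacian,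
  since the second moments of the ball are those of a multiple of the identity.\<close>

lemma line_laplace_mean:
  "\<exists>\<kappa>>0. \<forall>z. (LBINT lam. indicator (cball 0 1) lam * bump2 eps z (qact b lam) (qact b lam)) = \<kappa> * line_laplace eps b z"
proof -
  let ?m = "\<lambda>s t. (\<integral>x. indicator (cball 0 1) x * (x $ s * x $ t) \<partial>(lborel :: quat measure))"
  have int: "integrable lborel (\<lambda>x::quat. indicator (cball 0 1) x * (x $ s * x $ t))" for s t
  proof -
    have "continuous_on (cball (0::quat) 1) (\<lambda>x. x $ s * x $ t)" by (intro continuous_intros)
    from borel_integrable_compact[OF compact_cball this] show ?thesis by simp
  qed
  have "(LBINT lam. indicator (cball 0 1) lam * bump2 eps z (qact b lam) (qact b lam)) = ?m 1 1 * line_laplace eps b z" for z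
  proof -
    let ?c = "\<lambda>s t. bump2 eps z (qact b (axis s 1)) (qact b (axis t 1))"
    have "(LBINT lam. indicator (cball 0 1) lam * bump2 eps z (qact b lam) (qact b lam)) = 
      (LBINT lam. (\<Sum>s\<in>UNIV. \<Sum>t\<in>UNIV. (indicator (cball 0 1) lam * (lam $ s * lam $ t)) * ?c s t))"
      unfolding bump2_qact_expand by (simp only: sum_distrib_left mult.assoc)
    also have "\<dots> = (\<Sum>s\<in>UNIV. \<Sum>t\<in>UNIV. ?m s t * ?c s t)"
      using int by (simp add: Bochner_Integration.integral_sum)
    also have "\<dots> = (\<Sum>s\<in>UNIV. ?m 1 1 * ?c s s)"
    proof (rule sum.cong[OF refl])
      fix s :: 4
      have "(\<Sum>t\<in>UNIV. ?m s t * ?c s t) = (\<Sum>t\<in>UNIV. if t = s then ?m s s * ?c s s else 0)"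
      proof (rule sum.cong[OF refl])
        fix t :: 4
        show "?m s t * ?c s t = (if t = s then ?m s s * ?c s s else 0)"
          by (cases "t = s") (simp_all add: integral_cball_moments(1)[of s t])
      qed
      then show "(\<Sum>t\<in>UNIV. ?m s t * ?c s t) = ?m 1 1 * ?c s s"
        using integral_cball_moments(2)[of s 1] by simp
    qed
    finally show ?thesis by (simp add: line_laplace_def sum_distrib_left)
  qed
  moreover have "?m 1 1 > 0" by (rule integral_cball_moments(3))
  ultimately show ?thesis by blast
qed

lemma bump_measurable [measurable (raw)]:
  assumes [measurable]: "f \<in> borel_measurable M"
  shows "(\<lambda>x. bump eps (f x :: 'a::euclidean_space)) \<in> borel_measurable M"
  unfolding bump_def by measurable

lemma bump2_measurable [measurable (raw)]:
  assumes [measurable]: "f \<in> borel_measurable M" "g \<in> borel_measurable M" "h \<in> borel_measurable M"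
  shows "(\<lambda>x. bump2 eps (f x :: 'a::euclidean_space) (g x) (h x)) \<in> borel_measurable M"
  unfolding bump2_def by measurable

lemma bump_bounded: "eps > 0 \<Longrightarrow> bump eps z \<le> eps ^ 6"
proof -
  assume "eps > 0"
  have "(max 0 (eps\<^sup>2 - z \<bullet> z)) ^ 3 \<le> (eps\<^sup>2) ^ 3" by (intro power_mono) auto
  then show ?thesis by (simp add: bump_def flip: power_mult)
qed

text \<open>The kernel \<open>bump (x - y)\<close> lives on the ball of radius \<open>eps\<close>. The doubled radius leaves room for translations by
  vectors of length at most \<open>eps\<close>, along which the mean value inequality is used.\<close>

locale psh_bump =
  fixes \<Omega> :: "'n::finite qspace set" and u :: "'n qspace \<Rightarrow> ereal" and eps M :: real and y :: "'n qspace"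
  assumes u: "u \<in> PSH \<Omega>" and op: "open \<Omega>" and loc: "loc_integrable_on \<Omega> u"
    and eps_pos: "eps > 0" and sub: "cball y (2 * eps) \<subseteq> \<Omega>"
    and M: "0 \<le> M" "\<And>x. x \<in> cball y (2 * eps) \<Longrightarrow> u x \<le> ereal M"
begin

definition w :: "'n qspace \<Rightarrow> real" where
  "w x = indicator (cball y (2 * eps)) x * (M - real_of_ereal (u x))"

definition G :: "'n qspace \<Rightarrow> 'n qspace \<Rightarrow> real" where
  "G p x = (LBINT lam. indicator (cball 0 1) lam * bump eps (x - qact p lam - y))"

definition V :: real where
  "V = measure lborel (cball (0::quat) 1)"

lemma V: "emeasure lborel (cball (0::quat) 1) = ennreal V" "0 < V"
proof -
  show 1: "emeasure lborel (cball (0::quat) 1) = ennreal V"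
    unfolding V_def using emeasure_cball_pos_finite(2)[of 1 "0::quat"] by (intro emeasure_eq_ennreal_measure) simp
  show "0 < V" using emeasure_cball_pos_finite(1)[of 1 "0::quat"] unfolding 1 by simp
qed

lemma w_eq: "w x = M * indicator (cball y (2 * eps)) x - cutoff u (cball y (2 * eps)) x"
  by (simp add: w_def algebra_simps)

lemma integrable_u: "integrable lborel (cutoff u (cball y (2 * eps)))"
proof -
  have "set_integrable lborel (cball y (2 * eps)) (\<lambda>x. real_of_ereal (u x))"
    using loc sub compact_cball[of y "2 * eps"] unfolding loc_integrable_on_def by blast
  then show ?thesis by (simp add: set_integrable_def)
qed

lemma integrable_w: "integrable lborel w"
proof -
  have "integrable lborel (\<lambda>x. M * indicator (cball y (2 * eps)) x - cutoff u (cball y (2 * eps)) x)"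
    by (intro Bochner_Integration.integrable_diff integrable_u integrable_mult_right integrable_real_indicator emeasure_bounded_finite) auto
  then show ?thesis unfolding w_eq[abs_def] .
qed

lemma measurable_w [measurable]: "w \<in> borel_measurable borel"
  using borel_measurable_integrable[OF integrable_w] by simp

lemma w_nonneg: "0 \<le> w x"
proof (cases "x \<in> cball y (2 * eps)")
  case True
  then have "u x \<le> ereal M" by (rule M(2))
  then have "real_of_ereal (u x) \<le> M" using M(1) by (cases "u x") auto
  then show ?thesis by (simp add: w_def)
qed (simp add: w_def)

lemma integrable_bump_qact: "integrable lborel (\<lambda>lam. indicator (cball (0::quat) 1) lam * bump eps (x - qact p lam - y))"
proof -
  have "continuous_on (cball (0::quat) 1) (\<lambda>lam. bump eps (x - qact p lam - y))" by (intro continuous_intros)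
  from borel_integrable_compact[OF compact_cball this] show ?thesis by simp
qed

lemma measurable_G [measurable]: "G p \<in> borel_measurable borel"
  unfolding G_def[abs_def]
proof (rule lborel.borel_measurable_lebesgue_integral)
  have [measurable]: "cball (0::quat) 1 \<in> sets borel" by simp
  have "(\<lambda>(x, lam). indicator (cball 0 1) lam * bump eps (x - qact p lam - y)) \<in> borel_measurable (borel \<Otimes>\<^sub>M borel)"
    by measurable
  then show "(\<lambda>(x, lam). indicator (cball 0 1) lam * bump eps (x - qact p lam - y)) \<in> borel_measurable (borel \<Otimes>\<^sub>M lborel)"
    by (subst measurable_cong_sets[OF sets_pair_measure_cong[OF refl sets_lborel] refl])
qed

lemma G_nonneg: "0 \<le> G p x"
  unfolding G_def by (intro integral_nonneg_AE AE_I2) (simp add: bump_nonneg)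

lemma G_bounded: "G p x \<le> eps ^ 6 * V"
proof -
  have "G p x \<le> (LBINT lam. eps ^ 6 * indicator (cball (0::quat) 1) lam)"
    unfolding G_def
  proof (rule integral_mono[OF integrable_bump_qact])
    show "integrable lborel (\<lambda>lam. eps ^ 6 * indicator (cball (0::quat) 1) lam)"
      by (intro integrable_mult_right integrable_real_indicator emeasure_bounded_finite) auto
  qed (auto simp: indicator_def bump_bounded eps_pos)
  then show ?thesis by (simp add: V_def)
qed

lemma integrable_w_mult:
  assumes [measurable]: "f \<in> borel_measurable borel" and B: "\<And>x. \<bar>f x\<bar> \<le> B"
  shows "integrable lborel (\<lambda>x. w x * f x)"
proof (rule Bochner_Integration.integrable_bound[of lborel "\<lambda>x. B * w x"])
  show "integrable lborel (\<lambda>x. B * w x)" using integrable_w by simp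
  show "AE x in lborel. norm (w x * f x) \<le> norm (B * w x)"
  proof (rule AE_I2)
    fix x
    have "w x * \<bar>f x\<bar> \<le> w x * B" by (rule mult_left_mono[OF B w_nonneg])
    moreover have "0 \<le> B" using B[of 0] by linarith
    ultimately show "norm (w x * f x) \<le> norm (B * w x)" using w_nonneg by (simp add: abs_mult mult.commute)
  qed
qed measurable

text \<open>The inequality \<open>\<integral> (M - u)(x + p\<lambda>) d\<lambda> \<le> V (M - u)(x)\<close> is multiplied by the bump function and integrated over \<open>x\<close>;
  the substitution \<open>x \<mapsto> x - p\<lambda>\<close> then moves the mean from \<open>M - u\<close> to the bump function.\<close>

lemma mean_inequality:
  assumes p: "p \<noteq> 0" "norm p \<le> eps"
  shows "(LBINT x. w x * G p x) \<le> V * (LBINT x. w x * bump eps (x - y))"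
proof -
  let ?K = "cball y (2 * eps)" and ?C = "cball (0::quat) 1"
  have [measurable]: "?K \<in> sets borel" "?C \<in> sets borel" by auto
  have usc: "usc_on \<Omega> u" using u by (simp add: PSH_def)
  define u0 where "u0 = (\<lambda>x. if x \<in> \<Omega> then u x else 0)"
  have [measurable]: "u0 \<in> borel_measurable borel" unfolding u0_def by (rule usc_borel[OF usc op])
  define v where "v = (\<lambda>x. e2ennreal (ereal M - u0 x) * indicator ?K x)"
  have [measurable]: "v \<in> borel_measurable borel" unfolding v_def by measurable
  have v: "v x = e2ennreal (ereal M - u x)" if "x \<in> ?K" for x
    using that sub by (auto simp: v_def u0_def)
  have vw: "AE x in lborel. v x = ennreal (w x)"
  proof -
    have "AE x in lborel. x \<in> \<Omega> \<longrightarrow> \<bar>u x\<bar> \<noteq> \<infinity>" using loc unfolding loc_integrable_on_def by blast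
    then show ?thesis
    proof (rule AE_mp, intro AE_I2 impI)
      fix x assume x: "x \<in> \<Omega> \<longrightarrow> \<bar>u x\<bar> \<noteq> \<infinity>"
      show "v x = ennreal (w x)"
      proof (cases "x \<in> ?K")
        case True
        then have "x \<in> \<Omega>" using sub by blast
        then have "\<bar>u x\<bar> \<noteq> \<infinity>" using x by simp
        then obtain t where "u x = ereal t" by (cases "u x") auto
        then show ?thesis using v[OF True] True by (simp add: w_def e2ennreal_ereal)
      qed (simp add: v_def w_def)
    qed
  qed
  let ?g = "\<lambda>x. ennreal (bump eps (x - y))"
  have line: "(\<integral>\<^sup>+lam. ?g x * v (x + qact p lam) * indicator ?C lam \<partial>lborel) \<le> ennreal V * (?g x * v x)" for x
  proof (cases "norm (x - y) < eps")
    case False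
    then show ?thesis using bump_zero(1)[of eps "x - y"] eps_pos by simp
  next
    case True
    have mem: "x + qact p lam \<in> ?K" if "lam \<in> ?C" for lam
    proof -
      have "norm lam * norm p \<le> 1 * eps" using that p by (intro mult_mono) auto
      then have "norm (qact p lam) \<le> eps" by (simp add: norm_qact)
      then have "norm ((x - y) + qact p lam) \<le> 2 * eps" using True norm_triangle_ineq[of "x - y" "qact p lam"] by simp
      then show ?thesis by (simp add: dist_norm norm_minus_commute algebra_simps)
    qed
    have "x \<in> ?K" using mem[of 0] by simp
    have "(\<integral>\<^sup>+lam. v (x + qact p lam) * indicator ?C lam \<partial>lborel) = 
       (\<integral>\<^sup>+lam. e2ennreal (ereal M - u (x + qact p lam)) * indicator ?C lam \<partial>lborel)"
      using v mem by (intro nn_integral_cong) (auto simp: indicator_def)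
    also have "\<dots> \<le> emeasure lborel ?C * e2ennreal (ereal M - u x)"
      by (rule PSH_line_mean[OF u op p(1) _ _ M(1)]) (use mem sub M in auto)
    finally have "(\<integral>\<^sup>+lam. v (x + qact p lam) * indicator ?C lam \<partial>lborel) \<le> ennreal V * v x"
      using v[OF \<open>x \<in> ?K\<close>] V by simp
    from mult_left_mono[OF this, of "?g x"] show ?thesis
      by (simp add: nn_integral_cmult[symmetric] mult.assoc mult.left_commute)
  qed
  have G: "ennreal (G p x) = (\<integral>\<^sup>+lam. ?g (x - qact p lam) * indicator ?C lam \<partial>lborel)" for x
  proof -
    have "ennreal (G p x) = (\<integral>\<^sup>+lam. ennreal (indicator ?C lam * bump eps (x - qact p lam - y)) \<partial>lborel)"
      unfolding G_def by (rule nn_integral_eq_integral[OF integrable_bump_qact, symmetric]) (simp add: bump_nonneg)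
    also have "\<dots> = (\<integral>\<^sup>+lam. ?g (x - qact p lam) * indicator ?C lam \<partial>lborel)"
      by (intro nn_integral_cong) (auto simp: indicator_def)
    finally show ?thesis .
  qed
  have "(\<integral>\<^sup>+x. v x * ennreal (G p x) \<partial>lborel) = (\<integral>\<^sup>+x. \<integral>\<^sup>+lam. ?g (x - qact p lam) * v x * indicator ?C lam \<partial>lborel \<partial>lborel)"
    unfolding G by (intro nn_integral_cong) (simp add: nn_integral_cmult[symmetric] mult_ac)
  also have "\<dots> = (\<integral>\<^sup>+lam. \<integral>\<^sup>+x. ?g (x - qact p lam) * v x * indicator ?C lam \<partial>lborel \<partial>lborel)"
    by (rule lborel_pair.Fubini'[symmetric]) measurable
  also have "\<dots> = (\<integral>\<^sup>+lam. \<integral>\<^sup>+x. ?g x * v (x + qact p lam) * indicator ?C lam \<partial>lborel \<partial>lborel)"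
  proof (rule nn_integral_cong)
    fix lam :: quat
    have "(\<integral>\<^sup>+x. ?g (x - qact p lam) * v x * indicator ?C lam \<partial>lborel) = 
       (\<integral>\<^sup>+x. ?g (x + qact p lam - qact p lam) * v (x + qact p lam) * indicator ?C lam \<partial>lborel)"
      by (rule lborel_nn_integral_shift[symmetric]) measurable
    then show "(\<integral>\<^sup>+x. ?g (x - qact p lam) * v x * indicator ?C lam \<partial>lborel) = (\<integral>\<^sup>+x. ?g x * v (x + qact p lam) * indicator ?C lam \<partial>lborel)"
      by simp
  qed
  also have "\<dots> = (\<integral>\<^sup>+x. \<integral>\<^sup>+lam. ?g x * v (x + qact p lam) * indicator ?C lam \<partial>lborel \<partial>lborel)"
    by (rule lborel_pair.Fubini') measurable
  also have "\<dots> \<le> (\<integral>\<^sup>+x. ennreal V * (?g x * v x) \<partial>lborel)"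
    by (intro nn_integral_mono line)
  also have "\<dots> = ennreal V * (\<integral>\<^sup>+x. ?g x * v x \<partial>lborel)"
    by (rule nn_integral_cmult) measurable
  finally have main: "(\<integral>\<^sup>+x. v x * ennreal (G p x) \<partial>lborel) \<le> ennreal V * (\<integral>\<^sup>+x. ?g x * v x \<partial>lborel)" .
  have ig: "integrable lborel (\<lambda>x. w x * bump eps (x - y))"
    by (rule integrable_w_mult[of _ "eps ^ 6"]) (auto simp: abs_of_nonneg bump_nonneg bump_bounded eps_pos)
  have iG: "integrable lborel (\<lambda>x. w x * G p x)"
    by (rule integrable_w_mult[of _ "eps ^ 6 * V"]) (auto simp: abs_of_nonneg G_nonneg G_bounded)
  have "(\<integral>\<^sup>+x. v x * ennreal (G p x) \<partial>lborel) = (\<integral>\<^sup>+x. ennreal (w x * G p x) \<partial>lborel)"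
    by (rule nn_integral_cong_AE) (use vw in \<open>auto simp: ennreal_mult w_nonneg G_nonneg\<close>)
  also have "\<dots> = ennreal (LBINT x. w x * G p x)"
    by (rule nn_integral_eq_integral[OF iG]) (simp add: w_nonneg G_nonneg)
  finally have 1: "(\<integral>\<^sup>+x. v x * ennreal (G p x) \<partial>lborel) = ennreal (LBINT x. w x * G p x)" .
  have "(\<integral>\<^sup>+x. ?g x * v x \<partial>lborel) = (\<integral>\<^sup>+x. ennreal (w x * bump eps (x - y)) \<partial>lborel)"
    by (rule nn_integral_cong_AE) (use vw in \<open>auto simp: ennreal_mult w_nonneg bump_nonneg mult.commute\<close>)
  also have "\<dots> = ennreal (LBINT x. w x * bump eps (x - y))"
    by (rule nn_integral_eq_integral[OF ig]) (simp add: w_nonneg bump_nonneg)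
  finally have 2: "(\<integral>\<^sup>+x. ?g x * v x \<partial>lborel) = ennreal (LBINT x. w x * bump eps (x - y))" .
  have nn: "0 \<le> (LBINT x. w x * bump eps (x - y))"
    by (intro integral_nonneg_AE AE_I2) (simp add: w_nonneg bump_nonneg)
  have "ennreal (LBINT x. w x * G p x) \<le> ennreal (V * (LBINT x. w x * bump eps (x - y)))"
    using main unfolding 1 2 using V nn by (simp add: ennreal_mult)
  then show ?thesis using V nn by (subst (asm) ennreal_le_iff) auto
qed

lemma integral_line_laplace_zero: "(LBINT x. line_laplace eps b (x - y)) = 0"
  and integrable_line_laplace: "integrable lborel (\<lambda>x. line_laplace eps b (x - y))"
proof -
  let ?p = "\<lambda>s::4. qact b (axis s 1)"
  have off: "norm (x - y) \<ge> eps" if "x \<notin> cball y eps" for x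
    using that by (simp add: dist_norm norm_minus_commute)
  have i: "integrable lborel (\<lambda>x. bump2 eps (x - y) (?p s) (?p s))" for s
    by (rule integrable_continuous_compact_support[OF _ compact_cball[of y eps]])
      (use eps_pos off in \<open>auto intro!: continuous_intros bump_zero\<close>)
  have z: "(LBINT x. bump2 eps (x - y) (?p s) (?p s)) = 0" for s
  proof (rule integral_directional_derivative_zero[where h="\<lambda>x. bump1 eps (x - y) (?p s)"
        and h'="\<lambda>x. bump2 eps (x - y) (?p s)", OF _ _ compact_cball[of y eps]])
    have sub: "((\<lambda>x. x - y) has_derivative (\<lambda>v. v)) (at x)" for x by (auto intro!: derivative_eq_intros)
    show "((\<lambda>x. bump1 eps (x - y) (?p s)) has_derivative bump2 eps (x - y) (?p s)) (at x)" for x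
      using has_derivative_compose[OF sub bump1_deriv] .
    show "continuous_on UNIV (\<lambda>x. bump2 eps (x - y) (?p s) (?p s))" by (intro continuous_intros)
    show "bump1 eps (x - y) (?p s) = 0" if "x \<notin> cball y eps" for x
      using bump_zero(2)[OF off[OF that] eps_pos] .
  qed
  show "integrable lborel (\<lambda>x. line_laplace eps b (x - y))"
    unfolding line_laplace_def using i by simp
  show "(LBINT x. line_laplace eps b (x - y)) = 0"
    unfolding line_laplace_def using i z by simp
qed

lemma line_laplace_off: "x \<notin> cball y (2 * eps) \<Longrightarrow> line_laplace eps b (x - y) = 0"
proof -
  assume "x \<notin> cball y (2 * eps)"
  then have "norm (x - y) \<ge> eps" using eps_pos by (simp add: dist_norm norm_minus_commute)
  then show ?thesis using bump_zero(3)[of eps "x - y"] eps_pos by (simp add: line_laplace_def)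
qed

text \<open>Adding the mean inequalities for \<open>p\<close> and \<open>-p\<close> cancels the first order term of the bump function.\<close>

lemma second_difference_inequality:
  fixes b :: "'n qspace" and n :: nat
  defines "p \<equiv> (1 / real (Suc n)) *\<^sub>R b"
  assumes b: "b \<noteq> 0" and small: "norm p \<le> eps"
  shows "(LBINT x. w x * ((real (Suc n))\<^sup>2 * (G p x + G (- p) x - 2 * V * bump eps (x - y)))) \<le> 0"
proof -
  have ig: "integrable lborel (\<lambda>x. w x * bump eps (x - y))"
    by (rule integrable_w_mult[of _ "eps ^ 6"]) (auto simp: abs_of_nonneg bump_nonneg bump_bounded eps_pos)
  have iG: "integrable lborel (\<lambda>x. w x * G p x)" for p
    by (rule integrable_w_mult[of _ "eps ^ 6 * V"]) (auto simp: abs_of_nonneg G_nonneg G_bounded)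
  have p: "p \<noteq> 0" "- p \<noteq> 0" using b by (auto simp: p_def)
  let ?N = "(real (Suc n))\<^sup>2"
  have "(LBINT x. w x * (?N * (G p x + G (- p) x - 2 * V * bump eps (x - y))))
     = (LBINT x. ?N * ((w x * G p x + w x * G (- p) x) - (2 * V) * (w x * bump eps (x - y))))"
    by (intro Bochner_Integration.integral_cong) (auto simp: algebra_simps)
  also have "\<dots> = ?N * (((LBINT x. w x * G p x) + (LBINT x. w x * G (- p) x)) - (2 * V) * (LBINT x. w x * bump eps (x - y)))"
    using ig iG[of p] iG[of "- p"]
    by (simp only: integral_mult_right_zero Bochner_Integration.integral_diff Bochner_Integration.integral_add
        Bochner_Integration.integrable_add integrable_mult_right)
  also have "\<dots> \<le> 0"
    using mean_inequality[OF p(1) small] mean_inequality[OF p(2)] small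
    by (intro mult_nonneg_nonpos) auto
  finally show ?thesis .
qed

text \<open>With \<open>p = b/(n+1)\<close> the integrands \<open>S n\<close> of the preceding inequality are averages of second difference
  quotients of the bump function over the unit ball. They converge boundedly to a positive multiple of
  \<open>line_laplace\<close>. The constant \<open>M\<close> drops out in the limit, because the integral of a second derivative of the bump
  function is zero.\<close>

theorem line_laplace_nonneg:
  assumes b: "b \<noteq> 0"
  shows "0 \<le> (LBINT x. cutoff u (cball y (2 * eps)) x * line_laplace eps b (x - y))"
proof -
  let ?C = "cball (0::quat) 1"
  have [measurable]: "?C \<in> sets borel" by simp
  obtain \<kappa> where \<kappa>: "\<kappa> > 0" "\<And>z. (LBINT lam. indicator ?C lam * bump2 eps z (qact b lam) (qact b lam)) = \<kappa> * line_laplace eps b z"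
    using line_laplace_mean[of eps b] by blast
  define B where "B = 30 * eps ^ 4 * (norm b)\<^sup>2"
  have B: "0 \<le> B" using eps_pos by (simp add: B_def)
  define p where "p = (\<lambda>n. (1 / real (Suc n)) *\<^sub>R b)"
  define S where "S = (\<lambda>n x. (real (Suc n))\<^sup>2 * (G (p n) x + G (- p n) x - 2 * V * bump eps (x - y)))"
  define q where "q = (\<lambda>n x lam. (real (Suc n))\<^sup>2 * (bump eps ((x - y) + (1 / real (Suc n)) *\<^sub>R qact b lam)
     + bump eps ((x - y) - (1 / real (Suc n)) *\<^sub>R qact b lam) - 2 * bump eps (x - y)))"
  have iC: "integrable lborel (\<lambda>lam. c * indicator ?C lam)" for c :: real
    by (intro integrable_mult_right integrable_real_indicator emeasure_bounded_finite) auto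
  have S_eq: "S n x = (LBINT lam. indicator ?C lam * q n x lam)" for n x
  proof -
    let ?N = "(real (Suc n))\<^sup>2"
    have qp: "qact (p n) lam = (1 / real (Suc n)) *\<^sub>R qact b lam" "qact (- p n) lam = - ((1 / real (Suc n)) *\<^sub>R qact b lam)" for lam
      unfolding p_def by (simp_all only: linear_cmul[OF linear_qact_left] linear_neg[OF linear_qact_left])
    have "(LBINT lam. indicator ?C lam * q n x lam) = 
      (LBINT lam. ?N * ((indicator ?C lam * bump eps (x - qact (p n) lam - y) + indicator ?C lam * bump eps (x - qact (- p n) lam - y))
        - (2 * bump eps (x - y)) * indicator ?C lam))"
    proof (intro Bochner_Integration.integral_cong refl)
      fix lam
      have e: "x - qact (p n) lam - y = (x - y) - (1 / real (Suc n)) *\<^sub>R qact b lam"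
        "x - qact (- p n) lam - y = (x - y) + (1 / real (Suc n)) *\<^sub>R qact b lam"
        unfolding qp by (simp_all add: algebra_simps)
      show "indicator ?C lam * q n x lam = ?N * ((indicator ?C lam * bump eps (x - qact (p n) lam - y) + indicator ?C lam * bump eps (x - qact (- p n) lam - y))
        - (2 * bump eps (x - y)) * indicator ?C lam)"
        unfolding e q_def by (simp only: algebra_simps)
    qed
    also have "\<dots> = ?N * ((G (p n) x + G (- p n) x) - (2 * bump eps (x - y)) * V)"
      unfolding G_def V_def
      using integrable_bump_qact[of x "p n"] integrable_bump_qact[of x "- p n"] iC
      by (simp only: integral_mult_right_zero Bochner_Integration.integral_diff Bochner_Integration.integral_add
          Bochner_Integration.integrable_add integrable_mult_right) simp
    finally show ?thesis by (simp add: S_def mult_ac)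
  qed
  have q_bound: "norm (indicator ?C lam * q n x lam) \<le> B * indicator ?C lam" for n x lam
  proof (cases "lam \<in> ?C")
    case True
    let ?P = "qact b lam" and ?t = "1 / real (Suc n)"
    have "norm lam * norm b \<le> 1 * norm b" using True by (intro mult_right_mono) auto
    then have "(norm ?P)\<^sup>2 \<le> (norm b)\<^sup>2" by (intro power_mono) (auto simp: norm_qact)
    then have P: "30 * eps ^ 4 * (norm ?P)\<^sup>2 \<le> B" unfolding B_def using eps_pos by (intro mult_left_mono) auto
    have "\<bar>q n x lam\<bar> \<le> (real (Suc n))\<^sup>2 * (?t\<^sup>2 * (30 * eps ^ 4 * (norm ?P)\<^sup>2))"
      unfolding q_def abs_mult abs_power2 by (intro mult_left_mono bump_second_difference_bound[OF eps_pos]) simp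
    also have "\<dots> = 30 * eps ^ 4 * (norm ?P)\<^sup>2" by (simp add: power_divide del: of_nat_Suc)
    finally show ?thesis using P True by simp
  qed simp
  have meas_q [measurable]: "q n x \<in> borel_measurable borel" for n x
    unfolding q_def by measurable
  have S_lim: "(\<lambda>n. S n x) \<longlonglongrightarrow> \<kappa> * line_laplace eps b (x - y)" for x
    unfolding S_eq \<kappa>(2)[symmetric]
  proof (rule integral_dominated_convergence[where w="\<lambda>lam. B * indicator ?C lam"])
    show "AE lam in lborel. (\<lambda>n. indicator ?C lam * q n x lam) \<longlonglongrightarrow> indicator ?C lam * bump2 eps (x - y) (qact b lam) (qact b lam)"
      unfolding q_def by (intro AE_I2 tendsto_mult tendsto_const bump_second_difference_limit)
  qed (use iC q_bound in \<open>auto simp del: real_norm_def\<close>)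
  have S_bound: "\<bar>S n x\<bar> \<le> B * V" for n x
  proof -
    have "norm (S n x) \<le> (LBINT lam. norm (indicator ?C lam * q n x lam))"
      unfolding S_eq by (rule integral_norm_bound)
    also have "\<dots> \<le> (LBINT lam. B * indicator ?C lam)"
      by (rule integral_mono_AE'[OF iC]) (use q_bound B in auto)
    finally show ?thesis by (simp add: V_def)
  qed
  have meas_S [measurable]: "S n \<in> borel_measurable borel" for n
    unfolding S_def by measurable
  have meas_L [measurable]: "(\<lambda>x. line_laplace eps b (x - y)) \<in> borel_measurable borel"
    unfolding line_laplace_def by measurable
  have "(\<lambda>n. LBINT x. w x * S n x) \<longlonglongrightarrow> (LBINT x. w x * (\<kappa> * line_laplace eps b (x - y)))"
  proof (rule integral_dominated_convergence[where w="\<lambda>x. B * V * w x"])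
    show "integrable lborel (\<lambda>x. B * V * w x)" using integrable_w by simp
    show "AE x in lborel. (\<lambda>n. w x * S n x) \<longlonglongrightarrow> w x * (\<kappa> * line_laplace eps b (x - y))"
      by (intro AE_I2 tendsto_mult tendsto_const S_lim)
    show "AE x in lborel. norm (w x * S n x) \<le> B * V * w x" for n
      using mult_left_mono[OF S_bound w_nonneg] w_nonneg by (intro AE_I2) (simp add: abs_mult mult_ac)
  qed measurable
  moreover have "\<forall>\<^sub>F n in sequentially. (LBINT x. w x * S n x) \<le> 0"
  proof -
    have "(\<lambda>n. 1 / real (Suc n) * norm b) \<longlonglongrightarrow> 0 * norm b"
      using LIMSEQ_inverse_real_of_nat by (intro tendsto_mult tendsto_const) (simp add: inverse_eq_divide)
    then have "\<forall>\<^sub>F n in sequentially. 1 / real (Suc n) * norm b < eps"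
      using eps_pos by (simp add: order_tendstoD)
    then show ?thesis
    proof (rule eventually_mono)
      fix n assume "1 / real (Suc n) * norm b < eps"
      then have "norm ((1 / real (Suc n)) *\<^sub>R b) \<le> eps" by simp
      from second_difference_inequality[OF b this] show "(LBINT x. w x * S n x) \<le> 0"
        by (simp add: S_def p_def)
    qed
  qed
  ultimately have "(LBINT x. w x * (\<kappa> * line_laplace eps b (x - y))) \<le> 0"
    by (rule tendsto_upperbound) simp
  also have "(LBINT x. w x * (\<kappa> * line_laplace eps b (x - y))) = \<kappa> * (LBINT x. w x * line_laplace eps b (x - y))"
    by (simp add: mult.left_commute)
  finally have neg: "(LBINT x. w x * line_laplace eps b (x - y)) \<le> 0"
    using \<kappa>(1) by (simp add: mult_le_0_iff)
  let ?U = "cutoff u (cball y (2 * eps))"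
  have "w x * line_laplace eps b (x - y) = M * line_laplace eps b (x - y) - ?U x * line_laplace eps b (x - y)" for x
    using line_laplace_off[of x b] by (cases "x \<in> cball y (2 * eps)") (simp_all add: w_def algebra_simps)
  moreover have "integrable lborel (\<lambda>x. ?U x * line_laplace eps b (x - y))"
  proof -
    have L: "\<bar>line_laplace eps b (x - y)\<bar> \<le> B * V / \<kappa>" for x
    proof -
      have "\<bar>\<kappa> * line_laplace eps b (x - y)\<bar> \<le> B * V"
        by (rule Lim_bounded[OF tendsto_rabs[OF S_lim], where M=0]) (use S_bound in simp)
      then show ?thesis using \<kappa>(1) by (simp add: abs_mult field_simps)
    qed
    have "integrable lborel (\<lambda>x. M * line_laplace eps b (x - y) - w x * line_laplace eps b (x - y))"
      by (intro Bochner_Integration.integrable_diff integrable_mult_right integrable_line_laplace integrable_w_mult[OF meas_L L])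
    then show ?thesis using calculation by simp
  qed
  ultimately have "(LBINT x. w x * line_laplace eps b (x - y)) = - (LBINT x. ?U x * line_laplace eps b (x - y))"
    using integrable_line_laplace[of b] integral_line_laplace_zero[of b] by simp
  then show ?thesis using neg by simp
qed

end

section \<open>From coordinates to lines\<close>

lemma coord_bij: "bij_betw (coord :: nat \<Rightarrow> 'n::{finite,linorder}) {..<CARD('n)} UNIV"
proof -
  let ?xs = "sorted_list_of_set (UNIV :: 'n set)"
  have "bij_betw ((!) ?xs) {..<length ?xs} (set ?xs)"
    by (rule bij_betw_nth) auto
  then show ?thesis by (simp add: coord_def[abs_def])
qed

text \<open>The quaternionic vector with \<open>b l\<close> as its coordinate \<open>q\<^sub>l\<close>.\<close>

definition qvec :: "(nat \<Rightarrow> quat) \<Rightarrow> 'n::{finite,linorder} qspace" where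
  "qvec b = (\<chi> i. b (inv_into {..<CARD('n)} coord i))"

lemma qvec_coord: "l < CARD('n) \<Longrightarrow> (qvec b :: 'n::{finite,linorder} qspace) $ coord l = b l"
  using coord_bij[where 'n='n] by (simp add: qvec_def bij_betw_def)

lemma qact_qvec:
  "qact (qvec b :: 'n::{finite,linorder} qspace) q = (\<Sum>l<CARD('n). axis (coord l) (qmult (b l) q))"
proof (rule vec_eq_iff[THEN iffD2], rule allI)
  fix i :: 'n
  obtain m where m: "m < CARD('n)" "i = coord m"
    using coord_bij[where 'n='n] unfolding bij_betw_def by (metis UNIV_I imageE lessThan_iff)
  have "(\<Sum>l<CARD('n). axis (coord l) (qmult (b l) q)) $ i = (\<Sum>l<CARD('n). if l = m then qmult (b m) q else 0)"
    unfolding sum_component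
  proof (rule sum.cong[OF refl])
    fix l assume "l \<in> {..<CARD('n)}"
    then have "(coord l :: 'n) = coord m \<longleftrightarrow> l = m"
      using coord_bij[where 'n='n] m(1) unfolding bij_betw_def inj_on_def by auto
    then show "axis (coord l) (qmult (b l) q) $ i = (if l = m then qmult (b m) q else 0)"
      by (auto simp: axis_def m(2))
  qed
  also have "\<dots> = qact (qvec b) q $ i"
    using m by (simp add: qact_def qvec_coord)
  finally show "qact (qvec b) q $ i = (\<Sum>l<CARD('n). axis (coord l) (qmult (b l) q)) $ i" by simp
qed

lemma sum_double: "(\<Sum>k<2*n. f k) = (\<Sum>l<n. f (2*l) + f (2*l+1 :: nat))" for f :: "nat \<Rightarrow> 'a::comm_monoid_add"
  by (induction n) (auto simp: add.assoc)

lemma axis_quat_expand: "axis i (q::quat) = (\<Sum>t\<in>UNIV. (q $ t) *\<^sub>R axis i (axis t 1))"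
proof (rule vec_eq_iff[THEN iffD2], rule allI)
  fix j
  have "q = (\<Sum>s\<in>UNIV. (q $ s) *\<^sub>R axis s 1)"
    using basis_expansion[of q] by (simp add: scalar_mult_eq_scaleR)
  then show "axis i q $ j = (\<Sum>t\<in>UNIV. (q $ t) *\<^sub>R axis i (axis t 1)) $ j"
    by (cases "j = i") (simp_all add: axis_def)
qed

lemma quat_axis_nth: "axis s (1::real) $ t = (if t = s then 1 else 0)"
  by (simp add: axis_def)

lemma tau_expand:
  "tau a 0 0 = complex_of_real (a $ 1) - \<i> * complex_of_real (a $ 2)"
  "tau a 0 1 = - complex_of_real (a $ 3) + \<i> * complex_of_real (a $ 4)"
  "tau a 1 0 = complex_of_real (a $ 3) + \<i> * complex_of_real (a $ 4)"
  "tau a 1 1 = complex_of_real (a $ 1) + \<i> * complex_of_real (a $ 2)"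
  by (simp_all add: tau_def complex_eq_iff)

lemma ncoef_values:
  "ncoef (2*l) \<alpha> s = ncoef 0 \<alpha> s" "ncoef (2*l+1) \<alpha> s = ncoef 1 \<alpha> s"
  "ncoef 0 0 1 = 1" "ncoef 0 0 2 = \<i>" "ncoef 0 0 3 = 0" "ncoef 0 0 4 = 0"
  "ncoef 0 1 1 = 0" "ncoef 0 1 2 = 0" "ncoef 0 1 3 = - 1" "ncoef 0 1 4 = - \<i>"
  "ncoef 1 0 1 = 0" "ncoef 1 0 2 = 0" "ncoef 1 0 3 = 1" "ncoef 1 0 4 = - \<i>"
  "ncoef 1 1 1 = 1" "ncoef 1 1 2 = - \<i>" "ncoef 1 1 3 = 0" "ncoef 1 1 4 = 0"
  by (simp_all add: ncoef_def)

lemma qmult_axis_values: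
  "qmult a (axis 1 1) $ 1 = a $ 1" "qmult a (axis 1 1) $ 2 = a $ 2" "qmult a (axis 1 1) $ 3 = a $ 3" "qmult a (axis 1 1) $ 4 = a $ 4"
  "qmult a (axis 2 1) $ 1 = - a $ 2" "qmult a (axis 2 1) $ 2 = a $ 1" "qmult a (axis 2 1) $ 3 = a $ 4" "qmult a (axis 2 1) $ 4 = - a $ 3"
  "qmult a (axis 3 1) $ 1 = - a $ 3" "qmult a (axis 3 1) $ 2 = - a $ 4" "qmult a (axis 3 1) $ 3 = a $ 1" "qmult a (axis 3 1) $ 4 = a $ 2"
  "qmult a (axis 4 1) $ 1 = - a $ 4" "qmult a (axis 4 1) $ 2 = a $ 3" "qmult a (axis 4 1) $ 3 = - a $ 2" "qmult a (axis 4 1) $ 4 = a $ 1"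
  by (simp_all add: quat_axis_nth)

text \<open>Up to the factor 2, \<open>\<nabla>\<^bsub>k\<alpha>\<^esub>\<close> is the derivative in the complex coordinate \<open>\<tau>(q)\<^bsub>k\<alpha>\<^esub>\<close>. As \<open>\<tau>\<close> is multiplicative, the
  linear substitution \<open>\<lambda> \<mapsto> b\<lambda>\<close> acts on the first index only, through the matrix \<open>\<tau>(b)\<close>. Here \<open>f\<close> stands for the
  derivative as a function of the direction.\<close>

lemma chain_rule_line:
  fixes f :: "'n::{finite,linorder} qspace \<Rightarrow> complex"
  assumes f: "linear f" and p: "p < 2" and \<alpha>: "\<alpha> < 2"
  shows "(\<Sum>k<2*CARD('n). tau (b (k div 2)) (k mod 2) p * (\<Sum>s\<in>UNIV. ncoef k \<alpha> s * f (bvec k s))) =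
    (\<Sum>s\<in>UNIV. ncoef p \<alpha> s * f (qact (qvec b) (axis s 1)))"
proof -
  let ?x = "\<lambda>l t. f (axis (coord l) (axis t 1))"
  have fa: "f (axis (coord l) (qmult a q)) = (\<Sum>t\<in>UNIV. complex_of_real (qmult a q $ t) * ?x l t)" for l a q
    unfolding axis_quat_expand[of "coord l" "qmult a q"] linear_sum[OF f] linear_cmul[OF f] by (simp add: scaleR_conv_of_real)
  have loc: "tau (b l) 0 p * (\<Sum>s\<in>UNIV. ncoef (2*l) \<alpha> s * ?x l s) + tau (b l) 1 p * (\<Sum>s\<in>UNIV. ncoef (2*l+1) \<alpha> s * ?x l s)
    = (\<Sum>s\<in>UNIV. ncoef p \<alpha> s * f (axis (coord l) (qmult (b l) (axis s 1))))" for l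
  proof -
    consider "p = 0" "\<alpha> = 0" | "p = 0" "\<alpha> = 1" | "p = 1" "\<alpha> = 0" | "p = 1" "\<alpha> = 1" using p \<alpha> by linarith
    then show ?thesis
    proof cases
      case 1
      show ?thesis unfolding 1 fa sum_UNIV_4 tau_expand ncoef_values qmult_axis_values of_real_minus
        by (simp add: complex_eq_iff algebra_simps)
    next
      case 2
      show ?thesis unfolding 2 fa sum_UNIV_4 tau_expand ncoef_values qmult_axis_values of_real_minus
        by (simp add: complex_eq_iff algebra_simps)
    next
      case 3
      show ?thesis unfolding 3 fa sum_UNIV_4 tau_expand ncoef_values qmult_axis_values of_real_minus
        by (simp add: complex_eq_iff algebra_simps)
    next
      case 4
      show ?thesis unfolding 4 fa sum_UNIV_4 tau_expand ncoef_values qmult_axis_values of_real_minus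
        by (simp add: complex_eq_iff algebra_simps)
    qed
  qed
  have "(\<Sum>k<2*CARD('n). tau (b (k div 2)) (k mod 2) p * (\<Sum>s\<in>UNIV. ncoef k \<alpha> s * f (bvec k s))) = 
    (\<Sum>l<CARD('n). \<Sum>s\<in>UNIV. ncoef p \<alpha> s * f (axis (coord l) (qmult (b l) (axis s 1))))"
    unfolding sum_double using loc by (simp add: bvec_def)
  also have "\<dots> = (\<Sum>s\<in>UNIV. ncoef p \<alpha> s * (\<Sum>l<CARD('n). f (axis (coord l) (qmult (b l) (axis s 1)))))"
    unfolding sum_distrib_left by (rule sum.swap)
  finally show ?thesis by (simp add: qact_qvec linear_sum[OF f])
qed

text \<open>By the chain rule the left-hand side is the operator
  \<open>\<nabla>\<^bsub>00\<^esub>\<nabla>\<^bsub>11\<^esub> - \<nabla>\<^bsub>10\<^esub>\<nabla>\<^bsub>01\<^esub>\<close> in the single variable \<open>\<lambda>\<close>, and this is the Laplacian in four real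
  variables. \<open>H\<close> stands for the second derivative as a symmetric form.\<close>

theorem nabla_form_on_line:
  fixes H :: "'n::{finite,linorder} qspace \<Rightarrow> 'n qspace \<Rightarrow> real" and b :: "nat \<Rightarrow> quat"
  assumes H: "bilinear H" and sym: "\<And>v w. H v w = H w v"
  defines "B \<equiv> \<lambda>k q. tau (b (k div 2)) (k mod 2) q"
  shows "(\<Sum>k<2*CARD('n). \<Sum>l<2*CARD('n). \<Sum>s\<in>UNIV. \<Sum>t\<in>UNIV.
      ncoef k 0 s * ncoef l 1 t * (B k 0 * B l 1 - B k 1 * B l 0) * of_real (H (bvec k s) (bvec l t))) =
    of_real (\<Sum>s\<in>UNIV. H (qact (qvec b) (axis s 1)) (qact (qvec b) (axis s 1)))"
proof -
  let ?N = "2*CARD('n)"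
  let ?e = "\<lambda>s::4. qact (qvec b :: 'n qspace) (axis s 1)"
  have l1: "linear (\<lambda>v. complex_of_real (H v w))" for w
  proof -
    have h: "linear (\<lambda>v. H v w)" using H unfolding bilinear_def by blast
    show ?thesis 
      by (intro linearI) (simp_all only: linear_add[OF h] linear_cmul[OF h] scaleR_conv_of_real[where 'a=complex] of_real_add real_scaleR_def of_real_mult)
  qed
  have l2: "linear (\<lambda>v. complex_of_real (H w v))" for w
    using l1[of w] by (simp only: sym[of w])
  have dbl: "(\<Sum>k<?N. \<Sum>l<?N. \<Sum>s\<in>UNIV. \<Sum>t\<in>UNIV. ncoef k 0 s * ncoef l 1 t * (B k p * B l q) * of_real (H (bvec k s) (bvec l t)))
     = (\<Sum>s\<in>UNIV. \<Sum>t\<in>UNIV. ncoef p 0 s * ncoef q 1 t * of_real (H (?e s) (?e t)))" if "p < 2" "q < 2" for p q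
  proof -
    have "(\<Sum>l<?N. \<Sum>s\<in>UNIV. \<Sum>t\<in>UNIV. ncoef k 0 s * ncoef l 1 t * (B k p * B l q) * of_real (H (bvec k s) (bvec l t)))
      = B k p * (\<Sum>s\<in>UNIV. ncoef k 0 s * (\<Sum>t\<in>UNIV. ncoef q 1 t * of_real (H (bvec k s) (?e t))))" for k
    proof -
      have "(\<Sum>l<?N. \<Sum>s\<in>UNIV. \<Sum>t\<in>UNIV. ncoef k 0 s * ncoef l 1 t * (B k p * B l q) * of_real (H (bvec k s) (bvec l t)))
       = (\<Sum>s\<in>UNIV. \<Sum>l<?N. \<Sum>t\<in>UNIV. ncoef k 0 s * ncoef l 1 t * (B k p * B l q) * of_real (H (bvec k s) (bvec l t)))"
        by (rule sum.swap)
      also have "\<dots> = (\<Sum>s\<in>UNIV. B k p * ncoef k 0 s * (\<Sum>l<?N. B l q * (\<Sum>t\<in>UNIV. ncoef l 1 t * of_real (H (bvec k s) (bvec l t)))))"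
        by (simp only: sum_distrib_left mult_ac)
      also have "\<dots> = (\<Sum>s\<in>UNIV. B k p * ncoef k 0 s * (\<Sum>t\<in>UNIV. ncoef q 1 t * of_real (H (bvec k s) (?e t))))"
        unfolding B_def by (subst chain_rule_line[OF l2 that(2)]) simp_all
      finally show ?thesis by (simp only: sum_distrib_left mult.assoc)
    qed
    then have "(\<Sum>k<?N. \<Sum>l<?N. \<Sum>s\<in>UNIV. \<Sum>t\<in>UNIV. ncoef k 0 s * ncoef l 1 t * (B k p * B l q) * of_real (H (bvec k s) (bvec l t)))
      = (\<Sum>k<?N. B k p * (\<Sum>s\<in>UNIV. ncoef k 0 s * (\<Sum>t\<in>UNIV. ncoef q 1 t * of_real (H (bvec k s) (?e t)))))" by simp
    also have "\<dots> = (\<Sum>s\<in>UNIV. ncoef p 0 s * (\<Sum>t\<in>UNIV. ncoef q 1 t * of_real (H (?e s) (?e t))))"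
      unfolding B_def
    proof (rule chain_rule_line[OF _ that(1)])
      show "linear (\<lambda>v. \<Sum>t\<in>UNIV. ncoef q 1 t * complex_of_real (H v (?e t)))"
        by (intro linear_compose_sum ballI) (rule linear_compose[OF l1, unfolded o_def], auto intro!: linearI simp: algebra_simps)
    qed simp
    finally show ?thesis by (simp only: sum_distrib_left mult.assoc)
  qed
  have "(\<Sum>k<?N. \<Sum>l<?N. \<Sum>s\<in>UNIV. \<Sum>t\<in>UNIV.
      ncoef k 0 s * ncoef l 1 t * (B k 0 * B l 1 - B k 1 * B l 0) * of_real (H (bvec k s) (bvec l t))) =
    (\<Sum>k<?N. \<Sum>l<?N. \<Sum>s\<in>UNIV. \<Sum>t\<in>UNIV. ncoef k 0 s * ncoef l 1 t * (B k 0 * B l 1) * of_real (H (bvec k s) (bvec l t))) - 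
    (\<Sum>k<?N. \<Sum>l<?N. \<Sum>s\<in>UNIV. \<Sum>t\<in>UNIV. ncoef k 0 s * ncoef l 1 t * (B k 1 * B l 0) * of_real (H (bvec k s) (bvec l t)))"
    by (simp only: right_diff_distrib left_diff_distrib sum_subtractf)
  also have "\<dots> = of_real (\<Sum>s\<in>UNIV. H (?e s) (?e s))"
    using sym[of "?e 2" "?e 1"] sym[of "?e 4" "?e 3"]
    by (subst dbl, simp, simp, subst dbl, simp, simp) (simp add: sum_UNIV_4 ncoef_def algebra_simps)
  finally show ?thesis .
qed

section \<open>Positivity of the current\<close>

lemma bump2_bounded:
  assumes "eps > 0"
  obtains B where "0 \<le> B" "\<And>z::'a::euclidean_space. \<bar>bump2 eps z v w\<bar> \<le> B"
proof -
  have "continuous_on UNIV (\<lambda>z::'a. bump2 eps z v w)" by (intro continuous_intros)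
  moreover have "bump2 eps z v w = 0" if "z \<notin> cball 0 eps" for z :: 'a
    by (rule bump_zero(3)) (use that assms in \<open>auto simp: dist_norm\<close>)
  ultimately obtain B where "0 \<le> B" "\<And>z::'a. norm (bump2 eps z v w) \<le> B"
    using bounded_continuous_compact_support[OF _ compact_cball] by blast
  then show thesis by (intro that) auto
qed

lemma integrable_mult_bump2:
  fixes W :: "'a::euclidean_space \<Rightarrow> real"
  assumes "eps > 0" and W: "integrable lborel W"
  shows "integrable lborel (\<lambda>x. W x * bump2 eps (x - y) v w)"
proof -
  have [measurable]: "W \<in> borel_measurable borel" using borel_measurable_integrable[OF W] by simp
  obtain B where B: "0 \<le> B" "\<And>z::'a. \<bar>bump2 eps z v w\<bar> \<le> B" using bump2_bounded[OF assms(1)] by blast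
  show ?thesis
  proof (rule Bochner_Integration.integrable_bound[of lborel "\<lambda>x. B * W x"])
    show "integrable lborel (\<lambda>x. B * W x)" using W by simp
    show "AE x in lborel. norm (W x * bump2 eps (x - y) v w) \<le> norm (B * W x)"
    proof (rule AE_I2)
      fix x
      have "\<bar>W x\<bar> * \<bar>bump2 eps (x - y) v w\<bar> \<le> \<bar>W x\<bar> * B" by (intro mult_left_mono B) simp
      then show "norm (W x * bump2 eps (x - y) v w) \<le> norm (B * W x)" using B(1) by (simp add: abs_mult mult.commute)
    qed
  qed measurable
qed

lemma Fubini_bump2:
  fixes W :: "'a::euclidean_space \<Rightarrow> real" and h :: "'a \<Rightarrow> complex"
  assumes eps: "eps > 0" and W: "integrable lborel W" and h: "continuous_on UNIV h" "compact K" "\<And>x. x \<notin> K \<Longrightarrow> h x = 0"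
  shows "(LBINT x. W x *\<^sub>R (LBINT y. bump2 eps (x - y) v w *\<^sub>R h y)) =
      (LBINT y. (LBINT x. W x * bump2 eps (x - y) v w) *\<^sub>R h y)" (is ?eq)
    and "integrable lborel (\<lambda>x. W x *\<^sub>R (LBINT y. bump2 eps (x - y) v w *\<^sub>R h y))" (is ?ix)
    and "integrable lborel (\<lambda>y. (LBINT x. W x * bump2 eps (x - y) v w) *\<^sub>R h y)" (is ?iy)
proof -
  have W_meas [measurable]: "W \<in> borel_measurable borel" using borel_measurable_integrable[OF W] by simp
  have h_meas [measurable]: "h \<in> borel_measurable borel" using borel_measurable_continuous_onI[OF h(1)] .
  obtain B where B: "0 \<le> B" "\<And>z::'a. \<bar>bump2 eps z v w\<bar> \<le> B" using bump2_bounded[OF eps] by blast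
  have ih: "integrable lborel h" by (rule integrable_continuous_compact_support[OF h])
  let ?f = "\<lambda>(x, y). W x *\<^sub>R (bump2 eps (x - y) v w *\<^sub>R h y)"
  have iy1: "integrable lborel (\<lambda>y. bump2 eps (x - y) v w *\<^sub>R h y)" for x
  proof (rule integrable_continuous_compact_support[OF _ h(2)])
    show "continuous_on UNIV (\<lambda>y. bump2 eps (x - y) v w *\<^sub>R h y)" using h(1) by (intro continuous_intros)
  qed (use h(3) in simp)
  have iy0: "integrable lborel (\<lambda>y. W x *\<^sub>R (bump2 eps (x - y) v w *\<^sub>R h y))" for x
    by (rule integrable_scaleR_right) (rule iy1)
  have bound: "norm (LBINT y. norm (W x *\<^sub>R (bump2 eps (x - y) v w *\<^sub>R h y))) \<le> norm (W x * (B * (LBINT y. norm (h y))))" for x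
  proof -
    have "(LBINT y. norm (W x *\<^sub>R (bump2 eps (x - y) v w *\<^sub>R h y))) \<le> (LBINT y. \<bar>W x\<bar> * (B * norm (h y)))"
    proof (rule integral_mono)
      show "integrable lborel (\<lambda>y. norm (W x *\<^sub>R (bump2 eps (x - y) v w *\<^sub>R h y)))" using iy0 by (rule integrable_norm)
      show "integrable lborel (\<lambda>y. \<bar>W x\<bar> * (B * norm (h y)))" using ih by (intro integrable_mult_right integrable_norm)
      show "norm (W x *\<^sub>R (bump2 eps (x - y) v w *\<^sub>R h y)) \<le> \<bar>W x\<bar> * (B * norm (h y))" for y
        unfolding norm_scaleR real_norm_def using B(2) by (intro mult_left_mono mult_right_mono) auto
    qed
    moreover have "0 \<le> (LBINT y. norm (W x *\<^sub>R (bump2 eps (x - y) v w *\<^sub>R h y)))" by (intro integral_nonneg_AE AE_I2) simp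
    moreover have "0 \<le> (LBINT y. norm (h y))" by (intro integral_nonneg_AE AE_I2) simp
    ultimately show ?thesis using B(1) by (simp add: abs_mult)
  qed
  have int: "integrable (lborel \<Otimes>\<^sub>M lborel) ?f"
  proof (rule lborel_pair.Fubini_integrable)
    show "?f \<in> borel_measurable (lborel \<Otimes>\<^sub>M lborel)" by measurable
    show "integrable lborel (\<lambda>x. LBINT y. norm (?f (x, y)))"
    proof (rule Bochner_Integration.integrable_bound[of lborel "\<lambda>x. W x * (B * (LBINT y. norm (h y)))"])
      show "integrable lborel (\<lambda>x. W x * (B * (LBINT y. norm (h y))))" using W by simp
      show "AE x in lborel. norm (LBINT y. norm (?f (x, y))) \<le> norm (W x * (B * (LBINT y. norm (h y))))"
        using bound by simp
    qed measurable
    show "AE x in lborel. integrable lborel (\<lambda>y. ?f (x, y))" using iy0 by simp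
  qed
  have ex: "(LBINT y. W x *\<^sub>R (bump2 eps (x - y) v w *\<^sub>R h y)) = W x *\<^sub>R (LBINT y. bump2 eps (x - y) v w *\<^sub>R h y)" for x
    by (rule integral_scaleR_right)
  have ey: "(LBINT x. W x *\<^sub>R (bump2 eps (x - y) v w *\<^sub>R h y)) = (LBINT x. W x * bump2 eps (x - y) v w) *\<^sub>R h y" for y
    using integrable_mult_bump2[OF eps W, of y v w] by simp
  show ?eq
    using lborel_pair.Fubini_integral[OF int] unfolding ex ey by (rule sym)
  show ?ix
    using lborel_pair.integrable_fst'[OF int] unfolding prod.case ex .
  show ?iy
    using lborel_pair.integrable_snd[OF int] unfolding ey .
qed

text \<open>The top coefficient of \<open>\<triangle>g \<and> c\<close> at a point where \<open>H\<close> is the second derivative of \<open>g\<close>.\<close>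

definition laplace_pairing :: "('n::{finite,linorder} qspace \<Rightarrow> 'n qspace \<Rightarrow> real) \<Rightarrow> ext \<Rightarrow> complex" where
  "laplace_pairing H c = (\<Sum>k<2*CARD('n). \<Sum>l<2*CARD('n). \<Sum>s\<in>UNIV. \<Sum>t\<in>UNIV.
    ncoef k 0 s * ncoef l 1 t * top_sign (2*CARD('n)) k l * c ({..<2*CARD('n)} - {k} - {l}) * of_real (H (bvec k s) (bvec l t)))"

text \<open>The pairing is linear in \<open>c\<close>, so only elementary \<open>c\<close> matter, and for these it is a nonnegative multiple of the trace
  of \<open>H\<close> over one right line.\<close>

lemma laplace_pairing_SP_nonneg:
  fixes H :: "'n::{finite,linorder} qspace \<Rightarrow> 'n qspace \<Rightarrow> real"
  assumes H: "bilinear H" "\<And>v w. H v w = H w v"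
    and pos: "\<And>b. b \<noteq> 0 \<Longrightarrow> 0 \<le> (\<Sum>s\<in>UNIV. H (qact b (axis s 1)) (qact b (axis s 1)))"
    and c: "c \<in> SP CARD('n) (CARD('n) - 1)"
  shows "laplace_pairing H c \<in> \<real>\<^sub>\<ge>\<^sub>0"
  using c
proof (induction rule: SP.induct)
  case zero
  then show ?case by (simp add: laplace_pairing_def)
next
  case (elementary c)
  obtain \<kappa> b where \<kappa>: "0 \<le> \<kappa>" and b: "\<exists>l<CARD('n). b l \<noteq> (0::quat)" and
    eq: "\<And>k l. k < 2*CARD('n) \<Longrightarrow> l < 2*CARD('n) \<Longrightarrow> wedge (omega {k}) (wedge (omega {l}) c) {..<2*CARD('n)} =
       of_real \<kappa> * (tau (b (k div 2)) (k mod 2) 0 * tau (b (l div 2)) (l mod 2) 1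
         - tau (b (k div 2)) (k mod 2) 1 * tau (b (l div 2)) (l mod 2) 0)"
    using elementary_sp_coeff[OF elementary zero_less_card_finite] by blast
  let ?B = "\<lambda>k q. tau (b (k div 2)) (k mod 2) q"
  have "laplace_pairing H c = (\<Sum>k<2*CARD('n). \<Sum>l<2*CARD('n). \<Sum>s\<in>UNIV. \<Sum>t\<in>UNIV. of_real \<kappa> *
    (ncoef k 0 s * ncoef l 1 t * (?B k 0 * ?B l 1 - ?B k 1 * ?B l 0) * of_real (H (bvec k s) (bvec l t))))"
    unfolding laplace_pairing_def
  proof (intro sum.cong refl)
    fix k l s t assume k: "k \<in> {..<2*CARD('n)}" and l: "l \<in> {..<2*CARD('n)}"
    have "top_sign (2*CARD('n)) k l * c ({..<2*CARD('n)} - {k} - {l}) = of_real \<kappa> * (?B k 0 * ?B l 1 - ?B k 1 * ?B l 0)"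
      using eq[of k l] wedge_omega2_top[of k "2*CARD('n)" l c] k l by simp
    then show "ncoef k 0 s * ncoef l 1 t * top_sign (2*CARD('n)) k l * c ({..<2*CARD('n)} - {k} - {l}) * of_real (H (bvec k s) (bvec l t))
      = of_real \<kappa> * (ncoef k 0 s * ncoef l 1 t * (?B k 0 * ?B l 1 - ?B k 1 * ?B l 0) * of_real (H (bvec k s) (bvec l t)))"
      by (simp only: mult.assoc mult.left_commute[of _ "of_real \<kappa>"])
  qed
  also have "\<dots> = of_real \<kappa> * of_real (\<Sum>s\<in>UNIV. H (qact (qvec b) (axis s 1)) (qact (qvec b) (axis s 1)))"
    unfolding sum_distrib_left[symmetric] nabla_form_on_line[OF H] ..
  also have "\<dots> \<in> \<real>\<^sub>\<ge>\<^sub>0"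
  proof -
    have "(qvec b :: 'n qspace) \<noteq> 0" using b qvec_coord[of _ b, where 'n='n] by (metis zero_index)
    from mult_nonneg_nonneg[OF \<kappa> pos[OF this]] show ?thesis
      unfolding of_real_mult[symmetric] by (simp only: nonneg_Reals_of_real_iff)
  qed
  finally show ?case .
next
  case (add a b)
  have "laplace_pairing H (\<lambda>I. a I + b I) = laplace_pairing H a + laplace_pairing H b"
    unfolding laplace_pairing_def by (simp only: sum.distrib[symmetric] distrib_left distrib_right)
  then show ?case using add by simp
next
  case (scale a r)
  have "laplace_pairing H (\<lambda>I. complex_of_real r * a I) = of_real r * laplace_pairing H a"
    unfolding laplace_pairing_def sum_distrib_left by (simp only: mult_ac)
  then show ?case using scale by simp
qed

text \<open>Let \<open>A eps\<close> be the integral of \<open>u\<close> against the mollification of \<open>\<triangle>\<eta>\<close>. After integration by parts and exchange of the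
  integrals, \<open>A eps\<close> is the integral over \<open>y\<close> of the pairing of the strongly positive element \<open>\<eta> y\<close> with the form
  \<open>H eps y v w = \<integral> u(x) \<partial>\<^sub>v\<partial>\<^sub>w bump (x - y) dx\<close>, whose traces over right lines are nonnegative. So \<open>A eps\<close> is nonnegative, and
  divided by the mass of the bump function it converges to the value of the current at \<open>\<eta>\<close>.\<close>

theorem positive_laplace:
  fixes \<Omega> :: "'n::{finite,linorder} qspace set" and u :: "'n qspace \<Rightarrow> ereal"
  assumes op: "open \<Omega>" and u: "u \<in> PSH \<Omega>" and loc: "loc_integrable_on \<Omega> u"
  shows "positive_current \<Omega> 1 (laplace_current (current_of_form \<Omega> (zero_form u)))"
  unfolding positive_current_def
proof (intro ballI impI)
  fix \<eta> assume \<eta>: "\<eta> \<in> test_forms \<Omega> (2 * int CARD('n) - 2 * int 1)" and SP: "\<forall>x. \<eta> x \<in> SP CARD('n) (CARD('n) - 1)"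
  let ?N = "2*CARD('n)" and ?T = "laplace_current (current_of_form \<Omega> (zero_form u)) \<eta>"
  note sm = test_formsD[OF \<eta>]
  define K0 where "K0 = form_support \<eta>"
  have K0: "compact K0" "K0 \<subseteq> \<Omega>" and \<eta>0: "\<And>x I. x \<notin> K0 \<Longrightarrow> \<eta> x I = 0"
    using sm form_support_zero by (auto simp: K0_def)
  let ?L = "\<lambda>x. laplace_form \<eta> x {..<?N}"
  have Lc: "continuous_on UNIV ?L" by (rule laplace_form_top_continuous[OF sm(1)])
  have L0: "?L x = 0" if "x \<notin> K0" for x
    using laplace_form_top_off_support[OF sm(1,2)] that by (simp add: K0_def)
  show "?T \<in> \<real>\<^sub>\<ge>\<^sub>0"
  proof (cases "K0 = {}")
    case True
    then show ?thesis unfolding laplace_current_zero_form using L0 by simp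
  next
    case False
    obtain e where e: "e > 0" "{x. infdist x K0 \<le> e} \<subseteq> \<Omega>"
      using compact_in_open_separated[OF False K0(1) op K0(2)] by blast
    define K where "K = {x. infdist x K0 \<le> e}"
    have K: "compact K" "K \<subseteq> \<Omega>"
      using compact_infdist_le[OF False K0(1) e(1)] e(2) by (auto simp: K_def)
    have near: "x \<in> K" if "y \<in> K0" "dist x y \<le> e" for x y
      using infdist_le2[OF that] by (simp add: K_def)
    have K0K: "x \<in> K" if "x \<in> K0" for x using near[OF that, of x] e(1) by simp
    define W where "W = cutoff u K"
    have W: "integrable lborel W"
      using loc K unfolding loc_integrable_on_def set_integrable_def W_def by simp
    have Lz: "?L x = 0" if "x \<notin> K" for x using L0 K0K that by blast
    have T: "?T = (LBINT x. W x *\<^sub>R ?L x)" and iWL: "integrable lborel (\<lambda>x. W x *\<^sub>R ?L x)"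
      using loc_integrable_mult_compact_support[OF loc K Lc Lz] unfolding laplace_current_zero_form W_def by auto
    have sub: "cball y (2 * eps) \<subseteq> K" if "y \<in> K0" "eps \<le> e / 2" for y eps
      using near[OF that(1)] that(2) by (auto simp: dist_commute)
    define H where "H = (\<lambda>eps y v w. LBINT x. W x * bump2 eps (x - y) v w)"
    have pairing_pos: "laplace_pairing (H eps y) (\<eta> y) \<in> \<real>\<^sub>\<ge>\<^sub>0" if eps: "eps > 0" "eps \<le> e / 2" for eps y
    proof (cases "y \<in> K0")
      case False
      then show ?thesis using \<eta>0 by (simp add: laplace_pairing_def)
    next
      case True
      note int = integrable_mult_bump2[OF eps(1) W, of y]
      show ?thesis
      proof (rule laplace_pairing_SP_nonneg)
        show sym: "H eps y v w = H eps y w v" for v w by (simp add: H_def bump2_commute[of _ _ v w])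
        have lin: "linear (\<lambda>w. H eps y v w)" for v
        proof (rule linearI)
          have b: "linear (bump2 eps z v)" for z using bump2_bilinear unfolding bilinear_def by blast
          show "H eps y v (w + w') = H eps y v w + H eps y v w'" for w w'
            using int[of v w] int[of v w'] by (simp add: H_def linear_add[OF b] distrib_left)
          show "H eps y v (r *\<^sub>R w) = r *\<^sub>R H eps y v w" for r w
            by (simp add: H_def linear_cmul[OF b] mult.left_commute)
        qed
        then show "bilinear (H eps y)"
          unfolding bilinear_def using sym by simp
        show "\<eta> y \<in> SP CARD('n) (CARD('n) - 1)" using SP by blast
        fix b :: "'n qspace" assume b: "b \<noteq> 0"
        obtain M where M: "0 \<le> M" "\<And>x. x \<in> K \<Longrightarrow> u x \<le> ereal M"
          using usc_bounded_above[OF _ op K] u unfolding PSH_def by blast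
        have c: "cball y (2 * eps) \<subseteq> K" by (rule sub[OF True eps(2)])
        interpret psh_bump \<Omega> u eps M y
          by unfold_locales (use u op loc eps c K M in auto)
        have "(\<Sum>s\<in>UNIV. H eps y (qact b (axis s 1)) (qact b (axis s 1))) = (LBINT x. W x * line_laplace eps b (x - y))"
          unfolding H_def line_laplace_def sum_distrib_left using int by (simp add: Bochner_Integration.integral_sum)
        also have "\<dots> = (LBINT x. cutoff u (cball y (2 * eps)) x * line_laplace eps b (x - y))"
        proof (rule Bochner_Integration.integral_cong[OF refl])
          fix x
          show "W x * line_laplace eps b (x - y) = cutoff u (cball y (2 * eps)) x * line_laplace eps b (x - y)"
            using line_laplace_off[of x b] c by (cases "x \<in> cball y (2 * eps)") (auto simp: W_def)
        qed
        finally show "0 \<le> (\<Sum>s\<in>UNIV. H eps y (qact b (axis s 1)) (qact b (axis s 1)))"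
          using line_laplace_nonneg[OF b] by simp
      qed
    qed
    define A where "A = (\<lambda>eps. LBINT x. W x *\<^sub>R (LBINT y. bump eps (x - y) *\<^sub>R ?L y))"
    let ?c = "\<lambda>k l s t. ncoef k 0 s * ncoef l 1 t * top_sign ?N k l"
    let ?h = "\<lambda>k l y. \<eta> y ({..<?N} - {k} - {l})"
    have conv: "(LBINT y. bump eps (x - y) *\<^sub>R ?L y) = (\<Sum>k<?N. \<Sum>l<?N. \<Sum>s\<in>UNIV. \<Sum>t\<in>UNIV.
        ?c k l s t * (LBINT y. bump2 eps (x - y) (bvec k s) (bvec l t) *\<^sub>R ?h k l y))" if eps: "eps > 0" for eps x
    proof -
      have i: "integrable lborel (\<lambda>y. ?c k l s t * (bump eps (x - y) *\<^sub>R dd (bvec k s) (dd (bvec l t) (?h k l)) y))" for k l s t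
      proof (rule integrable_mult_right, rule integrable_continuous_compact_support[OF _ K0(1)])
        show "continuous_on UNIV (\<lambda>y. bump eps (x - y) *\<^sub>R dd (bvec k s) (dd (bvec l t) (?h k l)) y)"
          by (intro continuous_intros smooth_continuous smooth_dd bvec_Basis sm(1))
        show "bump eps (x - y) *\<^sub>R dd (bvec k s) (dd (bvec l t) (?h k l)) y = 0" if "y \<notin> K0" for y
        proof -
          have "dd (bvec k s) (dd (bvec l t) (?h k l)) y = 0"
            by (rule dd2_off_support[OF sm(1,2) _ bvec_Basis bvec_Basis]) (use that in \<open>simp add: K0_def\<close>)
          then show ?thesis by simp
        qed
      qed
      have "(LBINT y. bump eps (x - y) *\<^sub>R ?L y) = (LBINT y. (\<Sum>k<?N. \<Sum>l<?N. \<Sum>s\<in>UNIV. \<Sum>t\<in>UNIV.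
        ?c k l s t * (bump eps (x - y) *\<^sub>R dd (bvec k s) (dd (bvec l t) (?h k l)) y)))"
        unfolding laplace_form_top[OF sm(1)] scaleR_sum_right by simp
      also have "\<dots> = (\<Sum>k<?N. \<Sum>l<?N. \<Sum>s\<in>UNIV. \<Sum>t\<in>UNIV.
        ?c k l s t * (LBINT y. bump eps (x - y) *\<^sub>R dd (bvec k s) (dd (bvec l t) (?h k l)) y))"
        using i by (simp only: Bochner_Integration.integral_sum Bochner_Integration.integrable_sum integral_mult_right_zero)
      also have "\<dots> = (\<Sum>k<?N. \<Sum>l<?N. \<Sum>s\<in>UNIV. \<Sum>t\<in>UNIV.
        ?c k l s t * (LBINT y. bump2 eps (x - y) (bvec k s) (bvec l t) *\<^sub>R ?h k l y))"
      proof (intro sum.cong refl)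
        fix k l :: nat and s t :: 4
        have "(LBINT y. bump eps (x - y) *\<^sub>R dd (bvec k s) (dd (bvec l t) (?h k l)) y) = 
          (LBINT y. bump2 eps (x - y) (bvec l t) (bvec k s) *\<^sub>R ?h k l y)"
          by (rule bump_convolution_dd[OF eps]) (intro smooth_continuous smooth_differentiable smooth_dd bvec_Basis sm(1))+
        then show "?c k l s t * (LBINT y. bump eps (x - y) *\<^sub>R dd (bvec k s) (dd (bvec l t) (?h k l)) y) = 
          ?c k l s t * (LBINT y. bump2 eps (x - y) (bvec k s) (bvec l t) *\<^sub>R ?h k l y)"
          by (simp add: bump2_commute[of _ _ "bvec l t"])
      qed
      finally show ?thesis .
    qed
    have hc: "continuous_on UNIV (?h k l)" for k l by (rule smooth_continuous) (rule sm(1))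
    have h0: "?h k l x = 0" if "x \<notin> K0" for k l x using \<eta>0[OF that] .
    have F: "(LBINT x. W x *\<^sub>R (LBINT y. bump2 eps (x - y) v w *\<^sub>R ?h k l y)) = (LBINT y. H eps y v w *\<^sub>R ?h k l y)"
      "integrable lborel (\<lambda>x. W x *\<^sub>R (LBINT y. bump2 eps (x - y) v w *\<^sub>R ?h k l y))"
      "integrable lborel (\<lambda>y. H eps y v w *\<^sub>R ?h k l y)" if eps: "eps > 0" for eps k l v w
      unfolding H_def using Fubini_bump2[OF eps W hc[of k l] K0(1) h0[of _ k l], of v w] by blast+
    have A_psi: "A eps = (LBINT y. laplace_pairing (H eps y) (\<eta> y))" if eps: "eps > 0" for eps
    proof -
      have "A eps = (LBINT x. (\<Sum>k<?N. \<Sum>l<?N. \<Sum>s\<in>UNIV. \<Sum>t\<in>UNIV.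
        ?c k l s t * (W x *\<^sub>R (LBINT y. bump2 eps (x - y) (bvec k s) (bvec l t) *\<^sub>R ?h k l y))))"
        unfolding A_def conv[OF eps] scaleR_sum_right mult_scaleR_right ..
      also have "\<dots> = (\<Sum>k<?N. \<Sum>l<?N. \<Sum>s\<in>UNIV. \<Sum>t\<in>UNIV.
        ?c k l s t * (LBINT x. W x *\<^sub>R (LBINT y. bump2 eps (x - y) (bvec k s) (bvec l t) *\<^sub>R ?h k l y)))"
        using F(2)[OF eps] by (simp only: Bochner_Integration.integral_sum Bochner_Integration.integrable_sum integral_mult_right_zero integrable_mult_right)
      also have "\<dots> = (\<Sum>k<?N. \<Sum>l<?N. \<Sum>s\<in>UNIV. \<Sum>t\<in>UNIV.
        ?c k l s t * (LBINT y. H eps y (bvec k s) (bvec l t) *\<^sub>R ?h k l y))"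
        unfolding F(1)[OF eps] ..
      also have "\<dots> = (LBINT y. (\<Sum>k<?N. \<Sum>l<?N. \<Sum>s\<in>UNIV. \<Sum>t\<in>UNIV.
        ?c k l s t * (H eps y (bvec k s) (bvec l t) *\<^sub>R ?h k l y)))"
        using F(3)[OF eps] by (simp only: Bochner_Integration.integral_sum Bochner_Integration.integrable_sum integral_mult_right_zero integrable_mult_right)
      also have "\<dots> = (LBINT y. laplace_pairing (H eps y) (\<eta> y))"
        unfolding laplace_pairing_def scaleR_conv_of_real by (simp only: mult_ac)
      finally show ?thesis .
    qed
    have A_pos: "A eps \<in> \<real>\<^sub>\<ge>\<^sub>0" if eps: "eps > 0" "eps \<le> e / 2" for eps
    proof -
      let ?p = "\<lambda>y. laplace_pairing (H eps y) (\<eta> y)"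
      have p: "?p y = of_real (Re (?p y))" "0 \<le> Re (?p y)" for y
        using pairing_pos[OF eps, of y] by (auto elim!: nonneg_Reals_cases)
      have "A eps = (LBINT y. of_real (Re (?p y)))" unfolding A_psi[OF eps(1)] using p(1) by (metis (no_types, lifting))
      also have "\<dots> = of_real (LBINT y. Re (?p y))" by (rule integral_complex_of_real)
      finally show ?thesis using p(2) by (simp add: integral_nonneg_AE)
    qed
    define w where "w = (LBINT x. \<bar>W x\<bar>)"
    have w: "0 \<le> w" unfolding w_def by (intro integral_nonneg_AE AE_I2) simp
    have approx: "\<exists>z\<in>\<real>\<^sub>\<ge>\<^sub>0. norm (z - ?T) \<le> \<delta> * w" if \<delta>: "\<delta> > 0" for \<delta>
    proof -
      have "uniformly_continuous_on K ?L"
        by (rule compact_uniformly_continuous[OF continuous_on_subset[OF Lc] K(1)]) simp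
      then obtain d where d: "d > 0" "\<And>x y. x \<in> K \<Longrightarrow> y \<in> K \<Longrightarrow> dist y x < d \<Longrightarrow> dist (?L y) (?L x) < \<delta>"
        using \<delta> by (rule uniformly_continuous_onE) blast
      define eps where "eps = min (e / 2) (d / 2)"
      have eps: "eps > 0" "eps \<le> e / 2" "eps < d" using e(1) d(1) by (auto simp: eps_def min_def)
      \<comment> \<open>the Laplacian vanishes off K0, so that uniform continuity is only needed on K, which contains the e-neighbourhood of K0\<close>
      have close: "norm (?L y - ?L x) \<le> \<delta>" if xy: "norm (x - y) \<le> eps" for x y
      proof (cases "x \<in> K0 \<or> y \<in> K0")
        case True
        have "dist x y \<le> e" "dist y x \<le> e" using xy eps e(1) by (auto simp: dist_norm norm_minus_commute)
        then have "x \<in> K" "y \<in> K" using True near K0K by blast+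
        then have "dist (?L y) (?L x) < \<delta>" using xy eps by (intro d(2)) (auto simp: dist_norm norm_minus_commute)
        then show ?thesis by (simp add: dist_norm)
      next
        case False
        then show ?thesis using L0 \<delta> by simp
      qed
      define N where "N = (LBINT y. bump eps (y :: 'n qspace))"
      have N: "N > 0" using bump_mass_pos[OF eps(1)] by (simp add: N_def)
      let ?M = "\<lambda>x. LBINT y. bump eps (x - y) *\<^sub>R ?L y"
      have mol: "norm (?M x - N *\<^sub>R ?L x) \<le> \<delta> * N" for x
        unfolding N_def by (rule bump_mollify[OF eps(1) Lc close])
      have iM: "integrable lborel (\<lambda>x. W x *\<^sub>R ?M x)"
        unfolding conv[OF eps(1)] scaleR_sum_right mult_scaleR_right[symmetric]
        by (intro Bochner_Integration.integrable_sum integrable_mult_right F(2)[OF eps(1)])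
      have iN: "integrable lborel (\<lambda>x. W x *\<^sub>R (N *\<^sub>R ?L x))"
        using integrable_scaleR_right[of N lborel "\<lambda>x. W x *\<^sub>R ?L x"] iWL by (simp add: mult.commute)
      have "A eps - N *\<^sub>R ?T = (LBINT x. W x *\<^sub>R ?M x) - (LBINT x. W x *\<^sub>R (N *\<^sub>R ?L x))"
      proof -
        have "N *\<^sub>R ?T = (LBINT x. N *\<^sub>R (W x *\<^sub>R ?L x))"
          unfolding T by (rule integral_scaleR_right[symmetric])
        then show ?thesis unfolding A_def by (simp add: mult.commute)
      qed
      also have "\<dots> = (LBINT x. W x *\<^sub>R (?M x - N *\<^sub>R ?L x))"
        unfolding scaleR_diff_right by (rule Bochner_Integration.integral_diff[OF iM iN, symmetric])
      also have "norm \<dots> \<le> (LBINT x. norm (W x *\<^sub>R (?M x - N *\<^sub>R ?L x)))"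
        by (rule integral_norm_bound)
      also have "\<dots> \<le> (LBINT x. \<bar>W x\<bar> * (\<delta> * N))"
      proof (rule integral_mono)
        show "integrable lborel (\<lambda>x. norm (W x *\<^sub>R (?M x - N *\<^sub>R ?L x)))"
          unfolding scaleR_diff_right using iM iN by (intro integrable_norm Bochner_Integration.integrable_diff)
        show "integrable lborel (\<lambda>x. \<bar>W x\<bar> * (\<delta> * N))" using W by (intro integrable_mult_left integrable_abs)
        show "norm (W x *\<^sub>R (?M x - N *\<^sub>R ?L x)) \<le> \<bar>W x\<bar> * (\<delta> * N)" for x
          unfolding norm_scaleR real_norm_def by (intro mult_left_mono mol) simp
      qed
      also have "\<dots> = N * (\<delta> * w)" by (simp add: w_def mult_ac)
      finally have le: "norm (A eps - N *\<^sub>R ?T) \<le> N * (\<delta> * w)" .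
      have "A eps - N *\<^sub>R ?T = N *\<^sub>R ((1 / N) *\<^sub>R A eps - ?T)" using N by (simp add: scaleR_diff_right)
      then have "N * norm ((1 / N) *\<^sub>R A eps - ?T) \<le> N * (\<delta> * w)" using le N by simp
      then have "norm ((1 / N) *\<^sub>R A eps - ?T) \<le> \<delta> * w" using N by simp
      moreover have "(1 / N) *\<^sub>R A eps \<in> \<real>\<^sub>\<ge>\<^sub>0"
        unfolding scaleR_conv_of_real using A_pos[OF eps(1,2)] N by (intro nonneg_Reals_mult_I) auto
      ultimately show ?thesis by blast
    qed
    have "?T \<in> closure \<real>\<^sub>\<ge>\<^sub>0"
      unfolding closure_approachable
    proof (intro allI impI)
      fix r :: real assume r: "r > 0"
      obtain z where z: "z \<in> \<real>\<^sub>\<ge>\<^sub>0" "norm (z - ?T) \<le> r / (w + 1) * w"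
        using approx[of "r / (w + 1)"] r w by auto
      have "r / (w + 1) * w < r" using r w by (simp add: field_simps)
      then show "\<exists>z\<in>\<real>\<^sub>\<ge>\<^sub>0. dist z ?T < r" using z by (intro bexI[of _ z]) (auto simp: dist_norm)
    qed
    then show ?thesis by (simp add: closure_closed)
  qed
qed

section \<open>The Laplacian of a plurisubharmonic function\<close>

theorem proposition3p7:
  fixes \<Omega> :: "'n::{finite,linorder} qspace set" and u :: "'n qspace \<Rightarrow> ereal"
  assumes "open \<Omega>" and "connected \<Omega>"
    and "u \<in> PSH \<Omega>" and "\<exists>x\<in>\<Omega>. u x \<noteq> - \<infinity>"
  defines "T \<equiv> laplace_current (current_of_form \<Omega> (zero_form u))"
  shows "loc_integrable_on \<Omega> u \<and> current \<Omega> 2 T \<and> closed_current \<Omega> 2 T \<and> positive_current \<Omega> 1 T"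
proof (intro conjI)
  show loc: "loc_integrable_on \<Omega> u" by (rule PSH_loc_integrable[OF assms(1-4)])
  show "current \<Omega> 2 T" unfolding T_def by (rule current_laplace[OF loc])
  show "closed_current \<Omega> 2 T" unfolding T_def by (rule closed_laplace)
  show "positive_current \<Omega> 1 T" unfolding T_def by (rule positive_laplace[OF assms(1,3) loc])
qed

end
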